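(* Let $W$ be a deterministic Wheeler graph with $m$ edges over an alphabet of size $\sigma$, let $|W|$ denote its total number of vertices and edges, let $k$ be a positive integer, and for $1\le\ell\le k$ let $n_\ell$ be the number of distinct $\ell$-mers contained in $W$. There exists a data structure for simulating navigation of the node-centric de Bruijn graph of the $k$-mers of $W$ which uses $$O\Big(n_k+|W|\,k\log\big(\max_{1\le\ell\le k} n_\ell\big)+\sigma\log m\Big)$$ bits of space, and which implements: retrieving the handle of a $k$-mer in $O(k\log\sigma)$ time; listing of outgoing labels (given the handle of a node) in $O(\log\sigma)$ time per label; and forward traversal (given the handle of a node and an outgoing label, returning the handle of the node reached) in $O(\log\sigma)$ time.
   Context: A labeled graph has a finite vertex set $V$ and an edge set $E\subseteq V\times V\times\Sigma$, where $\Sigma$ is a finite alphabet totally ordered by $\prec$; an edge $(u,v,a)$ goes from $u$ to $v$ and has label $a$. An $\ell$-mer is a string $\alpha\in\Sigma^\ell$. The graph contains $\alpha$, and $\alpha$ reaches the vertex $v_\ell$, if there is a walk $v_0,\dots,v_\ell$ with $(v_{i-1},v_i,\alpha[i])\in E$ for all $1\le i\le \ell$. Strings are compared co-lexicographically (right-to-left lexicographic order, "colex"). The graph is deterministic if no two distinct outgoing edges of the same vertex have the same label. It is a Wheeler graph if there is a total ordering $<$ of the nodes (a Wheeler order) such that nodes with no incoming edges precede those with positive indegree, and for every pair of edges $(u,v,a),(u',v',a')$: (W1) $a\prec a'\Rightarrow v<v'$; (W2) $(a=a'\wedge u<u')\Rightarrow v\le v'$. A Wheeler order is fixed. The node-centric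 de Bruijn graph of the $k$-mers of $W$ has one node for each distinct $k$-mer contained in $W$, and an edge labeled $c\in\Sigma$ from $b\alpha$ to $\alpha c$ (where $b\in\Sigma$, $|\alpha|=k-1$) whenever both are $k$-mers contained in $W$. The outgoing labels of a node are the labels of its outgoing edges. The handle of a $k$-mer $\alpha$ is the triple $(u,v,j)$, where $[u,v]$ is the maximal interval (in the Wheeler order) of vertices of $W$ that $\alpha$ reaches, and $j$ is the rank of $\alpha$ in the colex order of the distinct $k$-mers reaching the left endpoint $u$. Model of computation: Word RAM whose word size is large enough to hold the numbers handled, which are proportional to the maximum number of distinct $\ell$-mers in $W$ over $1\le\ell\le k$. *)

theory Defs
  imports Complex_Main
begin

section \<open>Labeled graphs and Wheeler graphs\<close>

text \<open>
  An edge \<^term>\<open>(u, v, a)\<close> goes from \<^term>\<open>u\<close> to \<^term>\<open>v\<close> and has label \<^term>\<open>a\<close>. The alphabet is an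
  explicit finite set, ordered by the order of the type of its letters. Vertices and letters are
  given by finite sets rather than finite types so that one choice of programs and constants can
  serve graphs and alphabets of all sizes: already with vertices and letters of type \<^typ>\<open>nat\<close>,
  all finite labeled graphs occur up to isomorphism.
\<close>

definition labeled_graph :: "'v set \<Rightarrow> 'a set \<Rightarrow> ('v \<times> 'v \<times> 'a) set \<Rightarrow> bool" where
  "labeled_graph V \<Sigma> E \<longleftrightarrow> finite V \<and> finite \<Sigma> \<and> E \<subseteq> V \<times> V \<times> \<Sigma>"

definition deterministic :: "('v \<times> 'v \<times> 'a) set \<Rightarrow> bool" where
  "deterministic E \<longleftrightarrow> (\<forall>u v v' a. (u, v, a) \<in> E \<and> (u, v', a) \<in> E \<longrightarrow> v = v')"

definition no_incoming :: "('v \<times> 'v \<times> 'a) set \<Rightarrow> 'v \<Rightarrow> bool" where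
  "no_incoming E v \<longleftrightarrow> (\<forall>u a. (u, v, a) \<notin> E)"

text \<open>The relation \<^term>\<open>le\<close> is the reflexive version of the Wheeler order.\<close>

definition wheeler_order ::
    "'v set \<Rightarrow> ('v \<times> 'v \<times> 'a::linorder) set \<Rightarrow> ('v \<times> 'v) set \<Rightarrow> bool" where
  "wheeler_order V E le \<longleftrightarrow>
     linear_order_on V le \<and>
     (\<forall>u\<in>V. \<forall>v\<in>V. no_incoming E u \<and> \<not> no_incoming E v \<longrightarrow> (u, v) \<in> le - Id) \<and>
     (\<forall>(u, v, a)\<in>E. \<forall>(u', v', a')\<in>E.
        (a < a' \<longrightarrow> (v, v') \<in> le - Id) \<and>
        (a = a' \<and> (u, u') \<in> le - Id \<longrightarrow> (v, v') \<in> le))"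


section \<open>Strings contained in a graph\<close>

definition reaches :: "('v \<times> 'v \<times> 'a) set \<Rightarrow> 'a list \<Rightarrow> 'v \<Rightarrow> bool" where
  "reaches E \<alpha> v \<longleftrightarrow>
     (\<exists>vs. length vs = length \<alpha> + 1 \<and>
           (\<forall>i < length \<alpha>. (vs ! i, vs ! (i + 1), \<alpha> ! i) \<in> E) \<and>
           vs ! length \<alpha> = v)"

text \<open>
  The distinct strings of length \<^term>\<open>l\<close> contained in the graph (used for \<^term>\<open>l \<ge> 1\<close>, where
  the letters and the vertices of the walk belong to the graph because the edges do).
\<close>

definition mers :: "('v \<times> 'v \<times> 'a) set \<Rightarrow> nat \<Rightarrow> 'a list set" where
  "mers E l = {\<alpha>. length \<alpha> = l \<and> (\<exists>v. reaches E \<alpha> v)}"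

definition num_mers :: "('v \<times> 'v \<times> 'a) set \<Rightarrow> nat \<Rightarrow> nat" where
  "num_mers E l = card (mers E l)"

definition max_mers :: "('v \<times> 'v \<times> 'a) set \<Rightarrow> nat \<Rightarrow> nat" where
  "max_mers E k = Max (num_mers E ` {1..k})"

definition colex_less :: "'a::linorder list \<Rightarrow> 'a list \<Rightarrow> bool" where
  "colex_less \<alpha> \<beta> \<longleftrightarrow> (rev \<alpha>, rev \<beta>) \<in> lexord {(a, b). a < b}"


section \<open>The node-centric de Bruijn graph and handles\<close>

text \<open>The nodes are the elements of \<^term>\<open>mers E k\<close>.\<close>

definition dbg_edges :: "('v \<times> 'v \<times> 'a) set \<Rightarrow> nat \<Rightarrow> ('a list \<times> 'a list \<times> 'a) set" where
  "dbg_edges E k =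
     {(b # \<alpha>, \<alpha> @ [c], c) | b \<alpha> c. b # \<alpha> \<in> mers E k \<and> \<alpha> @ [c] \<in> mers E k}"

definition out_labels :: "('v \<times> 'v \<times> 'a) set \<Rightarrow> nat \<Rightarrow> 'a list \<Rightarrow> 'a set" where
  "out_labels E k \<alpha> = {c. \<exists>\<beta>. (\<alpha>, \<beta>, c) \<in> dbg_edges E k}"

definition interval :: "('v \<times> 'v) set \<Rightarrow> 'v \<Rightarrow> 'v \<Rightarrow> 'v set" where
  "interval le u v = {x. (u, x) \<in> le \<and> (x, v) \<in> le}"

definition maximal_interval :: "('v \<times> 'v) set \<Rightarrow> 'v set \<Rightarrow> 'v \<Rightarrow> 'v \<Rightarrow> bool" where
  "maximal_interval le R u v \<longleftrightarrow>
     (u, v) \<in> le \<and> interval le u v \<subseteq> R \<and>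
     (\<forall>u' v'. interval le u v \<subseteq> interval le u' v' \<and> interval le u' v' \<subseteq> R \<longrightarrow>
        interval le u' v' = interval le u v)"

text \<open>
  In a Wheeler graph the vertices reached by a string form an interval, so a string contained in
  the graph has exactly one maximal interval. Ranks count from 1.
\<close>

definition handle ::
    "('v \<times> 'v \<times> 'a::linorder) set \<Rightarrow> ('v \<times> 'v) set \<Rightarrow> 'a list \<Rightarrow> 'v \<times> 'v \<times> nat" where
  "handle E le \<alpha> =
     (let (u, v) = (THE (u, v). maximal_interval le {x. reaches E \<alpha> x} u v)
      in (u, v, card {\<beta> \<in> mers E (length \<alpha>). reaches E \<beta> u \<and> (colex_less \<beta> \<alpha> \<or> \<beta> = \<alpha>)}))"


section \<open>Word RAM\<close>

text \<open>
  Words are natural numbers below \<open>2 ^ w\<close>. A program is fixed independently of its input and of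
  \<^term>\<open>w\<close>, hence uses finitely many registers. Structured control flow replaces jumps. Every
  executed instruction and every evaluated test takes one unit of time.
\<close>

datatype binop = Add | Sub | Mul | Div | Mod | And | Or | Xor | Shl | Shr | Lt | Eq

fun eval_binop :: "nat \<Rightarrow> binop \<Rightarrow> nat \<Rightarrow> nat \<Rightarrow> nat" where
  "eval_binop w Add x y = take_bit w (x + y)"
| "eval_binop w Sub x y = nat (take_bit w (int x - int y))"
| "eval_binop w Mul x y = take_bit w (x * y)"
| "eval_binop w Div x y = take_bit w (x div y)"
| "eval_binop w Mod x y = take_bit w (x mod y)"
| "eval_binop w And x y = take_bit w (Bit_Operations.and x y)"
| "eval_binop w Or x y = take_bit w (Bit_Operations.or x y)"
| "eval_binop w Xor x y = take_bit w (Bit_Operations.xor x y)"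
| "eval_binop w Shl x y = take_bit w (push_bit y x)"
| "eval_binop w Shr x y = take_bit w (drop_bit y x)"
| "eval_binop w Lt x y = take_bit w (of_bool (x < y))"
| "eval_binop w Eq x y = take_bit w (of_bool (x = y))"

text \<open>
  The operands are register numbers: \<^term>\<open>Load r a\<close> and \<^term>\<open>Store a r\<close> access the memory cell
  whose address is the content of register \<^term>\<open>a\<close>, and tests ask whether a register is nonzero.
\<close>

datatype com =
    Const nat nat
  | Op binop nat nat nat
  | Load nat nat
  | Store nat nat
  | Emit nat
  | Skip
  | Seq com com
  | If nat com com
  | While nat com

record ram =
  regs :: "nat \<Rightarrow> nat"
  mem :: "nat \<Rightarrow> nat"
  outp :: "nat list"

inductive exec :: "nat \<Rightarrow> com \<Rightarrow> ram \<Rightarrow> nat \<Rightarrow> ram \<Rightarrow> bool" for w where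
  Const: "exec w (Const r n) s 1 (s\<lparr>regs := (regs s)(r := take_bit w n)\<rparr>)"
| Op: "exec w (Op f r p q) s 1 (s\<lparr>regs := (regs s)(r := eval_binop w f (regs s p) (regs s q))\<rparr>)"
| Load: "exec w (Load r a) s 1 (s\<lparr>regs := (regs s)(r := mem s (regs s a))\<rparr>)"
| Store: "exec w (Store a r) s 1 (s\<lparr>mem := (mem s)(regs s a := regs s r)\<rparr>)"
| Emit: "exec w (Emit r) s 1 (s\<lparr>outp := outp s @ [regs s r]\<rparr>)"
| Skip: "exec w Skip s 1 s"
| Seq: "exec w c s t s' \<Longrightarrow> exec w d s' t' s'' \<Longrightarrow> exec w (Seq c d) s (t + t') s''"
| IfTrue: "regs s r \<noteq> 0 \<Longrightarrow> exec w c s t s' \<Longrightarrow> exec w (If r c d) s (t + 1) s'"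
| IfFalse: "regs s r = 0 \<Longrightarrow> exec w d s t s' \<Longrightarrow> exec w (If r c d) s (t + 1) s'"
| WhileTrue: "regs s r \<noteq> 0 \<Longrightarrow> exec w c s t s' \<Longrightarrow> exec w (While r c) s' t' s'' \<Longrightarrow>
    exec w (While r c) s (t + t' + 1) s''"
| WhileFalse: "regs s r = 0 \<Longrightarrow> exec w (While r c) s 1 s"

text \<open>
  A data structure is a bit string. It is packed into \<open>\<lceil>length D / w\<rceil>\<close> words from address 0 on, least
  significant bit first; the words of the query follow, and the rest of the memory is zero. At
  the start register 0 holds the address of the query and register 1 the word size.
\<close>

definition num_words :: "nat \<Rightarrow> bool list \<Rightarrow> nat" where
  "num_words w D = (length D + w - 1) div w"

definition packed_word :: "nat \<Rightarrow> bool list \<Rightarrow> nat \<Rightarrow> nat" where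
  "packed_word w D i = horner_sum of_bool 2 (take w (drop (i * w) D))"

definition initial :: "nat \<Rightarrow> bool list \<Rightarrow> nat list \<Rightarrow> ram" where
  "initial w D xs = (let N = num_words w D in
     \<lparr>regs = (\<lambda>_. 0)(0 := take_bit w N, 1 := take_bit w w),
      mem = (\<lambda>i. if i < N then packed_word w D i
                 else if i < N + length xs then take_bit w (xs ! (i - N)) else 0),
      outp = []\<rparr>)"

definition answers :: "nat \<Rightarrow> com \<Rightarrow> bool list \<Rightarrow> nat list \<Rightarrow> nat list \<Rightarrow> nat \<Rightarrow> bool" where
  "answers w p D xs ys t \<longleftrightarrow> (\<exists>s. exec w p (initial w D xs) t s \<and> outp s = ys)"

text \<open>Letters and vertices are passed as their ranks, counted from 1.\<close>

definition letter_code :: "'a::linorder set \<Rightarrow> 'a \<Rightarrow> nat" where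
  "letter_code \<Sigma> a = card {b \<in> \<Sigma>. b \<le> a}"

definition vertex_code :: "('v \<times> 'v) set \<Rightarrow> 'v \<Rightarrow> nat" where
  "vertex_code le v = card {x. (x, v) \<in> le}"

definition handle_code :: "('v \<times> 'v) set \<Rightarrow> 'v \<times> 'v \<times> nat \<Rightarrow> nat list" where
  "handle_code le h = (case h of (u, v, j) \<Rightarrow> [vertex_code le u, vertex_code le v, j])"

text \<open>
  The logarithm of asymptotic bounds: a bound such as \<open>O(log \<sigma>)\<close> is not meant to vanish (or to be
  undefined) when its argument is at most 1.
\<close>

definition lg :: "nat \<Rightarrow> real" where
  "lg n = (if n \<le> 2 then 1 else log 2 (real n))"

end

theory Submission
  imports Defs
begin

text \<open>
  The strings of length \<open>l\<close> reaching a vertex are consecutive in colex order, and consecutive vertices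
  share at most one of them. Hence there are at most \<open>min n\<^sub>l (3 |V|)\<close> sets of vertices reached by strings of
  length \<open>l\<close>, each vertex lies in at most three of them, and they have at most \<open>3 m\<close> outgoing labels altogether;
  all of this can be tabulated for every \<open>l \<le> k\<close> with \<open>O(log max n\<^sub>l)\<close> bits per entry. Such an entry says which
  interval \<open>\<gamma>c\<close> has and how its rank at the left end of that interval follows from the rank of \<open>\<gamma>\<close>: the new
  rank is a number that depends only on the interval of \<open>\<gamma>\<close> and on \<open>c\<close>, plus the old rank if the leftmost vertex
  with an edge labeled \<open>c\<close> is the left end of the interval. This gives the handle of a string letter by letter.

  For an edge of the de Bruijn graph the first letter has to be dropped. The interval of the suffix is
  found by comparing the rank of the handle with two thresholds stored at its vertex. The rank of the
  suffix among those \<open>(k-1)\<close>-mers that can be extended to the right is a monotone function of the global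
  rank of the \<open>k\<close>-mer, between sets of size at most \<open>n\<^sub>k\<close>; a two-level directory with a table for the remaining
  tiny blocks evaluates it in constant time from \<open>O(n\<^sub>k)\<close> bits.
\<close>

section \<open>Expressions on the word RAM\<close>

text \<open>Two obstacles shape the construction. First, names of vertices, edges and letters may
  need many more bits than \<open>log M\<close>, where \<open>M\<close> is the largest number of
  \<open>l\<close>-mers. Hence intervals and used letters are numbered afresh, with at most
  \<open>M\<close> numbers for each length. Larger numbers occur only in tables with at most
  \<open>min M (3 |V|)\<close> records per length. Second, the (k-1)-mers may outnumber the k-mers,
  because those reaching only vertices without outgoing edges have no extension; plain ranks of
  suffixes would then not fit into \<open>O(n_k)\<close> bits. Ranks among extendable strings
  suffice, since the old rank enters the new one only if the letter leaves the left end of the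
  interval. In that case every (k-1)-mer reaching this left end is extendable by the letter; in all
  other cases the computed rank is multiplied by 0. Overflow is excluded uniformly: each array is
  part of a bit string shorter than \<open>2 ^ w\<close>, so its length bounds all indices and
  addresses that refer to it.\<close>

datatype ex = Num nat | Var nat | Bin binop ex ex | Cell ex

fun ev :: "nat \<Rightarrow> (nat \<Rightarrow> nat) \<Rightarrow> (nat \<Rightarrow> nat) \<Rightarrow> ex \<Rightarrow> nat" where
  "ev w \<mu> \<rho> (Num n) = take_bit w n"
| "ev w \<mu> \<rho> (Var r) = \<rho> r"
| "ev w \<mu> \<rho> (Bin f a b) = eval_binop w f (ev w \<mu> \<rho> a) (ev w \<mu> \<rho> b)"
| "ev w \<mu> \<rho> (Cell a) = \<mu> (ev w \<mu> \<rho> a)"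

text \<open>The registers from \<open>t\<close> upwards act as an evaluation stack, whose depth
  depends on the program text only. A move is the \<open>Or\<close> of a register with itself; it is
  faithful because register contents stay below \<open>2 ^ w\<close>.\<close>

fun compile :: "nat \<Rightarrow> ex \<Rightarrow> com" where
  "compile t (Num n) = Const t n"
| "compile t (Var r) = Op Or t r r"
| "compile t (Bin f a b) = Seq (compile t a) (Seq (compile (Suc t) b) (Op f t t (Suc t)))"
| "compile t (Cell a) = Seq (compile t a) (Load t t)"

fun cost :: "ex \<Rightarrow> nat" where
  "cost (Num n) = 1"
| "cost (Var r) = 1"
| "cost (Bin f a b) = cost a + (cost b + 1)"
| "cost (Cell a) = cost a + 1"

fun vars :: "ex \<Rightarrow> nat set" where
  "vars (Num n) = {}"
| "vars (Var r) = {r}"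
| "vars (Bin f a b) = vars a \<union> vars b"
| "vars (Cell a) = vars a"

lemma eval_binop_less: "eval_binop w f x y < 2 ^ w"
proof -
  have "nat (take_bit w z) < 2 ^ w" for z :: int
    using take_bit_int_less_exp [of w z] take_bit_nonnegative [of w z] by (simp add: nat_less_iff)
  then show ?thesis by (cases f) (auto simp flip: take_bit_and take_bit_or take_bit_xor)
qed

lemma ev_less:
  assumes "\<forall>r\<in>vars e. \<rho> r < 2 ^ w" "\<forall>i. \<mu> i < 2 ^ w"
  shows "ev w \<mu> \<rho> e < 2 ^ w"
  using assms by (induction e) (auto intro: eval_binop_less)

lemma ev_cong: "\<forall>r\<in>vars e. \<rho> r = \<rho>' r \<Longrightarrow> ev w \<mu> \<rho> e = ev w \<mu> \<rho>' e"
  by (induction e) auto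

lemma exec_compile:
  assumes "\<forall>r\<in>vars e. r < t \<and> regs s r < 2 ^ w"
  shows "\<exists>s'. exec w (compile t e) s (cost e) s' \<and> regs s' t = ev w (mem s) (regs s) e \<and>
     (\<forall>r<t. regs s' r = regs s r) \<and> mem s' = mem s \<and> outp s' = outp s"
  using assms
proof (induction e arbitrary: t s)
  case (Num n)
  then show ?case using exec.Const[of w t n s] by (intro exI[of _ "s\<lparr>regs := (regs s)(t := take_bit w n)\<rparr>"]) auto
next
  case (Var r)
  then have "take_bit w (regs s r) = regs s r" by (simp add: take_bit_nat_eq_self)
  then show ?case using exec.Op[of w Or t r r s]
    by (intro exI[of _ "s\<lparr>regs := (regs s)(t := eval_binop w Or (regs s r) (regs s r))\<rparr>"]) auto
next
  case (Bin f a b)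
  from Bin.IH(1)[of t s] Bin.prems obtain s1 where s1: "exec w (compile t a) s (cost a) s1"
    "regs s1 t = ev w (mem s) (regs s) a" "\<forall>r<t. regs s1 r = regs s r" "mem s1 = mem s" "outp s1 = outp s"
    by auto
  have "\<forall>r\<in>vars b. r < Suc t \<and> regs s1 r < 2 ^ w"
    using Bin.prems s1(3) by (simp add: less_SucI)
  from Bin.IH(2)[OF this] obtain s2 where s2: "exec w (compile (Suc t) b) s1 (cost b) s2"
    "regs s2 (Suc t) = ev w (mem s1) (regs s1) b" "\<forall>r<Suc t. regs s2 r = regs s1 r"
    "mem s2 = mem s1" "outp s2 = outp s1" by auto
  have b: "ev w (mem s1) (regs s1) b = ev w (mem s) (regs s) b"
    using Bin.prems s1(3,4) by (auto intro: ev_cong)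
  have "exec w (compile t (Bin f a b)) s (cost (Bin f a b))
     (s2\<lparr>regs := (regs s2)(t := eval_binop w f (regs s2 t) (regs s2 (Suc t)))\<rparr>)"
    by (simp only: compile.simps cost.simps) (rule exec.Seq[OF s1(1) exec.Seq[OF s2(1) exec.Op]])
  moreover have "\<forall>r<t. regs s2 r = regs s1 r" "regs s2 t = regs s1 t" using s2(3) by auto
  ultimately show ?case using s1 s2 b
    by (intro exI[of _ "s2\<lparr>regs := (regs s2)(t := eval_binop w f (regs s2 t) (regs s2 (Suc t)))\<rparr>"]) auto
next
  case (Cell a)
  from Cell.IH[of t s] Cell.prems obtain s1 where s1: "exec w (compile t a) s (cost a) s1"
    "regs s1 t = ev w (mem s) (regs s) a" "\<forall>r<t. regs s1 r = regs s r" "mem s1 = mem s" "outp s1 = outp s"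
    by auto
  have "exec w (compile t (Cell a)) s (cost (Cell a)) (s1\<lparr>regs := (regs s1)(t := mem s1 (regs s1 t))\<rparr>)"
    by (simp only: compile.simps cost.simps) (rule exec.Seq[OF s1(1) exec.Load])
  then show ?case using s1
    by (intro exI[of _ "s1\<lparr>regs := (regs s1)(t := mem s1 (regs s1 t))\<rparr>"]) auto
qed

section \<open>Total correctness with time bounds\<close>

text \<open>Registers from \<^term>\<open>nvars\<close> on are scratch space for evaluating expressions.\<close>

definition nvars :: nat where "nvars = 32"

text \<open>Queries never store, so the memory is one fixed function and a state reduces to the
  program variables and the output.\<close>

definition represents :: "nat \<Rightarrow> (nat \<Rightarrow> nat) \<Rightarrow> ram \<Rightarrow> (nat \<Rightarrow> nat) \<times> nat list \<Rightarrow> bool" where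
  "represents w \<mu> s st \<longleftrightarrow> (\<forall>r<nvars. regs s r = fst st r \<and> fst st r < 2 ^ w) \<and> (\<forall>i. \<mu> i < 2 ^ w) \<and>
     mem s = \<mu> \<and> outp s = snd st"

definition tot :: "nat \<Rightarrow> (nat \<Rightarrow> nat) \<Rightarrow> com \<Rightarrow> nat \<Rightarrow> (nat \<Rightarrow> nat) \<times> nat list \<Rightarrow>
    ((nat \<Rightarrow> nat) \<times> nat list \<Rightarrow> bool) \<Rightarrow> bool" where
  "tot w \<mu> c t st Q \<longleftrightarrow> (\<forall>s. represents w \<mu> s st \<longrightarrow>
     (\<exists>t' s' st'. exec w c s t' s' \<and> t' \<le> t \<and> represents w \<mu> s' st' \<and> Q st'))"

definition asg :: "nat \<Rightarrow> ex \<Rightarrow> com" where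
  "asg v e = Seq (compile nvars e) (Op Or v nvars nvars)"

definition emit :: "ex \<Rightarrow> com" where
  "emit e = Seq (compile nvars e) (Emit nvars)"

lemma tot_weaken:
  assumes "tot w \<mu> c t st Q" "t \<le> t'" "\<And>st'. Q st' \<Longrightarrow> Q' st'"
  shows "tot w \<mu> c t' st Q'"
  unfolding tot_def
proof (intro allI impI)
  fix s assume "represents w \<mu> s st"
  with assms(1) obtain t1 s1 st1 where "exec w c s t1 s1" "t1 \<le> t" "represents w \<mu> s1 st1" "Q st1"
    unfolding tot_def by blast
  with assms(2,3) show "\<exists>t'' s' st'. exec w c s t'' s' \<and> t'' \<le> t' \<and> represents w \<mu> s' st' \<and> Q' st'"
    by (intro exI[of _ t1] exI[of _ s1] exI[of _ st1]) simp
qed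

lemma tot_Seq:
  assumes "tot w \<mu> c t st R" "\<And>st'. R st' \<Longrightarrow> tot w \<mu> d t' st' Q"
  shows "tot w \<mu> (Seq c d) (t + t') st Q"
  unfolding tot_def
proof (intro allI impI)
  fix s assume "represents w \<mu> s st"
  with assms(1) obtain t1 s1 st1 where 1: "exec w c s t1 s1" "t1 \<le> t" "represents w \<mu> s1 st1" "R st1"
    unfolding tot_def by blast
  from assms(2)[OF 1(4)] 1(3) obtain t2 s2 st2 where
    2: "exec w d s1 t2 s2" "t2 \<le> t'" "represents w \<mu> s2 st2" "Q st2"
    unfolding tot_def by blast
  from exec.Seq[OF 1(1) 2(1)] have "exec w (Seq c d) s (t1 + t2) s2" .
  moreover have "t1 + t2 \<le> t + t'" using 1 2 by simp
  ultimately show "\<exists>t'' s' st'. exec w (Seq c d) s t'' s' \<and> t'' \<le> t + t' \<and> represents w \<mu> s' st' \<and> Q st'"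
    using 2 by blast
qed

inductive_cases exec_SeqE: "exec w (Seq c d) s t s'"

text \<open>Programs are nested to the right, but a loop is verified together with the test that
  precedes it; this changes between the two bracketings without changing the time.\<close>

lemma tot_assoc:
  assumes "tot w \<mu> (Seq (Seq b c) d) t st Q"
  shows "tot w \<mu> (Seq b (Seq c d)) t st Q"
  unfolding tot_def
proof (intro allI impI)
  fix s assume "represents w \<mu> s st"
  with assms obtain t1 s1 st1 where *: "exec w (Seq (Seq b c) d) s t1 s1" "t1 \<le> t" "represents w \<mu> s1 st1" "Q st1"
    unfolding tot_def by blast
  from *(1) obtain ta tb tc sa sb where "exec w b s ta sa" "exec w c sa tb sb" "exec w d sb tc s1" "t1 = ta + tb + tc"
    by (elim exec_SeqE) blast
  then have "exec w (Seq b (Seq c d)) s t1 s1"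
    using exec.Seq[of w b s ta sa "Seq c d" "tb + tc" s1] exec.Seq[of w c sa tb sb d tc s1] by (simp add: add.assoc)
  with * show "\<exists>t' s' st'. exec w (Seq b (Seq c d)) s t' s' \<and> t' \<le> t \<and> represents w \<mu> s' st' \<and> Q st'" by blast
qed

lemma exec_compile_represents:
  assumes "represents w \<mu> s (\<rho>, out)" "\<forall>r\<in>vars e. r < nvars"
  shows "\<exists>s'. exec w (compile nvars e) s (cost e) s' \<and> regs s' nvars = ev w \<mu> \<rho> e \<and>
    ev w \<mu> \<rho> e < 2 ^ w \<and> represents w \<mu> s' (\<rho>, out)"
proof -
  have "\<forall>r\<in>vars e. r < nvars \<and> regs s r < 2 ^ w"
    using assms by (auto simp: represents_def)
  from exec_compile[OF this] obtain s' where s': "exec w (compile nvars e) s (cost e) s'"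
    "regs s' nvars = ev w (mem s) (regs s) e" "\<forall>r<nvars. regs s' r = regs s r"
    "mem s' = mem s" "outp s' = outp s" by blast
  moreover have "ev w (mem s) (regs s) e = ev w \<mu> \<rho> e"
    using assms by (auto simp: represents_def intro: ev_cong)
  moreover have "ev w \<mu> \<rho> e < 2 ^ w"
    by (rule ev_less) (use assms in \<open>auto simp: represents_def\<close>)
  moreover have "represents w \<mu> s' (\<rho>, out)"
    using s' assms by (simp add: represents_def)
  ultimately show ?thesis by auto
qed

lemma tot_asg:
  assumes "v < nvars" "\<forall>r\<in>vars e. r < nvars" "ev w \<mu> \<rho> e = x" "Q (\<rho>(v := x), out)"
  shows "tot w \<mu> (asg v e) (cost e + 1) (\<rho>, out) Q"
  unfolding tot_def
proof (intro allI impI)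
  fix s assume "represents w \<mu> s (\<rho>, out)"
  from exec_compile_represents[OF this assms(2)] obtain s' where
    s': "exec w (compile nvars e) s (cost e) s'" "regs s' nvars = x" "x < 2 ^ w" "represents w \<mu> s' (\<rho>, out)"
    using assms(3) by auto
  have "exec w (asg v e) s (cost e + 1)
      (s'\<lparr>regs := (regs s')(v := eval_binop w Or (regs s' nvars) (regs s' nvars))\<rparr>)"
    unfolding asg_def by (rule exec.Seq[OF s'(1) exec.Op])
  moreover have "represents w \<mu> (s'\<lparr>regs := (regs s')(v := eval_binop w Or (regs s' nvars) (regs s' nvars))\<rparr>)
      (\<rho>(v := x), out)"
    using s' by (auto simp: represents_def take_bit_nat_eq_self)
  ultimately show "\<exists>t' s' st'. exec w (asg v e) s t' s' \<and> t' \<le> cost e + 1 \<and> represents w \<mu> s' st' \<and> Q st'"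
    using assms(4) by blast
qed

lemma tot_Seq_asg:
  assumes "v < nvars" "\<forall>r\<in>vars e. r < nvars" "ev w \<mu> \<rho> e = x" "tot w \<mu> d t (\<rho>(v := x), out) Q"
  shows "tot w \<mu> (Seq (asg v e) d) (cost e + 1 + t) (\<rho>, out) Q"
  by (rule tot_Seq[where R = "\<lambda>st. st = (\<rho>(v := x), out)"], rule tot_asg) (use assms in auto)

lemma tot_emit:
  assumes "\<forall>r\<in>vars e. r < nvars" "ev w \<mu> \<rho> e = x" "Q (\<rho>, out @ [x])"
  shows "tot w \<mu> (emit e) (cost e + 1) (\<rho>, out) Q"
  unfolding tot_def
proof (intro allI impI)
  fix s assume "represents w \<mu> s (\<rho>, out)"
  from exec_compile_represents[OF this assms(1)] obtain s' where
    s': "exec w (compile nvars e) s (cost e) s'" "regs s' nvars = x" "x < 2 ^ w" "represents w \<mu> s' (\<rho>, out)"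
    using assms(2) by auto
  have "exec w (emit e) s (cost e + 1) (s'\<lparr>outp := outp s' @ [regs s' nvars]\<rparr>)"
    unfolding emit_def by (rule exec.Seq[OF s'(1) exec.Emit])
  moreover have "represents w \<mu> (s'\<lparr>outp := outp s' @ [regs s' nvars]\<rparr>) (\<rho>, out @ [x])"
    using s' by (auto simp: represents_def)
  ultimately show "\<exists>t' s' st'. exec w (emit e) s t' s' \<and> t' \<le> cost e + 1 \<and> represents w \<mu> s' st' \<and> Q st'"
    using assms(3) by blast
qed

lemma tot_If:
  assumes "v < nvars" "\<rho> v \<noteq> 0 \<Longrightarrow> tot w \<mu> c t (\<rho>, out) Q" "\<rho> v = 0 \<Longrightarrow> tot w \<mu> d t (\<rho>, out) Q"
  shows "tot w \<mu> (If v c d) (t + 1) (\<rho>, out) Q"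
  unfolding tot_def
proof (intro allI impI)
  fix s assume s: "represents w \<mu> s (\<rho>, out)"
  then have v: "regs s v = \<rho> v" using assms(1) by (simp add: represents_def)
  show "\<exists>t' s' st'. exec w (If v c d) s t' s' \<and> t' \<le> t + 1 \<and> represents w \<mu> s' st' \<and> Q st'"
  proof (cases "\<rho> v = 0")
    case True
    with assms(3) s obtain t' s' st' where "exec w d s t' s'" "t' \<le> t" "represents w \<mu> s' st'" "Q st'"
      unfolding tot_def by blast
    with True v exec.IfFalse[of s v w d t' s' c] show ?thesis
      by (intro exI[of _ "t' + 1"] exI[of _ s'] exI[of _ st']) simp
  next
    case False
    with assms(2) s obtain t' s' st' where "exec w c s t' s'" "t' \<le> t" "represents w \<mu> s' st'" "Q st'"
      unfolding tot_def by blast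
    with False v exec.IfTrue[of s v w c t' s' d] show ?thesis
      by (intro exI[of _ "t' + 1"] exI[of _ s'] exI[of _ st']) simp
  qed
qed

text \<open>The index of the invariant bounds the iterations that remain. The loop may end before
  the index reaches 0, as binary search does on short ranges.\<close>

lemma tot_While:
  assumes "v < nvars" "I (n::nat) st"
    and "\<And>n st. I n st \<Longrightarrow> fst st v = 0 \<Longrightarrow> Q st"
    and "\<And>n st. I n st \<Longrightarrow> fst st v \<noteq> 0 \<Longrightarrow> n > 0 \<and> tot w \<mu> c t st (I (n - 1))"
  shows "tot w \<mu> (While v c) (n * (t + 1) + 1) st Q"
  using assms(2)
proof (induction n arbitrary: st)
  case (0 st)
  show ?case unfolding tot_def
  proof (intro allI impI)
    fix s assume s: "represents w \<mu> s st"
    have "fst st v = 0" using 0 assms(4) by blast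
    moreover from this have "regs s v = 0" using s assms(1) by (simp add: represents_def)
    ultimately show "\<exists>t' s' st'. exec w (While v c) s t' s' \<and> t' \<le> 0 * (t + 1) + 1 \<and> represents w \<mu> s' st' \<and> Q st'"
      using exec.WhileFalse[of s v w c] s assms(3)[OF 0]
      by (intro exI[of _ 1] exI[of _ s] exI[of _ st]) auto
  qed
next
  case (Suc n st)
  show ?case unfolding tot_def
  proof (intro allI impI)
    fix s assume s: "represents w \<mu> s st"
    then have v: "regs s v = fst st v" using assms(1) by (simp add: represents_def)
    show "\<exists>t' s' st'. exec w (While v c) s t' s' \<and> t' \<le> Suc n * (t + 1) + 1 \<and> represents w \<mu> s' st' \<and> Q st'"
    proof (cases "fst st v = 0")
      case True
      then show ?thesis using v exec.WhileFalse[of s v w c] s assms(3)[OF Suc.prems]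
        by (intro exI[of _ 1] exI[of _ s] exI[of _ st]) auto
    next
      case False
      from assms(4)[OF Suc.prems False] s obtain t1 s1 st1 where
        1: "exec w c s t1 s1" "t1 \<le> t" "represents w \<mu> s1 st1" "I n st1"
        unfolding tot_def by auto
      from Suc.IH[OF 1(4)] 1(3) obtain t2 s2 st2 where
        2: "exec w (While v c) s1 t2 s2" "t2 \<le> n * (t + 1) + 1" "represents w \<mu> s2 st2" "Q st2"
        unfolding tot_def by blast
      have "exec w (While v c) s (t1 + t2 + 1) s2"
        by (rule exec.WhileTrue) (use False v 1 2 in auto)
      moreover have "t1 + t2 + 1 \<le> Suc n * (t + 1) + 1" using 1 2 by simp
      ultimately show ?thesis using 2 by blast
    qed
  qed
qed

section \<open>Word arithmetic without overflow\<close>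

lemma ev_arith:
  assumes "ev w \<mu> \<rho> a = x" "ev w \<mu> \<rho> b = y"
  shows ev_Add: "x + y < 2 ^ w \<Longrightarrow> ev w \<mu> \<rho> (Bin Add a b) = x + y"
    and ev_Mul: "x * y < 2 ^ w \<Longrightarrow> ev w \<mu> \<rho> (Bin Mul a b) = x * y"
    and ev_Sub: "y \<le> x \<Longrightarrow> x < 2 ^ w \<Longrightarrow> ev w \<mu> \<rho> (Bin Sub a b) = x - y"
    and ev_Div: "x < 2 ^ w \<Longrightarrow> ev w \<mu> \<rho> (Bin Div a b) = x div y"
    and ev_Mod: "x < 2 ^ w \<Longrightarrow> ev w \<mu> \<rho> (Bin Mod a b) = x mod y"
    and ev_Lt: "w > 0 \<Longrightarrow> ev w \<mu> \<rho> (Bin Lt a b) = of_bool (x < y)"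
proof -
  have self: "take_bit w z = z" if "z < 2 ^ w" for z :: nat
    using that by (rule take_bit_nat_eq_self)
  have bool: "(of_bool p :: nat) < 2 ^ w" if "w > 0" for p
    using that one_less_power[of "2 :: nat" w] by (cases p) auto
  show "ev w \<mu> \<rho> (Bin Add a b) = x + y" if "x + y < 2 ^ w"
    by (simp only: ev.simps eval_binop.simps assms self[OF that])
  show "ev w \<mu> \<rho> (Bin Mul a b) = x * y" if "x * y < 2 ^ w"
    by (simp only: ev.simps eval_binop.simps assms self[OF that])
  show "ev w \<mu> \<rho> (Bin Lt a b) = of_bool (x < y)" if "w > 0"
    by (simp only: ev.simps eval_binop.simps assms self[OF bool[OF that]])
  show "ev w \<mu> \<rho> (Bin Div a b) = x div y" if "x < 2 ^ w"
    by (simp only: ev.simps eval_binop.simps assms self[OF le_less_trans[OF div_le_dividend that]])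
  show "ev w \<mu> \<rho> (Bin Mod a b) = x mod y" if "x < 2 ^ w"
    by (simp only: ev.simps eval_binop.simps assms self[OF le_less_trans[OF mod_less_eq_dividend that]])
  show "ev w \<mu> \<rho> (Bin Sub a b) = x - y" if "y \<le> x" "x < 2 ^ w"
  proof -
    have "int x - int y = int (x - y)" using that by simp
    then show ?thesis
      using self[of "x - y"] that by (simp only: ev.simps eval_binop.simps assms take_bit_of_nat nat_int)
  qed
qed

section \<open>Reading bit fields\<close>

definition field :: "bool list \<Rightarrow> nat \<Rightarrow> nat \<Rightarrow> nat" where
  "field D p b = horner_sum of_bool 2 (take b (drop p D))"

definition bits :: "nat \<Rightarrow> nat \<Rightarrow> bool list" where
  "bits b x = map (bit x) [0..<b]"

lemma length_bits [simp]: "length (bits b x) = b"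
  by (simp add: bits_def)

lemma bit_field: "bit (field D p b) n \<longleftrightarrow> n < b \<and> p + n < length D \<and> D ! (p + n)"
  by (auto simp: field_def bit_horner_sum_bit_iff)

lemma field_less: "field D p b < 2 ^ b"
proof -
  have "take_bit b (field D p b) = field D p b"
    by (simp add: field_def take_bit_horner_sum_bit_eq)
  then show ?thesis by (metis take_bit_nat_less_exp)
qed

lemma field_append: "p = length xs + q \<Longrightarrow> field (xs @ ys) p b = field ys q b"
  by (simp add: field_def)

lemma field_append_left: "p + b \<le> length xs \<Longrightarrow> field (xs @ ys) p b = field xs p b"
  by (simp add: field_def)

lemma field_bits: "x < 2 ^ b \<Longrightarrow> field (bits b x @ ys) 0 b = x"
  by (simp add: field_def bits_def horner_sum_bit_eq_take_bit take_bit_nat_eq_self)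

definition enc :: "nat \<times> nat list \<Rightarrow> bool list" where
  "enc a = concat (map (bits (fst a)) (snd a))"

lemma length_enc: "length (enc (b, xs)) = b * length xs"
  by (induction xs) (auto simp: enc_def)

lemma field_enc:
  assumes "i < length xs" "\<forall>x\<in>set xs. x < 2 ^ b"
  shows "field (enc (b, xs)) (i * b) b = xs ! i"
  using assms
proof (induction xs arbitrary: i)
  case (Cons x xs)
  have e: "enc (b, x # xs) = bits b x @ enc (b, xs)" by (simp add: enc_def)
  show ?case
  proof (cases i)
    case 0
    then show ?thesis using Cons.prems by (simp add: e field_bits)
  next
    case (Suc j)
    have "field (enc (b, x # xs)) (i * b) b = field (enc (b, xs)) (j * b) b"
      unfolding e by (rule field_append) (simp add: Suc)
    then show ?thesis using Suc Cons by simp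
  qed
qed simp

lemma enc_of_bool: "enc (1, map of_bool bs) = bs"
  by (induction bs) (auto simp: enc_def bits_def bit_1_iff[of "0", where ?'a = nat, simplified])

abbreviation wsize :: ex where "wsize \<equiv> Var 1"

text \<open>A field may straddle two words.\<close>

definition rd :: "ex \<Rightarrow> ex \<Rightarrow> ex" where
  "rd p b = Bin Mod
     (Bin Or (Bin Shr (Cell (Bin Div p wsize)) (Bin Mod p wsize))
             (Bin Shl (Cell (Bin Add (Bin Div p wsize) (Num 1))) (Bin Sub wsize (Bin Mod p wsize))))
     (Bin Shl (Num 1) b)"

lemma vars_rd: "vars (rd p b) = vars p \<union> vars b \<union> {1}"
  by (auto simp: rd_def)

lemma less_num_words: "w > 0 \<Longrightarrow> i < num_words w D \<longleftrightarrow> i * w < length D"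
proof -
  assume w: "w > 0"
  have "i < num_words w D \<longleftrightarrow> Suc i * w \<le> length D + w - 1"
    using less_eq_div_iff_mult_less_eq[OF w, of "Suc i" "length D + w - 1"]
    unfolding num_words_def by (simp only: Suc_le_eq)
  also have "\<dots> \<longleftrightarrow> i * w < length D" using w by auto
  finally show ?thesis .
qed

lemma bit_packed_word: "bit (packed_word w D i) n \<longleftrightarrow> n < w \<and> i * w + n < length D \<and> D ! (i * w + n)"
  using bit_field[of D "i * w" w n] by (simp add: packed_word_def field_def)

text \<open>Bits above the field, possibly from a word outside the data structure, are removed by
  the final \<open>Mod\<close>. If the field starts at a word boundary, the second word is shifted
  by \<open>w\<close> and vanishes.\<close>

lemma ev_rd:
  assumes p: "ev w \<mu> \<rho> p = P" and b: "ev w \<mu> \<rho> b = \<beta>" and w: "\<rho> 1 = w"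
    and P: "P + \<beta> \<le> length D" and D: "length D + 1 < 2 ^ w" and \<beta>: "\<beta> < w"
    and \<mu>: "\<forall>i < num_words w D. \<mu> i = packed_word w D i"
  shows "ev w \<mu> \<rho> (rd p b) = field D P \<beta>"
proof -
  have w0: "w > 0" using \<beta> by simp
  have ww: "w < 2 ^ w" by (rule less_exp)
  have w1: "ev w \<mu> \<rho> wsize = w" using w by simp
  have P2: "P < 2 ^ w" using P D by simp
  have one: "take_bit w (1::nat) = 1" using w0 one_less_power[of "2 :: nat" w]
    by (intro take_bit_nat_eq_self) auto
  have d: "ev w \<mu> \<rho> (Bin Div p wsize) = P div w" by (rule ev_Div[OF p w1 P2])
  have m: "ev w \<mu> \<rho> (Bin Mod p wsize) = P mod w" by (rule ev_Mod[OF p w1 P2])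
  have a: "ev w \<mu> \<rho> (Bin Add (Bin Div p wsize) (Num 1)) = P div w + 1"
  proof (rule ev_Add[OF d])
    show "ev w \<mu> \<rho> (Num 1) = 1" using one by simp
    have "P div w \<le> P" by (rule div_le_dividend)
    then show "P div w + 1 < 2 ^ w" using P D by linarith
  qed
  have s: "ev w \<mu> \<rho> (Bin Sub wsize (Bin Mod p wsize)) = w - P mod w"
    by (rule ev_Sub[OF w1 m _ ww]) (use w0 in simp)
  have pw: "take_bit w (push_bit \<beta> (1::nat)) = 2 ^ \<beta>"
    using \<beta> by (intro trans[OF take_bit_nat_eq_self]) (auto simp: push_bit_eq_mult)
  let ?x = "Bit_Operations.or (take_bit w (drop_bit (P mod w) (\<mu> (P div w))))
      (take_bit w (push_bit (w - P mod w) (\<mu> (P div w + 1))))"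
  have "ev w \<mu> \<rho> (rd p b) = take_bit w (take_bit w ?x mod 2 ^ \<beta>)"
    unfolding rd_def
    by (simp only: ev.simps(3,4)[of w \<mu> \<rho>] eval_binop.simps) (use d m a s b one pw in \<open>simp del: eval_binop.simps(3)\<close>)
  also have "\<dots> = take_bit \<beta> ?x"
    using \<beta> by (simp flip: take_bit_eq_mod add: min_def)
  also have "\<dots> = field D P \<beta>"
  proof (rule bit_eqI)
    fix n
    show "bit (take_bit \<beta> ?x) n = bit (field D P \<beta>) n"
    proof (cases "n < \<beta>")
      case True
      then have n: "P + n < length D" "n < w" using P \<beta> by auto
      have dm: "P div w * w + P mod w = P" by simp
      have lt: "P mod w < w" using w0 by simp
      have "P div w * w < length D" using n dm by linarith
      then have f: "\<mu> (P div w) = packed_word w D (P div w)" using \<mu> less_num_words[OF w0] by blast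
      show ?thesis
      \<comment> \<open>Only if bit \<open>n\<close> lies in the second word is that word known to
        belong to the data structure, so only then are its contents consulted.\<close>
      proof (cases "P mod w + n < w")
        case c: True
        then have "\<not> w - P mod w \<le> n" by linarith
        then show ?thesis using c n f dm True
          by (simp add: bit_field bit_take_bit_iff bit_or_iff bit_drop_bit_eq bit_push_bit_iff bit_packed_word
              flip: add.assoc)
      next
        case c: False
        let ?k = "n - (w - P mod w)"
        have k: "(P div w + 1) * w + ?k = P + n" using c lt dm by (simp only: add_mult_distrib mult_1)
        then have "(P div w + 1) * w < length D" using n by linarith
        then have g: "\<mu> (P div w + 1) = packed_word w D (P div w + 1)" using \<mu> less_num_words[OF w0] by blast
        have "?k < w" using n lt by linarith
        moreover have "w - P mod w \<le> n" using c by linarith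
        ultimately have "bit (take_bit w (push_bit (w - P mod w) (\<mu> (P div w + 1)))) n = D ! (P + n)"
          using n k by (simp only: g bit_take_bit_iff bit_push_bit_iff bit_packed_word possible_bit_nat simp_thms)
        moreover have "\<not> bit (take_bit w (drop_bit (P mod w) (\<mu> (P div w)))) n"
          using c by (simp only: f bit_take_bit_iff bit_drop_bit_eq o_def bit_packed_word) blast
        ultimately show ?thesis using n True by (simp add: bit_field bit_take_bit_iff bit_or_iff)
      qed
    qed (simp add: bit_field bit_take_bit_iff bit_or_iff)
  qed
  finally show ?thesis .
qed

section \<open>A self-describing sequence of arrays\<close>

definition bl :: "nat \<Rightarrow> nat" where
  "bl x = (LEAST b. x < 2 ^ b)"

lemma less_bl: "x < 2 ^ bl x"
  unfolding bl_def by (rule LeastI) (rule less_exp)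

lemma bl_le: "x < 2 ^ b \<Longrightarrow> bl x \<le> b"
  unfolding bl_def by (rule Least_le)

lemma bl_le_self: "bl x \<le> x"
  by (rule bl_le) (rule less_exp)

lemma bl_mono: "x \<le> y \<Longrightarrow> bl x \<le> bl y"
  by (rule bl_le) (use less_bl[of y] in linarith)

definition body :: "(nat \<times> nat list) list \<Rightarrow> bool list" where
  "body arrs = concat (map enc arrs)"

definition offset :: "(nat \<times> nat list) list \<Rightarrow> nat \<Rightarrow> nat" where
  "offset arrs j = length (body (take j arrs))"

text \<open>The sum makes one field size serve both kinds of header entries, the offsets and the
  widths.\<close>

definition hwidth :: "(nat \<times> nat list) list \<Rightarrow> nat" where
  "hwidth arrs = bl (length (body arrs) + sum_list (map fst arrs))"

definition header :: "(nat \<times> nat list) list \<Rightarrow> nat list" where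
  "header arrs = map (\<lambda>i. if even i then offset arrs (i div 2) else fst (arrs ! (i div 2))) [0..<2 * length arrs]"

text \<open>The leading unary field delimits the width of the header fields.\<close>

definition encode :: "(nat \<times> nat list) list \<Rightarrow> bool list" where
  "encode arrs = (let B = hwidth arrs in
     replicate B True @ [False] @ bits B B @ enc (B, header arrs) @ body arrs)"

lemma length_encode: "length (encode arrs) =
    1 + (2 + 2 * length arrs) * hwidth arrs + length (body arrs)"
  by (simp add: encode_def Let_def length_enc header_def algebra_simps)

lemma length_body: "length (body arrs) = (\<Sum>(b, xs)\<leftarrow>arrs. b * length xs)"
  by (induction arrs) (auto simp: body_def length_enc)

lemma offset_bound:
  assumes "j < length arrs"
  shows "offset arrs j + fst (arrs ! j) * length (snd (arrs ! j)) \<le> length (body arrs)"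
proof -
  have "body arrs = body (take j arrs @ arrs ! j # drop (Suc j) arrs)"
    using assms by (simp add: id_take_nth_drop[symmetric])
  also have "\<dots> = body (take j arrs) @ enc (arrs ! j) @ body (drop (Suc j) arrs)"
    by (simp add: body_def)
  finally have "length (body arrs) = offset arrs j + length (enc (arrs ! j)) + length (body (drop (Suc j) arrs))"
    by (simp add: offset_def)
  then show ?thesis using length_enc[of "fst (arrs ! j)" "snd (arrs ! j)"] by simp
qed

lemma field_body:
  assumes "j < length arrs" "p + b \<le> fst (arrs ! j) * length (snd (arrs ! j))"
  shows "field (body arrs) (offset arrs j + p) b = field (enc (arrs ! j)) p b"
proof -
  have "body arrs = body (take j arrs @ arrs ! j # drop (Suc j) arrs)"
    using assms by (simp add: id_take_nth_drop[symmetric])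
  also have "\<dots> = body (take j arrs) @ enc (arrs ! j) @ body (drop (Suc j) arrs)"
    by (simp add: body_def)
  finally have "field (body arrs) (offset arrs j + p) b = field (enc (arrs ! j) @ body (drop (Suc j) arrs)) p b"
    by (simp add: offset_def field_append)
  also have "\<dots> = field (enc (arrs ! j)) p b"
    by (rule field_append_left) (use assms length_enc[of "fst (arrs ! j)" "snd (arrs ! j)"] in simp)
  finally show ?thesis .
qed

lemma member_le_sum_list_fst: "j < length arrs \<Longrightarrow> fst (arrs ! j) \<le> sum_list (map fst (arrs :: (nat \<times> nat list) list))"
  by (rule member_le_sum_list) auto

definition num_arrays :: nat where "num_arrays = 26"

abbreviation hw_var :: ex where "hw_var \<equiv> Var 2"

definition hbase :: ex where "hbase = Bin Add (Bin Add hw_var hw_var) (Num 1)"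

definition hdr :: "nat \<Rightarrow> ex" where
  "hdr i = rd (Bin Add hbase (Bin Mul (Num i) hw_var)) hw_var"

definition apos :: "nat \<Rightarrow> ex" where
  "apos a = Bin Add (Bin Add hbase (Bin Mul (Num (2 * num_arrays)) hw_var)) (hdr (2 * a))"

definition arr :: "nat \<Rightarrow> ex \<Rightarrow> ex" where
  "arr a e = rd (Bin Add (apos a) (Bin Mul e (hdr (2 * a + 1)))) (hdr (2 * a + 1))"

definition arrbits :: "nat \<Rightarrow> ex \<Rightarrow> ex \<Rightarrow> ex" where
  "arrbits a e b = rd (Bin Add (apos a) e) b"

definition load_hw :: com where
  "load_hw = Seq (asg 3 (Cell (Num 0)))
     (Seq (asg 4 (Bin Add (Bin Xor (Var 3) (Bin Add (Var 3) (Num 1))) (Num 1)))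
       (asg 2 (Bin Mod (Bin Div (Var 3) (Var 4)) (Bin Div (Var 4) (Num 2)))))"

lemma vars_arr: "vars (arr a e) = vars e \<union> {1, 2}" "vars (arrbits a e b) = vars e \<union> vars b \<union> {1, 2}"
  by (auto simp: arr_def arrbits_def apos_def hdr_def hbase_def vars_rd)

text \<open>The bound on \<open>2 * hwidth arrs + 1\<close> puts the unary prefix and the binary
  copy of the header width into the first word. With \<open>8 < w\<close> the numerals used in
  addresses, at most \<open>2 * num_arrays\<close>, are loaded without truncation.\<close>

locale store =
  fixes w :: nat and \<mu> :: "nat \<Rightarrow> nat" and arrs :: "(nat \<times> nat list) list"
  assumes len: "length arrs = num_arrays"
    and wide: "length (encode arrs) + 1 < 2 ^ w" "2 * hwidth arrs + 1 < w" "\<forall>a\<in>set arrs. fst a < w" "8 < w"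
    and small: "\<forall>a\<in>set arrs. \<forall>x\<in>set (snd a). x < 2 ^ fst a"
    and mem: "\<forall>i < num_words w (encode arrs). \<mu> i = packed_word w (encode arrs) i"
begin

abbreviation "B \<equiv> hwidth arrs"

definition ready :: "(nat \<Rightarrow> nat) \<Rightarrow> bool" where
  "ready \<rho> \<longleftrightarrow> \<rho> 1 = w \<and> \<rho> 2 = B"

lemma length_encode': "length (encode arrs) = (B + B + 1) + 2 * num_arrays * B + length (body arrs)"
  by (simp add: length_encode len)

lemma Num_eq:
  assumes "n \<le> 2 * num_arrays"
  shows "ev w \<mu> \<rho> (Num n) = n"
proof -
  have "n < 2 ^ 8" using assms by (simp add: num_arrays_def)
  also have "(2 :: nat) ^ 8 \<le> 2 ^ w" using wide(4) by (intro power_increasing) auto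
  finally show ?thesis by (simp add: take_bit_nat_eq_self)
qed

lemma ev_hbase:
  assumes "ready \<rho>"
  shows "ev w \<mu> \<rho> hbase = B + B + 1"
  unfolding hbase_def
proof (rule ev_Add, rule ev_Add)
  show "ev w \<mu> \<rho> hw_var = B" "ev w \<mu> \<rho> hw_var = B" using assms by (auto simp: ready_def)
  show "B + B < 2 ^ w" "B + B + 1 < 2 ^ w" using wide(1) by (auto simp: length_encode')
qed (simp add: Num_eq num_arrays_def del: ev.simps)

lemma ev_hdr:
  assumes "ready \<rho>" "i < 2 * num_arrays"
  shows "ev w \<mu> \<rho> (hdr i) = header arrs ! i"
proof -
  have hw: "ev w \<mu> \<rho> hw_var = B" using assms by (auto simp: ready_def)
  have "i * B + B = Suc i * B" by simp
  also have "\<dots> \<le> 2 * num_arrays * B" using assms(2) by (intro mult_right_mono) auto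
  finally have iB: "i * B + B \<le> 2 * num_arrays * B" .
  have i: "ev w \<mu> \<rho> (Num i) = i"
    using assms(2) Num_eq by simp
  have "ev w \<mu> \<rho> (hdr i) = field (encode arrs) (B + B + 1 + i * B) B"
    unfolding hdr_def
  proof (rule ev_rd[OF _ hw _ _ wide(1) _ mem])
    show "ev w \<mu> \<rho> (Bin Add hbase (Bin Mul (Num i) hw_var)) = B + B + 1 + i * B"
      by (rule ev_Add[OF ev_hbase[OF assms(1)] ev_Mul[OF i hw]])
        (use wide(1) iB in \<open>auto simp: length_encode'\<close>)
    show "\<rho> 1 = w" using assms by (simp add: ready_def)
    show "B + B + 1 + i * B + B \<le> length (encode arrs)" using iB by (simp add: length_encode')
    show "B < w" using wide(2) by simp
  qed
  also have "encode arrs = (replicate B True @ [False] @ bits B B) @ enc (B, header arrs) @ body arrs"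
    by (simp add: encode_def Let_def)
  also have "field \<dots> (B + B + 1 + i * B) B = field (enc (B, header arrs) @ body arrs) (i * B) B"
    by (rule field_append) simp
  also have "\<dots> = field (enc (B, header arrs)) (i * B) B"
    by (rule field_append_left) (use iB in \<open>simp add: length_enc header_def len mult.commute\<close>)
  also have "\<dots> = header arrs ! i"
  proof (rule field_enc)
    show "i < length (header arrs)" using assms(2) by (simp add: header_def len)
    have "offset arrs j + fst (arrs ! j) < 2 ^ B" if "j < length arrs" for j
    proof -
      have "offset arrs j + fst (arrs ! j) \<le> length (body arrs) + sum_list (map fst arrs)"
        using offset_bound[OF that] member_le_sum_list_fst[OF that] by linarith
      then show ?thesis using less_bl[of "length (body arrs) + sum_list (map fst arrs)"]
        unfolding hwidth_def by linarith
    qed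
    then have "offset arrs j < 2 ^ B" "fst (arrs ! j) < 2 ^ B" if "j < length arrs" for j
      using that by (meson add_lessD1 trans_less_add2 add.commute le_less_trans le_add2)+
    then show "\<forall>x\<in>set (header arrs). x < 2 ^ B"
      by (auto simp: header_def)
  qed
  finally show ?thesis .
qed

lemma ev_apos:
  assumes "ready \<rho>" "a < num_arrays"
  shows "ev w \<mu> \<rho> (apos a) = (B + B + 1) + 2 * num_arrays * B + offset arrs a"
    and "ev w \<mu> \<rho> (hdr (2 * a + 1)) = fst (arrs ! a)"
proof -
  have hw: "ev w \<mu> \<rho> hw_var = B" using assms by (auto simp: ready_def)
  have h: "ev w \<mu> \<rho> (hdr (2 * a)) = offset arrs a"
    using ev_hdr[OF assms(1), of "2 * a"] assms(2) by (simp add: header_def len)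
  show "ev w \<mu> \<rho> (hdr (2 * a + 1)) = fst (arrs ! a)"
    using ev_hdr[OF assms(1), of "2 * a + 1"] assms(2) by (simp add: header_def len)
  have n: "ev w \<mu> \<rho> (Num (2 * num_arrays)) = 2 * num_arrays"
    using Num_eq by simp
  have "offset arrs a \<le> length (body arrs)" using offset_bound[of a arrs] assms(2) len by simp
  then show "ev w \<mu> \<rho> (apos a) = (B + B + 1) + 2 * num_arrays * B + offset arrs a"
    unfolding apos_def
    by (intro ev_Add ev_hbase assms ev_Mul n hw h) (use wide(1) in \<open>auto simp: length_encode'\<close>)
qed

lemma field_encode:
  assumes "a < num_arrays" "p + b \<le> fst (arrs ! a) * length (snd (arrs ! a))"
  shows "field (encode arrs) ((B + B + 1) + 2 * num_arrays * B + offset arrs a + p) b = field (enc (arrs ! a)) p b"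
proof -
  have e: "encode arrs = (replicate B True @ [False] @ bits B B @ enc (B, header arrs)) @ body arrs"
    by (simp add: encode_def Let_def)
  have "field (encode arrs) ((B + B + 1) + 2 * num_arrays * B + offset arrs a + p) b
      = field (body arrs) (offset arrs a + p) b"
    unfolding e by (rule field_append) (simp add: length_enc header_def len)
  then show ?thesis using field_body assms len by simp
qed

lemma ev_arr:
  assumes "ready \<rho>" "a < num_arrays" "ev w \<mu> \<rho> e = i" "arrs ! a = (b, xs)" "i < length xs"
  shows "ev w \<mu> \<rho> (arr a e) = xs ! i"
proof -
  let ?P = "(B + B + 1) + 2 * num_arrays * B + offset arrs a"
  have a: "arrs ! a \<in> set arrs" using assms(2) len by simp
  have f: "fst (arrs ! a) = b" "snd (arrs ! a) = xs" using assms(4) by auto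
  have "i * b + b = Suc i * b" by simp
  also have "\<dots> \<le> length xs * b" using assms(5) by (intro mult_right_mono) auto
  finally have ib: "i * b + b \<le> b * length xs" by (simp add: mult.commute)
  have ob: "offset arrs a + b * length xs \<le> length (body arrs)"
    using offset_bound[of a arrs] assms(2) len f by simp
  note h = ev_apos(2)[OF assms(1,2), unfolded f]
  have "ev w \<mu> \<rho> (arr a e) = field (encode arrs) (?P + i * b) b"
    unfolding arr_def
  proof (rule ev_rd[OF _ h _ _ wide(1) _ mem])
    show "ev w \<mu> \<rho> (Bin Add (apos a) (Bin Mul e (hdr (2 * a + 1)))) = ?P + i * b"
      by (rule ev_Add[OF ev_apos(1)[OF assms(1,2)] ev_Mul[OF assms(3) h]])
        (use wide(1) ib ob in \<open>auto simp: length_encode'\<close>)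
    show "\<rho> 1 = w" using assms by (simp add: ready_def)
    show "?P + i * b + b \<le> length (encode arrs)" using ib ob by (simp add: length_encode')
    show "b < w" using wide(3) a f by auto
  qed
  also have "\<dots> = field (enc (arrs ! a)) (i * b) b"
    by (rule field_encode[OF assms(2)]) (use ib f in simp)
  also have "\<dots> = xs ! i"
    using field_enc[OF assms(5), of b] small a f assms(4) by force
  finally show ?thesis .
qed

lemma ev_arrbits:
  assumes "ready \<rho>" "a < num_arrays" "ev w \<mu> \<rho> e = i" "ev w \<mu> \<rho> c = b"
    and "arrs ! a = (1, map of_bool bs)" "i + b \<le> length bs" "b < w"
  shows "ev w \<mu> \<rho> (arrbits a e c) = field bs i b"
proof -
  let ?P = "(B + B + 1) + 2 * num_arrays * B + offset arrs a"
  have f: "fst (arrs ! a) = 1" "length (snd (arrs ! a)) = length bs" using assms(5) by auto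
  have ob: "offset arrs a + length bs \<le> length (body arrs)"
    using offset_bound[of a arrs] assms(2) len f by simp
  have "ev w \<mu> \<rho> (arrbits a e c) = field (encode arrs) (?P + i) b"
    unfolding arrbits_def
  proof (rule ev_rd[OF _ assms(4) _ _ wide(1) assms(7) mem])
    show "ev w \<mu> \<rho> (Bin Add (apos a) e) = ?P + i"
      by (rule ev_Add[OF ev_apos(1)[OF assms(1,2)] assms(3)])
        (use wide(1) assms(6) ob in \<open>auto simp: length_encode'\<close>)
    show "\<rho> 1 = w" using assms by (simp add: ready_def)
    show "?P + i + b \<le> length (encode arrs)" using assms(6) ob by (simp add: length_encode')
  qed
  also have "\<dots> = field (enc (arrs ! a)) i b"
    by (rule field_encode[OF assms(2)]) (use assms(6) f in simp)
  also have "enc (arrs ! a) = bs" using assms(5) enc_of_bool by simp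
  finally show ?thesis .
qed

text \<open>The first word \<open>x\<close> begins, from its low end, with \<open>B\<close> ones and
  a zero. Adding 1 flips exactly these bits, so \<open>x\<close> xor \<open>x + 1\<close> is the
  mask of \<open>B + 1\<close> bits, and its successor is \<open>2 ^ (B + 1)\<close>. Dividing by
  this power and reducing modulo its half extracts the binary copy of \<open>B\<close> that comes
  next. The time 50 is a round upper bound.\<close>

lemma tot_load_hw:
  assumes "\<rho> 1 = w"
    and "\<And>\<rho>'. ready \<rho>' \<Longrightarrow> \<forall>r. r \<notin> {2, 3, 4} \<longrightarrow> \<rho>' r = \<rho> r \<Longrightarrow> Q (\<rho>', out)"
  shows "tot w \<mu> load_hw 50 (\<rho>, out) Q"
proof -
  let ?D = "encode arrs"
  define x where "x = packed_word w ?D 0"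
  define R where "R = drop_bit (B + 1) x"
  have lD: "2 * B + 1 \<le> length ?D" by (simp add: length_encode')
  have "0 < length ?D" by (simp add: length_encode')
  then have "0 < num_words w ?D" using less_num_words[of w 0 ?D] wide(4) by linarith
  then have x0: "\<mu> 0 = x" using mem unfolding x_def by blast
  have D: "?D = replicate B True @ [False] @ bits B B @ enc (B, header arrs) @ body arrs"
    by (simp add: encode_def Let_def)
  have bx: "bit x n \<longleftrightarrow> n < w \<and> n < length ?D \<and> ?D ! n" for n
    unfolding x_def by (simp add: bit_packed_word)
  have tk: "take_bit (B + 1) x = mask B"
  proof (rule bit_eqI)
    fix n
    have "?D ! n \<longleftrightarrow> n < B" if "n < B + 1" using that by (auto simp: D nth_append)
    then show "bit (take_bit (B + 1) x) n = bit (mask B :: nat) n"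
      using wide(2) lD by (auto simp: bit_take_bit_iff bit_mask_iff bx)
  qed
  have x: "x = push_bit (B + 1) R + mask B"
    using bits_ident[of "B + 1" x] tk R_def by simp
  have "bit R n \<Longrightarrow> n + B + 1 < w" for n
    by (auto simp: R_def bit_drop_bit_eq bx)
  then have Rw: "take_bit (w - (B + 1)) R = R" by (intro bit_eqI) (auto simp: bit_take_bit_iff less_diff_conv)
  have "R < 2 ^ (w - (B + 1))" using take_bit_nat_less_exp[of "w - (B + 1)" R] unfolding Rw .
  \<comment> \<open>The zero at position \<open>B\<close> absorbs the carry, so \<open>x + 1\<close>
    stays below \<open>2 ^ w\<close>.\<close>
  then have "(R + 1) * 2 ^ (B + 1) \<le> 2 ^ (w - (B + 1)) * 2 ^ (B + 1)" by (intro mult_right_mono) auto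
  also have "\<dots> = 2 ^ w" using wide(2) by (simp flip: power_add del: power_Suc)
  finally have "(R + 1) * 2 ^ (B + 1) \<le> 2 ^ w" .
  moreover have "(R + 1) * 2 ^ (B + 1) = R * 2 ^ (B + 1) + 2 ^ B + (2 ^ B :: nat)" by simp
  moreover have "(0 :: nat) < 2 ^ B" by simp
  ultimately have x1: "push_bit (B + 1) R + 2 ^ B < 2 ^ w"
    unfolding push_bit_eq_mult by linarith
  have Sx: "x + 1 = push_bit (B + 1) R + 2 ^ B" unfolding x by (simp add: mask_eq_exp_minus_1)
  have "Bit_Operations.xor x (x + 1) = mask (B + 1)"
  proof (rule bit_eqI)
    fix n
    define S where "S = push_bit (B + 1) R"
    have S: "\<not> bit S n" if "n < B + 1" for n
      using that unfolding S_def bit_push_bit_iff_nat by linarith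
    have 1: "x = Bit_Operations.or S (mask B)" unfolding x S_def[symmetric]
      by (rule disjunctive_add_eq_or, rule bit_eqI) (use S in \<open>auto simp: bit_and_iff bit_mask_iff\<close>)
    have 2: "x + 1 = Bit_Operations.or S (2 ^ B)" unfolding Sx S_def[symmetric]
      by (rule disjunctive_add_eq_or, rule bit_eqI) (use S in \<open>auto simp: bit_and_iff bit_exp_iff\<close>)
    show "bit (Bit_Operations.xor x (x + 1)) n = bit (mask (B + 1) :: nat) n"
      unfolding 2 unfolding 1 bit_xor_iff bit_or_iff bit_mask_iff bit_exp_iff possible_bit_nat
      using S[of n] by (auto simp: less_Suc_eq)
  qed
  note xr0 = this
  have xr: "(mask (B + 1) :: nat) + 1 = 2 ^ (B + 1)" by (simp add: mask_eq_exp_minus_1)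
  have Bw: "(2::nat) ^ (B + 1) < 2 ^ w" using wide(2) by (intro power_strict_increasing) auto
  have n1: "ev w \<mu> \<rho>' (Num 1) = 1" and n2: "ev w \<mu> \<rho>' (Num 2) = 2" and n0: "ev w \<mu> \<rho>' (Num 0) = 0" for \<rho>'
    using Num_eq by (simp_all add: num_arrays_def del: ev.simps)
  have xw: "x < 2 ^ w" using Sx x1 by linarith
  have R_B: "x div 2 ^ (B + 1) mod 2 ^ B = B"
  proof -
    have "take_bit B (drop_bit (B + 1) x) = B"
    proof (rule bit_eqI)
      fix n
      have 1: "?D ! (B + 1 + n) \<longleftrightarrow> bit B n" if "n < B" using that by (simp add: D nth_append bits_def)
      have 2: "bit B n \<Longrightarrow> n < B"
        using take_bit_nat_eq_self[OF less_exp[of B]] bit_take_bit_iff[of B B n] by simp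
      show "bit (take_bit B (drop_bit (B + 1) x)) n = bit B n"
      proof (cases "n < B")
        case True
        then have "B + 1 + n < w" "B + 1 + n < length ?D" using wide(2) lD by linarith+
        then show ?thesis using True 1 by (simp only: bit_take_bit_iff bit_drop_bit_eq bx o_def simp_thms)
      next
        case False
        then show ?thesis using 2 by (simp only: bit_take_bit_iff) blast
      qed
    qed
    then show ?thesis by (simp only: drop_bit_eq_div take_bit_eq_mod)
  qed
  have half: "(2::nat) ^ (B + 1) div 2 = 2 ^ B" by simp
  let ?r1 = "\<rho>(3 := x)"
  have v3: "ev w \<mu> ?r1 (Var 3) = x" by simp
  have a3: "ev w \<mu> ?r1 (Bin Add (Var 3) (Num 1)) = x + 1"
    by (rule ev_Add[OF v3 n1]) (use Sx x1 in linarith)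
  have x3: "ev w \<mu> ?r1 (Bin Xor (Var 3) (Bin Add (Var 3) (Num 1))) = mask (B + 1)"
    unfolding ev.simps(3)[of w \<mu> ?r1 Xor] v3 a3 eval_binop.simps xr0
    using xr Bw by (intro take_bit_nat_eq_self) (simp only: xr0)
  have e4: "ev w \<mu> ?r1 (Bin Add (Bin Xor (Var 3) (Bin Add (Var 3) (Num 1))) (Num 1)) = 2 ^ (B + 1)"
    using ev_Add[OF x3 n1] xr Bw by (simp only: xr0)
  let ?r2 = "\<rho>(3 := x, 4 := 2 ^ (B + 1))"
  have v4: "ev w \<mu> ?r2 (Var 4) = 2 ^ (B + 1)" and v3': "ev w \<mu> ?r2 (Var 3) = x" by simp_all
  have d1: "ev w \<mu> ?r2 (Bin Div (Var 3) (Var 4)) = x div 2 ^ (B + 1)" by (rule ev_Div[OF v3' v4 xw])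
  have d2: "ev w \<mu> ?r2 (Bin Div (Var 4) (Num 2)) = 2 ^ B" using ev_Div[OF v4 n2 Bw] half by simp
  have e2: "ev w \<mu> ?r2 (Bin Mod (Bin Div (Var 3) (Var 4)) (Bin Div (Var 4) (Num 2))) = B"
    using ev_Mod[OF d1 d2 le_less_trans[OF div_le_dividend xw]] R_B by simp
  have e3: "ev w \<mu> \<rho> (Cell (Num 0)) = x" using n0 x0 by (simp only: ev.simps(4))
  show ?thesis
    unfolding load_hw_def
    by (rule tot_weaken, rule tot_Seq_asg[OF _ _ e3], simp add: nvars_def, simp,
        rule tot_Seq_asg[OF _ _ e4], simp add: nvars_def, simp add: nvars_def,
        rule tot_asg[OF _ _ e2, of 2 Q], simp add: nvars_def, simp add: nvars_def)
      (use assms in \<open>auto simp: ready_def\<close>)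
qed

end

section \<open>Monotone maps in linearly many bits\<close>

text \<open>The lists are placed at addresses prescribed by a monotone function \<open>Q\<close>,
  with padding wherever a region is not filled. When \<open>Q\<close> can be computed from data at
  hand, no pointers are needed and the total length is just \<open>Q N\<close>.\<close>

lemma fill_regions:
  fixes Q :: "nat \<Rightarrow> nat" and val :: "nat \<Rightarrow> nat \<Rightarrow> nat"
  assumes "\<And>c. Q c \<le> Q (Suc c)" "\<And>c. S c \<Longrightarrow> Q c + m * W \<le> Q (Suc c)"
    "\<And>c i. S c \<Longrightarrow> i < m \<Longrightarrow> val c i < 2 ^ W"
  shows "\<exists>bs. length bs = Q N \<and>
    (\<forall>c<N. S c \<longrightarrow> (\<forall>i<m. Q c + i * W + W \<le> Q N \<and> field bs (Q c + i * W) W = val c i))"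
proof (induction N)
  case 0
  show ?case by (intro exI[of _ "replicate (Q 0) False"]) simp
next
  case (Suc N)
  then obtain bs where bs: "length bs = Q N"
    "\<forall>c<N. S c \<longrightarrow> (\<forall>i<m. Q c + i * W + W \<le> Q N \<and> field bs (Q c + i * W) W = val c i)" by blast
  define e where "e = (if S N then enc (W, map (val N) [0..<m]) else [])"
  have le: "length e \<le> Q (Suc N) - Q N"
    using assms(2)[of N] by (auto simp: e_def length_enc mult.commute)
  let ?bs = "bs @ e @ replicate (Q (Suc N) - Q N - length e) False"
  have len: "length ?bs = Q (Suc N)" using bs(1) le assms(1)[of N] by simp
  have "Q c + i * W + W \<le> Q (Suc N) \<and> field ?bs (Q c + i * W) W = val c i"
    if c: "c < Suc N" "S c" "i < m" for c i
  proof (cases "c < N")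
    case True
    with bs c have "Q c + i * W + W \<le> Q N" "field bs (Q c + i * W) W = val c i" by auto
    then show ?thesis using assms(1)[of N] bs(1) by (simp add: field_append_left)
  next
    case False
    with c have [simp]: "c = N" by simp
    have "i * W + W = Suc i * W" by simp
    also have "\<dots> \<le> m * W" using c(3) by (intro mult_right_mono) auto
    finally have iW: "i * W + W \<le> m * W" .
    have "field ?bs (Q c + i * W) W = field (e @ replicate (Q (Suc N) - Q N - length e) False) (i * W) W"
      by (rule field_append) (simp add: bs)
    also have "\<dots> = field e (i * W) W"
      by (rule field_append_left) (use iW c in \<open>simp add: e_def length_enc mult.commute\<close>)
    also have "\<dots> = val c i"
      using c assms(3)[of N] field_enc[of i "map (val N) [0..<m]" W] by (simp add: e_def)
    finally show ?thesis using iW assms(2)[of N] c by simp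
  qed
  with len show ?case by blast
qed

definition region_bits :: "(nat \<Rightarrow> nat) \<Rightarrow> (nat \<Rightarrow> bool) \<Rightarrow> nat \<Rightarrow> nat \<Rightarrow> (nat \<Rightarrow> nat \<Rightarrow> nat) \<Rightarrow> nat \<Rightarrow> bool list" where
  "region_bits Q S m W val N = (SOME bs. length bs = Q N \<and>
    (\<forall>c<N. S c \<longrightarrow> (\<forall>i<m. Q c + i * W + W \<le> Q N \<and> field bs (Q c + i * W) W = val c i)))"

lemma region_bits:
  assumes "\<And>c. Q c \<le> Q (Suc c)" "\<And>c. S c \<Longrightarrow> Q c + m * W \<le> Q (Suc c)"
    "\<And>c i. S c \<Longrightarrow> i < m \<Longrightarrow> val c i < 2 ^ W"
  shows "length (region_bits Q S m W val N) = Q N"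
    and "c < N \<Longrightarrow> S c \<Longrightarrow> i < m \<Longrightarrow>
      Q c + i * W + W \<le> Q N \<and> field (region_bits Q S m W val N) (Q c + i * W) W = val c i"
  using someI_ex[OF fill_regions[of Q S m W val N, OF assms]] unfolding region_bits_def by blast+

lemma three_square_le: "3 * s\<^sup>2 \<le> (2::nat) ^ (3 * s)"
proof (induction s)
  case (Suc s)
  have "3 * (Suc s)\<^sup>2 \<le> 8 * 2 ^ (3 * s)"
  proof (cases "s = 0")
    case False
    then have "s \<le> s\<^sup>2" "1 \<le> s\<^sup>2" by (simp_all add: power2_eq_square)
    moreover have "3 * (Suc s)\<^sup>2 = 3 * s\<^sup>2 + 6 * s + 3" by (simp add: power2_eq_square)
    ultimately have "3 * (Suc s)\<^sup>2 \<le> 8 * (3 * s\<^sup>2)" by linarith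
    then show ?thesis using Suc by linarith
  qed simp
  then show ?case by (simp add: power_add)
qed simp

text \<open>
  The argument \<^term>\<open>s\<close> is of the order of \<open>log log n\<close>. Values are listed explicitly in blocks and in
  subblocks whose growth pays for the list; a subblock that grows slowly is described by fewer than
  \<open>3 s\<^sup>2\<close> bits, so that a table of all descriptions is affordable.
\<close>

locale mono_map =
  fixes F :: "nat \<Rightarrow> nat" and n s :: nat
  assumes mono: "\<And>g h. g \<le> h \<Longrightarrow> F g \<le> F h" and bounded: "\<And>g. F g \<le> n"
    and s: "s \<ge> 1" and n: "n < 2 ^ (2 ^ s)"
begin

text \<open>A value of \<open>F\<close> fits into \<open>L\<close> bits, a block consists of
  \<open>L\<close> subblocks of \<open>s\<close> arguments each, and \<open>R\<close> is the length
  of a list of \<open>s\<close> numbers with \<open>3 * s\<close> bits.\<close>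

definition "L = (2::nat) ^ s"
definition "K = s * L"
definition "R = s * (3 * s)"
text \<open>The position of the one belonging to \<open>g\<close> in the unary (Elias-Fano) code of
  \<open>F\<close>. The summand \<open>g\<close> makes it strictly increasing. It is also the
  address function of the explicit lists, so knowing \<open>F\<close> at the start of a block
  locates the list of the block.\<close>

definition "P g = g + F g"
definition "sparse1 b \<longleftrightarrow> P (b * K) + K * L \<le> P (Suc b * K)"
definition "sparse2 c \<longleftrightarrow> \<not> sparse1 (c div L) \<and> P (c * s) + R \<le> P (Suc c * s)"
definition "vals_A = map (\<lambda>b. F (b * K)) [0..<n div K + 1]"
definition "vals_sp1 = map (\<lambda>b. of_bool (sparse1 b) :: nat) [0..<n div K + 1]"
definition "vals_Rel = map (\<lambda>c. if sparse1 (c div L) then 0 else F (c * s) - F (c div L * K)) [0..<n div s + 1]"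
definition "vals_sp2 = map (\<lambda>c. of_bool (sparse2 c) :: nat) [0..<n div s + 1]"
text \<open>Positions \<open>P g\<close> with \<open>g \<le> n\<close> are at most
  \<open>2 * n\<close>; the \<open>R\<close> additional bits let a full window be read at each of
  them.\<close>

definition "unary = map (\<lambda>p. \<exists>g. P g = p) [0..<2 * n + R]"
definition select :: "nat \<Rightarrow> nat \<Rightarrow> nat" where
  "select x i = (THE p. bit x p \<and> card {q. q < p \<and> bit x q} = i)"
text \<open>One entry for every content of a window and every index in a subblock. In windows with
  too few ones \<open>select\<close> is unspecified, so the guard keeps all entries below
  \<open>2 ^ (3 * s)\<close>. Subtracting the index turns the position of a one into a growth of
  \<open>F\<close>.\<close>

definition "vals_Tab = map (\<lambda>t. if select (t div s) (t mod s) < 2 ^ (3 * s)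
    then select (t div s) (t mod s) - t mod s else 0) [0..<2 ^ R * s]"

lemma P_strict: "g < h \<Longrightarrow> P g < P h"
  using mono[of g h] by (simp add: P_def)

lemma P_less_iff: "P g < P h \<longleftrightarrow> g < h"
  by (metis P_strict linorder_neqE_nat not_less_iff_gr_or_eq)

lemma P_eq_iff: "P g = P h \<longleftrightarrow> g = h"
  by (metis P_strict linorder_neqE_nat not_less_iff_gr_or_eq)

lemma F_less: "F g < 2 ^ L"
  using bounded[of g] n unfolding L_def by simp

lemma L_pos: "L > 0" "K > 0" "s > 0"
  using s by (auto simp: L_def K_def)

text \<open>A block that grows too slowly for a list grows by less than \<open>K * L\<close>, and
  this is at most \<open>2 ^ (3 * s)\<close> because \<open>s\<close> is below \<open>2 ^ s\<close>.
  Here the width \<open>3 * s\<close> of relative values originates.\<close>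

lemma dense_block:
  assumes "\<not> sparse1 b" "b * K \<le> g" "g \<le> Suc b * K"
  shows "F g - F (b * K) < 2 ^ (3 * s)"
proof -
  have "P g \<le> P (Suc b * K)" using assms(3) P_strict[of g] by (cases "g = Suc b * K") (auto intro: less_imp_le)
  then have "P g < P (b * K) + K * L" using assms(1) by (simp add: sparse1_def)
  moreover have "0 < K * L" using L_pos by simp
  ultimately have "F g - F (b * K) < K * L" using assms(2) unfolding P_def by linarith
  also have "K * L \<le> 2 ^ s * 2 ^ s * 2 ^ s"
    unfolding K_def L_def by (intro mult_right_mono) (auto intro: less_imp_le less_exp)
  also have "\<dots> = 2 ^ (3 * s)" by (simp flip: power_add)
  finally show ?thesis .
qed

lemma subblock_in_block: "c div L * K \<le> c * s" "Suc c * s \<le> Suc (c div L) * K"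
proof -
  have "c div L * L \<le> c" by simp
  then have "c div L * L * s \<le> c * s" by (rule mult_right_mono) simp
  then show "c div L * K \<le> c * s" by (simp add: K_def ac_simps)
  have "c < Suc (c div L) * L" using L_pos by (simp add: dividend_less_div_times add.commute)
  then have "Suc c * s \<le> Suc (c div L) * L * s" by (intro mult_right_mono) auto
  moreover have "Suc (c div L) * L * s = Suc (c div L) * K" by (simp only: K_def ac_simps)
  ultimately show "Suc c * s \<le> Suc (c div L) * K" by simp
qed

definition "pool1 = region_bits (\<lambda>b. P (b * K)) sparse1 K L (\<lambda>b i. F (b * K + i)) (Suc (n div K))"
definition "pool2 = region_bits (\<lambda>c. P (c * s)) sparse2 s (3 * s) (\<lambda>c i. F (c * s + i) - F (c * s)) (Suc (n div s))"

lemma P_mono: "g \<le> h \<Longrightarrow> P g \<le> P h"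
  using mono[of g h] by (simp add: P_def)

lemma pool1: "length pool1 = P (Suc (n div K) * K)"
  "b \<le> n div K \<Longrightarrow> sparse1 b \<Longrightarrow> i < K \<Longrightarrow>
     P (b * K) + i * L + L \<le> length pool1 \<and> field pool1 (P (b * K) + i * L) L = F (b * K + i)"
proof -
  have *: "P (b * K) \<le> P (Suc b * K)" for b by (rule P_mono) simp
  show l: "length pool1 = P (Suc (n div K) * K)"
    unfolding pool1_def by (rule region_bits) (use * F_less in \<open>auto simp: sparse1_def\<close>)
  show "b \<le> n div K \<Longrightarrow> sparse1 b \<Longrightarrow> i < K \<Longrightarrow>
     P (b * K) + i * L + L \<le> length pool1 \<and> field pool1 (P (b * K) + i * L) L = F (b * K + i)"
    unfolding l unfolding pool1_def by (rule region_bits(2)) (use * F_less in \<open>auto simp: sparse1_def\<close>)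
qed

lemma pool2: "length pool2 = P (Suc (n div s) * s)"
  "c \<le> n div s \<Longrightarrow> sparse2 c \<Longrightarrow> i < s \<Longrightarrow> P (c * s) + i * (3 * s) + 3 * s \<le> length pool2 \<and>
     field pool2 (P (c * s) + i * (3 * s)) (3 * s) = F (c * s + i) - F (c * s)"
proof -
  have *: "P (c * s) \<le> P (Suc c * s)" for c by (rule P_mono) simp
  have v: "F (c * s + i) - F (c * s) < 2 ^ (3 * s)" if "sparse2 c" "i < s" for c i
  proof -
    have "F (c div L * K) \<le> F (c * s)" by (rule mono[OF subblock_in_block(1)])
    moreover have "F (c * s + i) - F (c div L * K) < 2 ^ (3 * s)"
      by (rule dense_block) (use that subblock_in_block[of c] in \<open>auto simp: sparse2_def\<close>)
    ultimately show ?thesis by linarith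
  qed
  show l: "length pool2 = P (Suc (n div s) * s)"
    unfolding pool2_def by (rule region_bits) (use * v in \<open>auto simp: sparse2_def R_def\<close>)
  show "c \<le> n div s \<Longrightarrow> sparse2 c \<Longrightarrow> i < s \<Longrightarrow> P (c * s) + i * (3 * s) + 3 * s \<le> length pool2 \<and>
     field pool2 (P (c * s) + i * (3 * s)) (3 * s) = F (c * s + i) - F (c * s)"
    unfolding l unfolding pool2_def by (rule region_bits(2)) (use * v in \<open>auto simp: sparse2_def R_def\<close>)
qed

text \<open>The ones of a window starting at \<open>P (c * s)\<close> belong to consecutive
  arguments, so index \<open>i\<close> selects the one of \<open>c * s + i\<close>. The bound on the
  growth keeps all \<open>s\<close> of them inside the window.\<close>

lemma select_unary:
  assumes "c \<le> n div s" "P (Suc c * s) < P (c * s) + R" "i < s"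
  shows "select (field unary (P (c * s)) R) i = i + (F (c * s + i) - F (c * s))"
    and "i + (F (c * s + i) - F (c * s)) < R"
    and "P (c * s) + R \<le> length unary"
proof -
  let ?x = "field unary (P (c * s)) R"
  let ?p = "\<lambda>i. P (c * s + i) - P (c * s)"
  have "c * s \<le> n div s * s" using assms(1) by simp
  also have "\<dots> \<le> n" by simp
  finally have "c * s \<le> n" .
  then show len: "P (c * s) + R \<le> length unary" using bounded[of "c * s"] by (simp add: unary_def P_def)
  have bit: "bit ?x q \<longleftrightarrow> q < R \<and> (\<exists>g. P g = P (c * s) + q)" for q
    using len by (auto simp: bit_field unary_def)
  have p: "P (c * s) + ?p j = P (c * s + j)" for j using P_strict[of "c * s" "c * s + j"] by (cases "j = 0") auto
  have less: "?p j < R" if "j < s" for j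
    using P_strict[of "c * s + j" "Suc c * s"] that assms(2) p[of j] by simp
  have pi: "?p i = i + (F (c * s + i) - F (c * s))"
    using mono[of "c * s" "c * s + i"] by (simp add: P_def)
  then show "i + (F (c * s + i) - F (c * s)) < R" using less[OF assms(3)] by simp
  have set: "{q. q < ?p i \<and> bit ?x q} = ?p ` {..<i}"
  proof (intro equalityI subsetI)
    fix q assume "q \<in> {q. q < ?p i \<and> bit ?x q}"
    then obtain g where g: "q < ?p i" "P g = P (c * s) + q" by (auto simp: bit)
    then have "P g < P (c * s + i)" using p[of i] by linarith
    then have "g < c * s + i" by (simp add: P_less_iff)
    moreover have "\<not> P g < P (c * s)" using g by simp
    then have "c * s \<le> g" by (simp add: P_less_iff)
    ultimately show "q \<in> ?p ` {..<i}" using g by (intro image_eqI[of _ _ "g - c * s"]) auto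
  next
    fix q assume "q \<in> ?p ` {..<i}"
    then obtain j where j: "j < i" "q = ?p j" by auto
    then have "q < ?p i" using p[of i] p[of j] P_strict[of "c * s + j" "c * s + i"] by simp
    moreover have "bit ?x q" using p[of j] j less[of j] assms(3) by (auto simp: bit)
    ultimately show "q \<in> {q. q < ?p i \<and> bit ?x q}" by simp
  qed
  have "inj_on ?p {..<i}" by (rule inj_onI) (metis p P_eq_iff add_left_cancel)
  then have card: "card {q. q < ?p i \<and> bit ?x q} = i" unfolding set by (simp add: card_image)
  have "select ?x i = ?p i" unfolding select_def
  proof (rule the_equality)
    show "bit ?x (?p i) \<and> card {q. q < ?p i \<and> bit ?x q} = i"
      using card p[of i] less[OF assms(3)] by (auto simp: bit)
    fix q assume q: "bit ?x q \<and> card {r. r < q \<and> bit ?x r} = i"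
    have contr: False if "a < b" "bit ?x a" "card {r. r < a \<and> bit ?x r} = card {r. r < b \<and> bit ?x r}" for a b
    proof -
      have "{r. r < a \<and> bit ?x r} \<subset> {r. r < b \<and> bit ?x r}" using that by auto
      then have "card {r. r < a \<and> bit ?x r} < card {r. r < b \<and> bit ?x r}" by (intro psubset_card_mono) auto
      then show False using that by simp
    qed
    have "bit ?x (?p i)" using p[of i] less[OF assms(3)] by (auto simp: bit)
    then show "q = ?p i" using contr[of q "?p i"] contr[of "?p i" q] q card by (metis linorder_neqE_nat)
  qed
  then show "select ?x i = i + (F (c * s + i) - F (c * s))" using pi by simp
qed

lemma lengths:
  "length vals_A = n div K + 1" "length vals_sp1 = n div K + 1" "length vals_Rel = n div s + 1"
  "length vals_sp2 = n div s + 1" "length unary = 2 * n + R" "length vals_Tab = 2 ^ R * s"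
  by (simp_all add: vals_A_def vals_sp1_def vals_Rel_def vals_sp2_def unary_def vals_Tab_def)

lemma ranges:
  "x \<in> set vals_A \<Longrightarrow> x < 2 ^ L" "x \<in> set vals_sp1 \<Longrightarrow> x < 2 ^ 1" "x \<in> set vals_Rel \<Longrightarrow> x < 2 ^ (3 * s)"
  "x \<in> set vals_sp2 \<Longrightarrow> x < 2 ^ 1" "x \<in> set vals_Tab \<Longrightarrow> x < 2 ^ (3 * s)"
proof -
  show "x \<in> set vals_A \<Longrightarrow> x < 2 ^ L" using F_less by (auto simp: vals_A_def)
  show "x \<in> set vals_sp1 \<Longrightarrow> x < 2 ^ 1" "x \<in> set vals_sp2 \<Longrightarrow> x < 2 ^ 1"
    by (auto simp: vals_sp1_def vals_sp2_def)
  have "F (c * s) - F (c div L * K) < 2 ^ (3 * s)" if "\<not> sparse1 (c div L)" for c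
    by (rule dense_block[OF that subblock_in_block(1)]) (use subblock_in_block(2)[of c] in simp)
  then show "x \<in> set vals_Rel \<Longrightarrow> x < 2 ^ (3 * s)" by (auto simp: vals_Rel_def)
  show "x \<in> set vals_Tab \<Longrightarrow> x < 2 ^ (3 * s)" by (auto simp: vals_Tab_def intro: less_imp_diff_less)
qed

lemma lookup:
  assumes "g \<le> n"
  defines "b \<equiv> g div K" and "c \<equiv> g div s"
  shows "b < length vals_A" "b < length vals_sp1" "c < length vals_Rel" "c < length vals_sp2"
    and "vals_A ! b = F (b * K)" "vals_sp1 ! b = of_bool (sparse1 b)" "vals_sp2 ! c = of_bool (sparse2 c)"
    and "\<not> sparse1 b \<Longrightarrow> vals_A ! b + vals_Rel ! c = F (c * s)"
    and "\<not> sparse1 b \<Longrightarrow> \<not> sparse2 c \<Longrightarrow> P (c * s) + R \<le> length unary \<and>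
      field unary (P (c * s)) R * s + g mod s < length vals_Tab \<and>
      F (c * s) + vals_Tab ! (field unary (P (c * s)) R * s + g mod s) = F g"
proof -
  show bc: "b < length vals_A" "b < length vals_sp1" "c < length vals_Rel" "c < length vals_sp2"
    using assms(1) by (simp_all add: lengths b_def c_def div_le_mono le_imp_less_Suc)
  show "vals_A ! b = F (b * K)" "vals_sp1 ! b = of_bool (sparse1 b)" "vals_sp2 ! c = of_bool (sparse2 c)"
    using bc by (simp_all add: lengths vals_A_def vals_sp1_def vals_sp2_def del: upt_Suc)
  have bc': "c div L = b" by (simp add: b_def c_def K_def div_mult2_eq)
  show rel: "vals_A ! b + vals_Rel ! c = F (c * s)" if "\<not> sparse1 b"
    using that bc mono[OF subblock_in_block(1)[of c]]
    by (simp add: lengths vals_A_def vals_Rel_def bc' del: upt_Suc)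
  assume d: "\<not> sparse1 b" "\<not> sparse2 c"
  then have span: "P (Suc c * s) < P (c * s) + R" by (simp add: sparse2_def bc')
  have i: "g mod s < s" and cn: "c \<le> n div s" using L_pos assms(1) by (auto simp: c_def div_le_mono)
  note sel = select_unary[OF cn span i]
  let ?x = "field unary (P (c * s)) R"
  have "?x < 2 ^ R" by (rule field_less)
  then have "Suc ?x * s \<le> 2 ^ R * s" by (intro mult_right_mono) auto
  then have t: "?x * s + g mod s < 2 ^ R * s" using i by simp
  \<comment> \<open>Positions inside a window are below \<open>R\<close>, so the guard of
    \<open>vals_Tab\<close> lets every window that occurs pass.\<close>
  have "R \<le> 2 ^ (3 * s)" using three_square_le[of s] by (simp add: R_def power2_eq_square mult.commute)
  moreover have "(?x * s + g mod s) div s = ?x" "(?x * s + g mod s) mod s = g mod s" using i by auto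
  ultimately have tab: "vals_Tab ! (?x * s + g mod s) = F (c * s + g mod s) - F (c * s)"
    using t sel(1,2) by (simp add: vals_Tab_def)
  have "c * s + g mod s = g" by (simp add: c_def)
  then have "F (c * s) + vals_Tab ! (?x * s + g mod s) = F g" using tab mono[of "c * s" g] by simp
  then show "P (c * s) + R \<le> length unary \<and> ?x * s + g mod s < length vals_Tab \<and>
      F (c * s) + vals_Tab ! (?x * s + g mod s) = F g"
    using sel(3) t by (simp add: lengths)
qed

end

section \<open>Colexicographic order\<close>

definition colex_le :: "'a::linorder list \<Rightarrow> 'a list \<Rightarrow> bool" where
  "colex_le \<alpha> \<beta> \<longleftrightarrow> colex_less \<alpha> \<beta> \<or> \<alpha> = \<beta>"

lemma colex_irrefl [simp]: "\<not> colex_less \<alpha> \<alpha>"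
  unfolding colex_less_def by (rule lexord_irreflexive) auto

lemma colex_trans: "colex_less \<alpha> \<beta> \<Longrightarrow> colex_less \<beta> \<gamma> \<Longrightarrow> colex_less \<alpha> \<gamma>"
  unfolding colex_less_def by (rule lexord_trans) (auto simp: trans_def)

lemma colex_linear: "colex_less \<alpha> \<beta> \<or> \<alpha> = \<beta> \<or> colex_less \<beta> \<alpha>"
  unfolding colex_less_def using lexord_linear[of "{(a, b). a < b}" "rev \<alpha>" "rev \<beta>"] linorder_less_linear
  by (simp add: rev_is_rev_conv) blast

lemma colex_snoc: "colex_less (\<alpha> @ [a]) (\<beta> @ [b]) \<longleftrightarrow> a < b \<or> a = b \<and> colex_less \<alpha> \<beta>"
  by (auto simp: colex_less_def)

lemma colex_le_snoc: "colex_le (\<alpha> @ [a]) (\<beta> @ [a]) \<longleftrightarrow> colex_le \<alpha> \<beta>"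
  by (auto simp: colex_le_def colex_snoc)

lemma not_colex_less: "\<not> colex_less \<alpha> \<beta> \<longleftrightarrow> colex_le \<beta> \<alpha>"
  using colex_linear colex_trans colex_irrefl by (metis colex_le_def)

lemma colex_le_refl [simp]: "colex_le \<alpha> \<alpha>"
  by (simp add: colex_le_def)

lemma colex_le_trans: "colex_le \<alpha> \<beta> \<Longrightarrow> colex_le \<beta> \<gamma> \<Longrightarrow> colex_le \<alpha> \<gamma>"
  using colex_trans by (auto simp: colex_le_def)

lemma colex_less_le_trans: "colex_less \<alpha> \<beta> \<Longrightarrow> colex_le \<beta> \<gamma> \<Longrightarrow> colex_less \<alpha> \<gamma>"
  using colex_trans by (auto simp: colex_le_def)

text \<open>The first letter is the least significant one in colex order. The contrapositive,
  monotonicity of \<open>tl\<close>, is what makes dropping a letter a monotone map between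
  ranks.\<close>

lemma colex_tl:
  assumes "length \<alpha> = length \<beta>" "colex_less (tl \<alpha>) (tl \<beta>)"
  shows "colex_less \<alpha> \<beta>"
proof (cases \<alpha>)
  case (Cons a \<alpha>')
  then obtain b \<beta>' where \<beta>: "\<beta> = b # \<beta>'" using assms(1) by (cases \<beta>) auto
  have "(rev \<alpha>' @ [a], rev \<beta>' @ [b]) \<in> lexord {(a, b). a < b}"
    by (rule lexord_sufI) (use assms Cons \<beta> in \<open>auto simp: colex_less_def\<close>)
  then show ?thesis using Cons \<beta> by (simp add: colex_less_def)
qed (use assms in simp)

lemma colex_le_tl:
  assumes "length \<alpha> = length \<beta>" "colex_le \<alpha> \<beta>"
  shows "colex_le (tl \<alpha>) (tl \<beta>)"
  using assms colex_tl[of \<beta> \<alpha>] by (metis not_colex_less)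

lemma finite_colex_extreme:
  assumes "finite (S :: 'a::linorder list set)" "S \<noteq> {}"
  shows "\<exists>m\<in>S. \<forall>\<gamma>\<in>S. colex_le m \<gamma>" "\<exists>m\<in>S. \<forall>\<gamma>\<in>S. colex_le \<gamma> m"
proof -
  from assms show "\<exists>m\<in>S. \<forall>\<gamma>\<in>S. colex_le m \<gamma>"
    by (induction rule: finite_ne_induct) (auto, metis colex_le_def colex_le_trans not_colex_less)
  from assms show "\<exists>m\<in>S. \<forall>\<gamma>\<in>S. colex_le \<gamma> m"
    by (induction rule: finite_ne_induct) (auto, metis colex_le_def colex_le_trans not_colex_less)
qed

section \<open>Walks\<close>

lemma reaches_Nil [simp]: "reaches E [] v"
  by (auto simp: reaches_def intro!: exI[of _ "[v]"])

lemma reaches_snoc: "reaches E (\<alpha> @ [c]) v \<longleftrightarrow> (\<exists>u. reaches E \<alpha> u \<and> (u, v, c) \<in> E)"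
proof
  assume "reaches E (\<alpha> @ [c]) v"
  then obtain vs where vs: "length vs = length \<alpha> + 2"
    "\<forall>i < length \<alpha> + 1. (vs ! i, vs ! (i + 1), (\<alpha> @ [c]) ! i) \<in> E" "vs ! (length \<alpha> + 1) = v"
    by (auto simp: reaches_def)
  have "(vs ! i, vs ! (i + 1), \<alpha> ! i) \<in> E" if "i < length \<alpha>" for i
    using vs(2)[rule_format, of i] that by (simp add: nth_append)
  then have "reaches E \<alpha> (vs ! length \<alpha>)"
    unfolding reaches_def
    by (intro exI[of _ "take (length \<alpha> + 1) vs"]) (use vs in auto)
  moreover have "(vs ! length \<alpha>, v, c) \<in> E" using vs(2)[rule_format, of "length \<alpha>"] vs(3) by simp
  ultimately show "\<exists>u. reaches E \<alpha> u \<and> (u, v, c) \<in> E" by blast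
next
  assume "\<exists>u. reaches E \<alpha> u \<and> (u, v, c) \<in> E"
  then obtain u vs where vs: "length vs = length \<alpha> + 1"
    "\<forall>i < length \<alpha>. (vs ! i, vs ! (i + 1), \<alpha> ! i) \<in> E" "vs ! length \<alpha> = u" "(u, v, c) \<in> E"
    by (auto simp: reaches_def)
  show "reaches E (\<alpha> @ [c]) v"
    unfolding reaches_def
    by (rule exI[of _ "vs @ [v]"]) (use vs in \<open>auto simp: nth_append less_Suc_eq\<close>)
qed

lemma reaches_append: "reaches E (\<alpha> @ \<beta>) v \<Longrightarrow> reaches E \<beta> v"
  by (induction \<beta> arbitrary: v rule: rev_induct) (auto simp: reaches_snoc simp flip: append_assoc)

lemma reaches_tl: "reaches E \<alpha> v \<Longrightarrow> reaches E (tl \<alpha>) v"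
  using reaches_append[of E "[hd \<alpha>]" "tl \<alpha>" v] by (cases \<alpha>) auto

lemma mers_snoc: "\<gamma> @ [c] \<in> mers E (Suc l) \<longleftrightarrow> \<gamma> \<in> mers E l \<and> (\<exists>u v. reaches E \<gamma> u \<and> (u, v, c) \<in> E)"
proof -
  have "(\<exists>v. reaches E (\<gamma> @ [c]) v) \<longleftrightarrow> (\<exists>u v. reaches E \<gamma> u \<and> (u, v, c) \<in> E)"
    using reaches_snoc[of E \<gamma> c] by blast
  then show ?thesis unfolding mers_def by auto
qed

lemma mers_0: "mers E 0 = {[]}"
  by (auto simp: mers_def)

lemma mers_take: "\<alpha> \<in> mers E k \<Longrightarrow> i \<le> k \<Longrightarrow> take i \<alpha> \<in> mers E i"
proof (induction "k - i" arbitrary: i)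
  case (Suc d)
  then have "take (Suc i) \<alpha> \<in> mers E (Suc i)" by simp
  moreover have "take (Suc i) \<alpha> = take i \<alpha> @ [\<alpha> ! i]"
    using Suc by (intro take_Suc_conv_app_nth) (auto simp: mers_def)
  ultimately show ?case by (simp add: mers_snoc)
qed (auto simp: mers_def)

lemma mers_tl: "\<alpha> \<in> mers E k \<Longrightarrow> tl \<alpha> \<in> mers E (k - 1)"
  using reaches_tl[of E \<alpha>] by (simp add: mers_def) blast

section \<open>Wheeler graphs\<close>

locale wheeler =
  fixes V :: "'v set" and \<Sigma> :: "'a::linorder set" and E :: "('v \<times> 'v \<times> 'a) set" and le :: "('v \<times> 'v) set"
  assumes graph: "labeled_graph V \<Sigma> E" and det: "deterministic E" and order: "wheeler_order V E le"
begin

lemma finite_V: "finite V" and finite_\<Sigma>: "finite \<Sigma>" and E_sub: "E \<subseteq> V \<times> V \<times> \<Sigma>"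
  using graph by (auto simp: labeled_graph_def)

lemma finite_E: "finite E"
  using E_sub finite_V finite_\<Sigma> by (meson finite_SigmaI finite_subset)

lemma E_dest: "(u, v, a) \<in> E \<Longrightarrow> u \<in> V \<and> v \<in> V \<and> a \<in> \<Sigma>"
  using E_sub by auto

lemma le_refl: "u \<in> V \<Longrightarrow> (u, u) \<in> le"
  and le_trans': "(u, v) \<in> le \<Longrightarrow> (v, x) \<in> le \<Longrightarrow> (u, x) \<in> le"
  and le_antisym': "(u, v) \<in> le \<Longrightarrow> (v, u) \<in> le \<Longrightarrow> u = v"
  and le_total: "u \<in> V \<Longrightarrow> v \<in> V \<Longrightarrow> (u, v) \<in> le \<or> (v, u) \<in> le"
  and le_V: "(u, v) \<in> le \<Longrightarrow> u \<in> V \<and> v \<in> V"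
proof -
  have "linear_order_on V le" using order by (simp add: wheeler_order_def)
  then have *: "refl_on V le" "trans le" "antisym le" "total_on V le" "le \<subseteq> V \<times> V"
    by (auto simp: order_on_defs)
  show "u \<in> V \<Longrightarrow> (u, u) \<in> le" using *(1) by (auto dest: refl_onD)
  then show "u \<in> V \<Longrightarrow> v \<in> V \<Longrightarrow> (u, v) \<in> le \<or> (v, u) \<in> le"
    using *(4) by (auto simp: total_on_def)
  show "(u, v) \<in> le \<Longrightarrow> (v, x) \<in> le \<Longrightarrow> (u, x) \<in> le" using *(2) by (auto dest: transD)
  show "(u, v) \<in> le \<Longrightarrow> (v, u) \<in> le \<Longrightarrow> u = v" using *(3) by (auto dest: antisymD)
  show "(u, v) \<in> le \<Longrightarrow> u \<in> V \<and> v \<in> V" using *(5) by auto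
qed

lemma W0: "u \<in> V \<Longrightarrow> v \<in> V \<Longrightarrow> no_incoming E u \<Longrightarrow> \<not> no_incoming E v \<Longrightarrow> (u, v) \<in> le \<and> u \<noteq> v"
  using order by (auto simp: wheeler_order_def)

lemma W1: "(u, v, a) \<in> E \<Longrightarrow> (u', v', a') \<in> E \<Longrightarrow> a < a' \<Longrightarrow> (v, v') \<in> le \<and> v \<noteq> v'"
  using order unfolding wheeler_order_def by blast

text \<open>Extends the second Wheeler condition to equal sources, where determinism makes the
  targets equal.\<close>

lemma W2: "(u, v, a) \<in> E \<Longrightarrow> (u', v', a) \<in> E \<Longrightarrow> (u, u') \<in> le \<Longrightarrow> (v, v') \<in> le"
proof (cases "u = u'")
  case True
  assume "(u, v, a) \<in> E" "(u', v', a) \<in> E"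
  then have "v = v'" "v \<in> V" using True det E_dest by (auto simp: deterministic_def)
  then show ?thesis using le_refl by simp
next
  case False
  assume "(u, v, a) \<in> E" "(u', v', a) \<in> E" "(u, u') \<in> le"
  then show ?thesis using order False unfolding wheeler_order_def by blast
qed

lemma reaches_V: "reaches E \<alpha> v \<Longrightarrow> \<alpha> \<noteq> [] \<Longrightarrow> v \<in> V"
  by (cases \<alpha> rule: rev_cases) (auto simp: reaches_snoc dest: E_dest)

lemma finite_mers: "finite (mers E l)"
proof -
  have "set \<alpha> \<subseteq> \<Sigma>" if "reaches E \<alpha> v" for \<alpha> v
    using that by (induction \<alpha> arbitrary: v rule: rev_induct) (auto simp: reaches_snoc dest: E_dest)
  then have "mers E l \<subseteq> {\<alpha>. set \<alpha> \<subseteq> \<Sigma> \<and> length \<alpha> = l}" by (auto simp: mers_def)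
  then show ?thesis using finite_lists_length_eq[OF finite_\<Sigma>] finite_subset by blast
qed

lemma mers_set: "\<alpha> \<in> mers E l \<Longrightarrow> c \<in> set \<alpha> \<Longrightarrow> \<exists>u v. (u, v, c) \<in> E"
proof -
  have "c \<in> set \<alpha> \<longrightarrow> (\<exists>u v. (u, v, c) \<in> E)" if "reaches E \<alpha> v" for \<alpha> v
    using that by (induction \<alpha> arbitrary: v rule: rev_induct) (auto simp: reaches_snoc)
  then show "\<alpha> \<in> mers E l \<Longrightarrow> c \<in> set \<alpha> \<Longrightarrow> \<exists>u v. (u, v, c) \<in> E" by (auto simp: mers_def)
qed

text \<open>Compare the last letters: different ones are settled by \<open>W1\<close>; for equal
  ones the induction hypothesis orders the predecessors and \<open>W2\<close> carries this order
  forward. By antisymmetry, a string strictly between two strings that reach \<open>u\<close>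
  reaches \<open>u\<close> only, which is the source of all consecutiveness arguments.\<close>

lemma reaches_mono:
  assumes "length \<beta> = length \<gamma>" "colex_less \<beta> \<gamma>" "reaches E \<beta> x" "reaches E \<gamma> y"
  shows "(x, y) \<in> le"
  using assms
proof (induction \<beta> arbitrary: \<gamma> x y rule: rev_induct)
  case (snoc a \<beta>)
  then obtain \<gamma>' b where \<gamma>: "\<gamma> = \<gamma>' @ [b]" by (cases \<gamma> rule: rev_cases) auto
  with snoc.prems obtain p q where pq: "reaches E \<beta> p" "(p, x, a) \<in> E" "reaches E \<gamma>' q" "(q, y, b) \<in> E"
    by (auto simp: reaches_snoc)
  show ?case
  proof (cases "a < b")
    case True
    then show ?thesis using W1 pq by blast
  next
    case False
    then have "a = b" "colex_less \<beta> \<gamma>'" using snoc.prems \<gamma> by (auto simp: colex_snoc)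
    then show ?thesis using snoc.IH[of \<gamma>' p q] snoc.prems \<gamma> pq W2 by auto
  qed
qed simp

text \<open>A vertex between two vertices with incoming label \<open>a\<close> has an incoming edge,
  since vertices without one come first, and \<open>W1\<close> from both sides forces its label to
  be \<open>a\<close>. By \<open>W2\<close> its predecessor lies between theirs, so the induction
  hypothesis applies to it.\<close>

lemma reaches_convex:
  assumes "reaches E \<gamma> x" "reaches E \<gamma> x'" "(x, y) \<in> le" "(y, x') \<in> le"
  shows "reaches E \<gamma> y"
  using assms
proof (induction \<gamma> arbitrary: x x' y rule: rev_induct)
  case (snoc a \<gamma>)
  from snoc.prems(1,2) obtain p p' where p: "reaches E \<gamma> p" "(p, x, a) \<in> E" "reaches E \<gamma> p'" "(p', x', a) \<in> E"
    unfolding reaches_snoc by blast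
  have "\<not> no_incoming E y"
  proof
    assume "no_incoming E y"
    moreover have "\<not> no_incoming E x" using p by (auto simp: no_incoming_def)
    ultimately have "(y, x) \<in> le" "y \<noteq> x" using W0 snoc.prems le_V by blast+
    then show False using snoc.prems(3) le_antisym' by blast
  qed
  then obtain z b where z: "(z, y, b) \<in> E" by (auto simp: no_incoming_def)
  have "\<not> b < a" using W1[OF z p(2)] snoc.prems(3) le_antisym' by blast
  moreover have "\<not> a < b" using W1[OF p(4) z] snoc.prems(4) le_antisym' by blast
  ultimately have b: "b = a" by simp
  show ?case
  proof (cases "y = x \<or> y = x'")
    case False
    have V: "p \<in> V" "z \<in> V" "p' \<in> V" using p z E_dest by auto
    have "(p, z) \<in> le"
      using W2[of z y a p x] z b p le_total[OF V(1,2)] snoc.prems(3) False le_antisym' by blast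
    moreover have "(z, p') \<in> le"
      using W2[of p' x' a z y] z b p le_total[OF V(2,3)] snoc.prems(4) False le_antisym' by blast
    ultimately have "reaches E \<gamma> z" using snoc.IH p by blast
    then show ?thesis using z b by (auto simp: reaches_snoc)
  qed (use snoc.prems in auto)
qed simp

text \<open>The empty string reaches every element of the type. Intersecting with \<open>V\<close>
  gives it the whole vertex set as interval, from which the search for a string starts.\<close>

definition ends :: "'a list \<Rightarrow> 'v set" where
  "ends \<gamma> = {x \<in> V. reaches E \<gamma> x}"

definition lft :: "'v set \<Rightarrow> 'v" where
  "lft I = (THE u. u \<in> I \<and> (\<forall>x\<in>I. (u, x) \<in> le))"

definition rgt :: "'v set \<Rightarrow> 'v" where
  "rgt I = (THE u. u \<in> I \<and> (\<forall>x\<in>I. (x, u) \<in> le))"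

lemma extremes:
  assumes "I \<subseteq> V" "I \<noteq> {}"
  shows "\<exists>u\<in>I. \<forall>x\<in>I. (u, x) \<in> le" "\<exists>u\<in>I. \<forall>x\<in>I. (x, u) \<in> le"
proof -
  have "finite I" using assms finite_V finite_subset by blast
  then have "I \<subseteq> V \<longrightarrow> (\<exists>u\<in>I. \<forall>x\<in>I. (u, x) \<in> le) \<and> (\<exists>u\<in>I. \<forall>x\<in>I. (x, u) \<in> le)"
    using assms(2)
  proof (induction rule: finite_ne_induct)
    case (singleton x)
    then show ?case using le_refl by auto
  next
    case (insert x I)
    show ?case
    proof
      assume *: "insert x I \<subseteq> V"
      then obtain u v where uv: "u \<in> I" "\<forall>x\<in>I. (u, x) \<in> le" "v \<in> I" "\<forall>x\<in>I. (x, v) \<in> le" using insert by auto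
      have "\<exists>u\<in>insert x I. \<forall>y\<in>insert x I. (u, y) \<in> le"
        using le_total[of x u] le_refl[of x] * uv(1,2) le_trans' by (metis insert_iff subset_iff)
      moreover have "\<exists>u\<in>insert x I. \<forall>y\<in>insert x I. (y, u) \<in> le"
        using le_total[of x v] le_refl[of x] * uv(3,4) le_trans' by (metis insert_iff subset_iff)
      ultimately show "(\<exists>u\<in>insert x I. \<forall>y\<in>insert x I. (u, y) \<in> le) \<and> (\<exists>u\<in>insert x I. \<forall>y\<in>insert x I. (y, u) \<in> le)" ..
    qed
  qed
  then show "\<exists>u\<in>I. \<forall>x\<in>I. (u, x) \<in> le" "\<exists>u\<in>I. \<forall>x\<in>I. (x, u) \<in> le" using assms by auto
qed

lemma lft_eqI: "u \<in> I \<Longrightarrow> \<forall>x\<in>I. (u, x) \<in> le \<Longrightarrow> lft I = u"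
  unfolding lft_def by (rule the_equality) (auto dest: le_antisym')

lemma rgt_eqI: "u \<in> I \<Longrightarrow> \<forall>x\<in>I. (x, u) \<in> le \<Longrightarrow> rgt I = u"
  unfolding rgt_def by (rule the_equality) (auto dest: le_antisym')

lemma lft_in: "I \<subseteq> V \<Longrightarrow> I \<noteq> {} \<Longrightarrow> lft I \<in> I" and lft_le: "I \<subseteq> V \<Longrightarrow> x \<in> I \<Longrightarrow> (lft I, x) \<in> le"
  using extremes(1)[of I] lft_eqI by (blast, metis empty_iff)

lemma rgt_in: "I \<subseteq> V \<Longrightarrow> I \<noteq> {} \<Longrightarrow> rgt I \<in> I" and rgt_le: "I \<subseteq> V \<Longrightarrow> x \<in> I \<Longrightarrow> (x, rgt I) \<in> le"
  using extremes(2)[of I] rgt_eqI by (blast, metis empty_iff)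

definition rank :: "'a list \<Rightarrow> 'v \<Rightarrow> nat" where
  "rank \<gamma> u = card {\<beta> \<in> mers E (length \<gamma>). reaches E \<beta> u \<and> colex_le \<beta> \<gamma>}"

definition lrank :: "'a list \<Rightarrow> nat" where
  "lrank \<gamma> = rank \<gamma> (lft (ends \<gamma>))"

lemma ends_sub: "ends \<gamma> \<subseteq> V"
  by (auto simp: ends_def)

lemma ends_nonempty: "\<gamma> \<in> mers E l \<Longrightarrow> V \<noteq> {} \<Longrightarrow> ends \<gamma> \<noteq> {}"
  by (cases "\<gamma> = []") (auto simp: ends_def mers_def dest: reaches_V)

text \<open>By convexity the reached vertices form an interval, which is then the only maximal one,
  so the definite description in \<open>handle\<close> denotes its two ends.\<close>

lemma handle_eq:
  assumes "\<alpha> \<in> mers E k" "k \<ge> 1"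
  shows "handle E le \<alpha> = (lft (ends \<alpha>), rgt (ends \<alpha>), lrank \<alpha>)"
proof -
  have ne: "\<alpha> \<noteq> []" and l: "length \<alpha> = k" using assms by (auto simp: mers_def)
  then have R: "{x. reaches E \<alpha> x} = ends \<alpha>" by (auto simp: ends_def dest: reaches_V)
  have en: "ends \<alpha> \<noteq> {}" using assms R by (auto simp: mers_def)
  let ?u = "lft (ends \<alpha>)" and ?v = "rgt (ends \<alpha>)"
  have "?u \<in> ends \<alpha>" "?v \<in> ends \<alpha>" using lft_in[OF ends_sub en] rgt_in[OF ends_sub en] by auto
  then have "x \<in> ends \<alpha>" if "(?u, x) \<in> le" "(x, ?v) \<in> le" for x
    using reaches_convex[of \<alpha> ?u ?v x] that le_V[OF that(1)] unfolding ends_def by blast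
  then have iv: "interval le ?u ?v = ends \<alpha>"
    using lft_le[OF ends_sub] rgt_le[OF ends_sub] unfolding interval_def by blast
  have uv: "(?u, ?v) \<in> le" using lft_le[OF ends_sub rgt_in[OF ends_sub en]] .
  have "maximal_interval le (ends \<alpha>) u v \<longleftrightarrow> u = ?u \<and> v = ?v" for u v
  proof
    assume m: "maximal_interval le (ends \<alpha>) u v"
    then have "interval le u v = ends \<alpha>" using iv unfolding maximal_interval_def by (metis order_refl)
    moreover have "u \<in> interval le u v" "v \<in> interval le u v" using m le_refl le_V
      by (auto simp: maximal_interval_def interval_def)
    ultimately show "u = ?u \<and> v = ?v"
      using lft_eqI[of u "ends \<alpha>"] rgt_eqI[of v "ends \<alpha>"] by (auto simp: interval_def)
  qed (use uv iv in \<open>auto simp: maximal_interval_def\<close>)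
  then have "(THE (u, v). maximal_interval le (ends \<alpha>) u v) = (?u, ?v)"
    by (intro the_equality) auto
  then show ?thesis by (simp add: handle_def R lrank_def rank_def colex_le_def)
qed

definition below :: "nat \<Rightarrow> 'v \<Rightarrow> 'a list set" where
  "below l u = {\<beta> \<in> mers E l. \<forall>\<gamma> \<in> mers E l. reaches E \<gamma> u \<longrightarrow> colex_less \<beta> \<gamma>}"

text \<open>A string strictly between two strings reaching \<open>u\<close> has its end vertices
  squeezed to \<open>u\<close>. So whatever precedes \<alpha> without reaching \<open>u\<close>
  precedes all strings that reach \<open>u\<close>, and this set no longer depends on
  \<alpha>.\<close>

lemma below_eq:
  assumes "\<alpha> \<in> mers E l" "reaches E \<alpha> u"
  shows "{\<beta> \<in> mers E l. colex_le \<beta> \<alpha> \<and> \<not> reaches E \<beta> u} = below l u"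
proof (intro equalityI subsetI)
  fix \<beta> assume "\<beta> \<in> below l u"
  then show "\<beta> \<in> {\<beta> \<in> mers E l. colex_le \<beta> \<alpha> \<and> \<not> reaches E \<beta> u}"
    using assms by (auto simp: below_def colex_le_def)
next
  fix \<beta> assume \<beta>: "\<beta> \<in> {\<beta> \<in> mers E l. colex_le \<beta> \<alpha> \<and> \<not> reaches E \<beta> u}"
  have "colex_less \<beta> \<gamma>" if \<gamma>: "\<gamma> \<in> mers E l" "reaches E \<gamma> u" for \<gamma>
  proof (rule ccontr)
    assume "\<not> colex_less \<beta> \<gamma>"
    then have 1: "colex_less \<gamma> \<beta>" using \<beta> \<gamma> by (auto simp: not_colex_less colex_le_def)
    have 2: "colex_less \<beta> \<alpha>" using \<beta> assms by (auto simp: colex_le_def)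
    obtain y where y: "reaches E \<beta> y" using \<beta> by (auto simp: mers_def)
    have "length \<alpha> = length \<beta>" "length \<beta> = length \<gamma>" using assms \<beta> \<gamma> by (auto simp: mers_def)
    then have "(u, y) \<in> le" "(y, u) \<in> le"
      using reaches_mono[OF _ 1 \<gamma>(2) y] reaches_mono[OF _ 2 y assms(2)] by simp_all
    then show False using le_antisym' y \<beta> by blast
  qed
  then show "\<beta> \<in> below l u" using \<beta> by (auto simp: below_def)
qed

definition grank :: "'a list \<Rightarrow> nat" where
  "grank \<alpha> = card {\<beta> \<in> mers E (length \<alpha>). colex_le \<beta> \<alpha>}"

lemma card_split:
  assumes "\<alpha> \<in> mers E l" "reaches E \<alpha> u"
  shows "card {\<beta> \<in> mers E l. Q \<beta> \<and> colex_le \<beta> \<alpha>} =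
    card {\<beta> \<in> mers E l. Q \<beta> \<and> reaches E \<beta> u \<and> colex_le \<beta> \<alpha>} + card {\<beta> \<in> below l u. Q \<beta>}"
proof -
  have "{\<beta> \<in> mers E l. Q \<beta> \<and> colex_le \<beta> \<alpha>} =
      {\<beta> \<in> mers E l. Q \<beta> \<and> reaches E \<beta> u \<and> colex_le \<beta> \<alpha>} \<union> {\<beta> \<in> below l u. Q \<beta>}"
    unfolding below_eq[OF assms, symmetric] by auto
  also have "card \<dots> = card {\<beta> \<in> mers E l. Q \<beta> \<and> reaches E \<beta> u \<and> colex_le \<beta> \<alpha>} + card {\<beta> \<in> below l u. Q \<beta>}"
    unfolding below_eq[OF assms, symmetric] by (rule card_Un_disjoint) (use finite_mers in auto)
  finally show ?thesis .
qed

text \<open>One stored number per vertex turns the rank in a handle into a global rank, the argument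
  of the monotone map.\<close>

lemma grank_eq:
  assumes "\<alpha> \<in> mers E l" "reaches E \<alpha> u"
  shows "grank \<alpha> = card (below l u) + rank \<alpha> u"
  using card_split[OF assms, of "\<lambda>_. True"] assms(1) by (simp add: grank_def rank_def mers_def)

lemma grank_mono_iff:
  assumes "\<alpha> \<in> mers E l" "\<beta> \<in> mers E l"
  shows "grank \<beta> \<le> grank \<alpha> \<longleftrightarrow> colex_le \<beta> \<alpha>"
proof
  assume "colex_le \<beta> \<alpha>"
  then have "{\<gamma> \<in> mers E l. colex_le \<gamma> \<beta>} \<subseteq> {\<gamma> \<in> mers E l. colex_le \<gamma> \<alpha>}" using colex_le_trans by blast
  then have "card {\<gamma> \<in> mers E l. colex_le \<gamma> \<beta>} \<le> card {\<gamma> \<in> mers E l. colex_le \<gamma> \<alpha>}"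
    by (rule card_mono[rotated]) (use finite_mers in auto)
  then show "grank \<beta> \<le> grank \<alpha>" using assms by (simp add: grank_def mers_def)
next
  assume g: "grank \<beta> \<le> grank \<alpha>"
  show "colex_le \<beta> \<alpha>"
  proof (rule ccontr)
    assume "\<not> colex_le \<beta> \<alpha>"
    then have l: "colex_less \<alpha> \<beta>" by (simp add: not_colex_less[symmetric])
    have "{\<gamma> \<in> mers E l. colex_le \<gamma> \<alpha>} \<subset> {\<gamma> \<in> mers E l. colex_le \<gamma> \<beta>}"
    proof
      show "{\<gamma> \<in> mers E l. colex_le \<gamma> \<alpha>} \<subseteq> {\<gamma> \<in> mers E l. colex_le \<gamma> \<beta>}"
        using l colex_le_trans colex_le_def by blast
      show "{\<gamma> \<in> mers E l. colex_le \<gamma> \<alpha>} \<noteq> {\<gamma> \<in> mers E l. colex_le \<gamma> \<beta>}"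
        using assms(2) \<open>\<not> colex_le \<beta> \<alpha>\<close> colex_le_refl[of \<beta>] by blast
    qed
    then have "card {\<gamma> \<in> mers E l. colex_le \<gamma> \<alpha>} < card {\<gamma> \<in> mers E l. colex_le \<gamma> \<beta>}"
      by (intro psubset_card_mono) (use finite_mers in auto)
    then show False using g assms by (simp add: grank_def mers_def)
  qed
qed

section \<open>Following an edge and dropping a letter\<close>

definition succs :: "'v set \<Rightarrow> 'a \<Rightarrow> 'v set" where
  "succs I c = {x. \<exists>z\<in>I. (z, x, c) \<in> E}"

definition outs :: "'v set \<Rightarrow> 'a set" where
  "outs I = {c. \<exists>z\<in>I. \<exists>x. (z, x, c) \<in> E}"

definition source :: "'v set \<Rightarrow> 'a \<Rightarrow> 'v" where
  "source I c = lft {z \<in> I. \<exists>x. (z, x, c) \<in> E}"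

definition before :: "nat \<Rightarrow> 'v set \<Rightarrow> 'a \<Rightarrow> nat" where
  "before l I c = card {\<beta> \<in> below l (source I c). \<exists>p x. (p, x, c) \<in> E \<and> (source I c, x, c) \<in> E \<and> reaches E \<beta> p}"

definition from_left :: "'v set \<Rightarrow> 'a \<Rightarrow> bool" where
  "from_left I c \<longleftrightarrow> source I c = lft I"

text \<open>If the source is not the left end, the current string is the least one reaching the
  source; the summand 1 is its rank there.\<close>

definition shift :: "nat \<Rightarrow> 'v set \<Rightarrow> 'a \<Rightarrow> nat" where
  "shift l I c = before l I c + (if from_left I c then 0 else 1)"

lemma ends_snoc: "ends (\<gamma> @ [c]) = succs (ends \<gamma>) c"
  using E_dest by (auto simp: ends_def succs_def reaches_snoc)

lemma snoc_in_mers: "\<gamma> @ [c] \<in> mers E (Suc l) \<longleftrightarrow> \<gamma> \<in> mers E l \<and> c \<in> outs (ends \<gamma>)"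
  using E_dest by (auto simp: mers_snoc outs_def ends_def)

lemma source:
  assumes "I \<subseteq> V" "c \<in> outs I"
  obtains x where "(source I c, x, c) \<in> E" "source I c \<in> I" "lft (succs I c) = x" "x \<in> succs I c"
proof -
  let ?Z = "{z \<in> I. \<exists>x. (z, x, c) \<in> E}"
  have Z: "?Z \<subseteq> V" "?Z \<noteq> {}" using assms by (auto simp: outs_def)
  have z: "source I c \<in> ?Z" unfolding source_def by (rule lft_in[OF Z])
  then obtain x where x: "(source I c, x, c) \<in> E" by auto
  have "x \<in> succs I c" using x z by (auto simp: succs_def)
  moreover have "\<forall>y\<in>succs I c. (x, y) \<in> le"
  proof
    fix y assume "y \<in> succs I c"
    then obtain q where q: "q \<in> I" "(q, y, c) \<in> E" by (auto simp: succs_def)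
    then have "(source I c, q) \<in> le" unfolding source_def by (intro lft_le[OF Z(1)]) auto
    then show "(x, y) \<in> le" using W2 x q by blast
  qed
  ultimately show ?thesis using that x z lft_eqI by blast
qed

text \<open>
  The strings reaching the left end of the new interval are those reaching its predecessors, of which
  the ones at \<^term>\<open>source I c\<close> are ranked relative to \<^term>\<open>\<gamma>\<close> and the earlier ones are counted once and for all.
\<close>

lemma lrank_snoc:
  assumes "\<gamma> \<in> mers E l" "c \<in> outs (ends \<gamma>)"
  shows "lrank (\<gamma> @ [c]) = of_bool (from_left (ends \<gamma>) c) * lrank \<gamma> + shift l (ends \<gamma>) c"
    and "shift l (ends \<gamma>) c \<le> num_mers E (Suc l)"
proof -
  let ?I = "ends \<gamma>" let ?z = "source ?I c"
  obtain x where x: "(?z, x, c) \<in> E" "?z \<in> ?I" "lft (succs ?I c) = x"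
    using source[OF ends_sub assms(2)] by metis
  have len: "length \<gamma> = l" using assms(1) by (simp add: mers_def)
  have rz: "reaches E \<gamma> ?z" using x(2) by (simp add: ends_def)
  have ux: "(?z, x', c) \<in> E \<longleftrightarrow> x' = x" for x' using x(1) det by (auto simp: deterministic_def)
  have "{\<beta> \<in> mers E (Suc l). reaches E \<beta> x \<and> colex_le \<beta> (\<gamma> @ [c])} =
      (\<lambda>\<beta>. \<beta> @ [c]) ` {\<beta> \<in> mers E l. (\<exists>p. (p, x, c) \<in> E \<and> reaches E \<beta> p) \<and> colex_le \<beta> \<gamma>}" (is "?A = _ ` ?B")
  proof (intro equalityI subsetI)
    fix \<beta>' assume \<beta>': "\<beta>' \<in> ?A"
    then obtain \<beta> d where \<beta>: "\<beta>' = \<beta> @ [d]" by (cases \<beta>' rule: rev_cases) (auto simp: mers_def)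
    with \<beta>' obtain p where p: "reaches E \<beta> p" "(p, x, d) \<in> E" by (auto simp: reaches_snoc)
    \<comment> \<open>All edges into one vertex have the same label, since \<open>W1\<close> would
      separate their targets otherwise.\<close>
    have "d = c" using W1[OF p(2) x(1)] W1[OF x(1) p(2)] by (meson linorder_neqE)
    then show "\<beta>' \<in> (\<lambda>\<beta>. \<beta> @ [c]) ` ?B" using \<beta>' \<beta> p by (auto simp: mers_snoc colex_le_snoc)
  next
    fix \<beta>' assume "\<beta>' \<in> (\<lambda>\<beta>. \<beta> @ [c]) ` ?B"
    then obtain \<beta> p where "\<beta>' = \<beta> @ [c]" "\<beta> \<in> mers E l" "(p, x, c) \<in> E" "reaches E \<beta> p" "colex_le \<beta> \<gamma>" by blast
    then show "\<beta>' \<in> ?A" by (auto simp: mers_snoc colex_le_snoc reaches_snoc)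
  qed
  then have "rank (\<gamma> @ [c]) x = card ?B"
    by (simp add: rank_def len card_image inj_on_def)
  also have "\<dots> = card {\<beta> \<in> mers E l. (\<exists>p. (p, x, c) \<in> E \<and> reaches E \<beta> p) \<and> reaches E \<beta> ?z \<and> colex_le \<beta> \<gamma>}
      + card {\<beta> \<in> below l ?z. \<exists>p. (p, x, c) \<in> E \<and> reaches E \<beta> p}"
    by (rule card_split[OF assms(1) rz])
  also have "{\<beta> \<in> mers E l. (\<exists>p. (p, x, c) \<in> E \<and> reaches E \<beta> p) \<and> reaches E \<beta> ?z \<and> colex_le \<beta> \<gamma>}
      = {\<beta> \<in> mers E l. reaches E \<beta> ?z \<and> colex_le \<beta> \<gamma>}" using x(1) by blast
  also have "card {\<beta> \<in> below l ?z. \<exists>p. (p, x, c) \<in> E \<and> reaches E \<beta> p} = before l ?I c"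
    unfolding before_def by (rule arg_cong[where f = card]) (auto simp: ux)
  finally have r: "rank (\<gamma> @ [c]) x = rank \<gamma> ?z + before l ?I c" by (simp add: rank_def len)
  have lr: "lrank (\<gamma> @ [c]) = rank (\<gamma> @ [c]) x" by (simp add: lrank_def ends_snoc x(3))
  have pos: "rank \<gamma> ?z \<ge> 1"
  proof -
    have "card {\<gamma>} \<le> rank \<gamma> ?z" unfolding rank_def len
      using assms(1) rz finite_mers by (intro card_mono) auto
    then show ?thesis by simp
  qed
  \<comment> \<open>A smaller string reaching the source would, by \<open>reaches_mono\<close>, put
    the source at or before the left end of the interval.\<close>
  have one: "rank \<gamma> ?z = 1" if "\<not> from_left ?I c"
  proof -
    have "{\<beta> \<in> mers E l. reaches E \<beta> ?z \<and> colex_le \<beta> \<gamma>} = {\<gamma>}"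
    proof (intro equalityI subsetI)
      fix \<beta> assume \<beta>: "\<beta> \<in> {\<beta> \<in> mers E l. reaches E \<beta> ?z \<and> colex_le \<beta> \<gamma>}"
      have "lft ?I \<in> ?I" using lft_in[OF ends_sub] x(2) by blast
      then have "reaches E \<gamma> (lft ?I)" by (simp add: ends_def)
      then have "colex_less \<beta> \<gamma> \<Longrightarrow> (?z, lft ?I) \<in> le"
        using reaches_mono[of \<beta> \<gamma> ?z "lft ?I"] \<beta> len by (simp add: mers_def)
      moreover have "(lft ?I, ?z) \<in> le" using lft_le[OF ends_sub x(2)] .
      ultimately show "\<beta> \<in> {\<gamma>}" using that \<beta> le_antisym' unfolding from_left_def colex_le_def by blast
    qed (use assms rz in auto)
    then show ?thesis by (simp add: rank_def len)
  qed
  show eq: "lrank (\<gamma> @ [c]) = of_bool (from_left ?I c) * lrank \<gamma> + shift l ?I c"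
    using r lr one by (cases "from_left ?I c") (auto simp: shift_def from_left_def lrank_def)
  have "shift l ?I c \<le> lrank (\<gamma> @ [c])" using r lr pos by (auto simp: shift_def)
  also have "\<dots> \<le> num_mers E (Suc l)" unfolding lrank_def rank_def num_mers_def
    by (intro card_mono) (use finite_mers len in auto)
  finally show "shift l ?I c \<le> num_mers E (Suc l)" .
qed

text \<open>Strings of length \<open>k - 1\<close> that reach only vertices without outgoing edges
  can outnumber the \<open>k\<close>-mers. The extendable ones cannot, because each arises from a
  \<open>k\<close>-mer by deleting the last letter.\<close>

definition ext :: "nat \<Rightarrow> 'a list set" where
  "ext k = {\<gamma> \<in> mers E (k - 1). \<exists>c. \<gamma> @ [c] \<in> mers E k}"

text \<open>The existential form yields a function that is defined and monotone on all numbers, not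
  only on ranks of \<open>k\<close>-mers, as the succinct representation of monotone maps
  demands.\<close>

definition ext_rank :: "nat \<Rightarrow> nat \<Rightarrow> nat" where
  "ext_rank k g = card {\<gamma> \<in> ext k. \<exists>\<alpha> \<in> mers E k. grank \<alpha> \<le> g \<and> colex_le \<gamma> (tl \<alpha>)}"

definition ext_below :: "nat \<Rightarrow> 'v set \<Rightarrow> nat" where
  "ext_below k I = card (ext k \<inter> below (k - 1) (lft I))"

lemma finite_ext: "finite (ext k)"
  using finite_mers by (simp add: ext_def)

lemma card_ext: "card (ext k) \<le> num_mers E k"
proof -
  have "ext k \<subseteq> butlast ` mers E k" unfolding ext_def by force
  then show ?thesis unfolding num_mers_def
    by (meson card_image_le card_mono finite_imageI finite_mers le_trans)
qed

lemma ext_rank_mono: "g \<le> h \<Longrightarrow> ext_rank k g \<le> ext_rank k h"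
  unfolding ext_rank_def by (rule card_mono) (simp add: finite_ext, blast intro: order_trans)

lemma ext_rank_le: "ext_rank k g \<le> num_mers E k"
proof -
  have "ext_rank k g \<le> card (ext k)" unfolding ext_rank_def by (intro card_mono) (auto simp: finite_ext)
  then show ?thesis using card_ext le_trans by blast
qed

lemma ext_below_le: "ext_below k I \<le> num_mers E k"
proof -
  have "ext_below k I \<le> card (ext k)" unfolding ext_below_def by (intro card_mono) (auto simp: finite_ext)
  then show ?thesis using card_ext le_trans by blast
qed

lemma ext_rank_grank:
  assumes "\<alpha> \<in> mers E k"
  shows "ext_rank k (grank \<alpha>) = card {\<gamma> \<in> ext k. colex_le \<gamma> (tl \<alpha>)}"
proof -
  have "colex_le \<gamma> (tl \<alpha>)" if "\<beta> \<in> mers E k" "grank \<beta> \<le> grank \<alpha>" "colex_le \<gamma> (tl \<beta>)" for \<gamma> \<beta>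
  proof -
    have "colex_le \<beta> \<alpha>" using grank_mono_iff[OF assms that(1)] that(2) by simp
    then have "colex_le (tl \<beta>) (tl \<alpha>)" using colex_le_tl[of \<beta> \<alpha>] assms that(1) by (simp add: mers_def)
    then show ?thesis using that colex_le_trans by blast
  qed
  then show ?thesis unfolding ext_rank_def using assms by (intro arg_cong[where f = card]) blast
qed

text \<open>Ensures that the subtraction made by the program does not wrap around, even in cases
  where the difference is not the rank of the suffix.\<close>

lemma ext_below_le_rank:
  assumes "\<alpha> \<in> mers E k" "V \<noteq> {}"
  shows "ext_below k (ends (tl \<alpha>)) \<le> ext_rank k (grank \<alpha>)"
proof -
  have t: "tl \<alpha> \<in> mers E (k - 1)" using assms mers_tl by blast
  have "lft (ends (tl \<alpha>)) \<in> ends (tl \<alpha>)" using lft_in[OF ends_sub ends_nonempty[OF t assms(2)]] .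
  then have "reaches E (tl \<alpha>) (lft (ends (tl \<alpha>)))" by (simp add: ends_def)
  then show ?thesis unfolding ext_rank_grank[OF assms(1)] ext_below_def
    by (intro card_mono) (use t finite_ext in \<open>auto simp: below_def colex_le_def\<close>)
qed

text \<open>The left end has an outgoing edge labeled \<open>c\<close>, so every string reaching it
  can be extended by \<open>c\<close> and belongs to \<open>ext k\<close>. Hence counting extendable
  strings gives the true rank there.\<close>

lemma lrank_tl:
  assumes "\<alpha> \<in> mers E k" "k \<ge> 1" "c \<in> outs (ends (tl \<alpha>))" "from_left (ends (tl \<alpha>)) c"
  shows "lrank (tl \<alpha>) = ext_rank k (grank \<alpha>) - ext_below k (ends (tl \<alpha>))"
proof -
  let ?\<gamma> = "tl \<alpha>" let ?u = "lft (ends ?\<gamma>)"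
  have t: "?\<gamma> \<in> mers E (k - 1)" using assms mers_tl by blast
  obtain x where x: "(?u, x, c) \<in> E" "?u \<in> ends ?\<gamma>"
    using source[OF ends_sub assms(3)] assms(4) by (metis from_left_def)
  have r: "reaches E ?\<gamma> ?u" using x(2) by (simp add: ends_def)
  have X: "\<beta> \<in> ext k" if "\<beta> \<in> mers E (k - 1)" "reaches E \<beta> ?u" for \<beta>
    using that x(1) assms(2) mers_snoc[of \<beta> c E "k - 1"] unfolding ext_def by auto
  have sub: "\<beta> \<in> ext k \<Longrightarrow> \<beta> \<in> mers E (k - 1)" for \<beta> by (simp add: ext_def)
  have "{\<gamma> \<in> ext k. colex_le \<gamma> ?\<gamma>} = {\<beta> \<in> mers E (k - 1). \<beta> \<in> ext k \<and> colex_le \<beta> ?\<gamma>}" using sub by auto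
  then have "ext_rank k (grank \<alpha>) = card {\<beta> \<in> mers E (k - 1). \<beta> \<in> ext k \<and> reaches E \<beta> ?u \<and> colex_le \<beta> ?\<gamma>}
     + card {\<beta> \<in> below (k - 1) ?u. \<beta> \<in> ext k}"
    using card_split[OF t r, of "\<lambda>\<beta>. \<beta> \<in> ext k"] ext_rank_grank[OF assms(1)] by simp
  also have "{\<beta> \<in> mers E (k - 1). \<beta> \<in> ext k \<and> reaches E \<beta> ?u \<and> colex_le \<beta> ?\<gamma>} =
      {\<beta> \<in> mers E (length ?\<gamma>). reaches E \<beta> ?u \<and> colex_le \<beta> ?\<gamma>}" using X t by (auto simp: mers_def)
  also have "{\<beta> \<in> below (k - 1) ?u. \<beta> \<in> ext k} = ext k \<inter> below (k - 1) ?u" by auto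
  finally show ?thesis by (simp add: lrank_def rank_def ext_below_def)
qed

section \<open>Intervals of strings\<close>

definition lowest :: "nat \<Rightarrow> 'v \<Rightarrow> 'a list" where
  "lowest l u = (SOME \<gamma>. \<gamma> \<in> mers E l \<and> reaches E \<gamma> u \<and> (\<forall>\<beta>\<in>mers E l. reaches E \<beta> u \<longrightarrow> colex_le \<gamma> \<beta>))"

definition highest :: "nat \<Rightarrow> 'v \<Rightarrow> 'a list" where
  "highest l u = (SOME \<gamma>. \<gamma> \<in> mers E l \<and> reaches E \<gamma> u \<and> (\<forall>\<beta>\<in>mers E l. reaches E \<beta> u \<longrightarrow> colex_le \<beta> \<gamma>))"

lemma lowest_highest:
  assumes "\<alpha> \<in> mers E l" "reaches E \<alpha> u"
  shows "lowest l u \<in> mers E l \<and> reaches E (lowest l u) u \<and> colex_le (lowest l u) \<alpha>"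
    and "highest l u \<in> mers E l \<and> reaches E (highest l u) u \<and> colex_le \<alpha> (highest l u)"
proof -
  let ?S = "{\<gamma> \<in> mers E l. reaches E \<gamma> u}"
  have S: "finite ?S" "?S \<noteq> {}" using finite_mers assms by auto
  have "\<exists>\<gamma>. \<gamma> \<in> mers E l \<and> reaches E \<gamma> u \<and> (\<forall>\<beta>\<in>mers E l. reaches E \<beta> u \<longrightarrow> colex_le \<gamma> \<beta>)"
    using finite_colex_extreme(1)[OF S] by blast
  from someI_ex[OF this] show "lowest l u \<in> mers E l \<and> reaches E (lowest l u) u \<and> colex_le (lowest l u) \<alpha>"
    unfolding lowest_def using assms by blast
  have "\<exists>\<gamma>. \<gamma> \<in> mers E l \<and> reaches E \<gamma> u \<and> (\<forall>\<beta>\<in>mers E l. reaches E \<beta> u \<longrightarrow> colex_le \<beta> \<gamma>)"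
    using finite_colex_extreme(2)[OF S] by blast
  from someI_ex[OF this] show "highest l u \<in> mers E l \<and> reaches E (highest l u) u \<and> colex_le \<alpha> (highest l u)"
    unfolding highest_def using assms by blast
qed

text \<open>Comparison with the lowest and with the highest string at \<open>u\<close> squeezes
  every vertex reached by the string to \<open>u\<close>.\<close>

lemma ends_middle:
  assumes "\<alpha> \<in> mers E l" "reaches E \<alpha> u" "u \<in> V" "\<alpha> \<noteq> lowest l u" "\<alpha> \<noteq> highest l u"
  shows "ends \<alpha> = {u}"
proof -
  have lo: "lowest l u \<in> mers E l" "reaches E (lowest l u) u" "colex_less (lowest l u) \<alpha>"
    and hi: "highest l u \<in> mers E l" "reaches E (highest l u) u" "colex_less \<alpha> (highest l u)"
    using lowest_highest[OF assms(1,2)] assms(4,5) by (auto simp: colex_le_def)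
  have "length (lowest l u) = length \<alpha>" "length \<alpha> = length (highest l u)"
    using lo hi assms by (auto simp: mers_def)
  then have "y = u" if "reaches E \<alpha> y" for y
    using reaches_mono[OF _ lo(3) lo(2) that] reaches_mono[OF _ hi(3) that hi(2)] le_antisym' by blast
  then show ?thesis using assms(2,3) unfolding ends_def by blast
qed

definition low_count :: "nat \<Rightarrow> 'v \<Rightarrow> nat" where
  "low_count k u = card {\<beta> \<in> mers E k. reaches E \<beta> u \<and> tl \<beta> = lowest (k - 1) u}"

definition mid_count :: "nat \<Rightarrow> 'v \<Rightarrow> nat" where
  "mid_count k u = card {\<beta> \<in> mers E k. reaches E \<beta> u \<and> tl \<beta> \<noteq> highest (k - 1) u}"

text \<open>Since \<open>tl\<close> is monotone, the \<open>k\<close>-mers at \<open>u\<close> with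
  the lowest tail come first and those with the highest tail come last, so two stored counts
  separate these groups. Every other tail has the interval \<open>{u}\<close>.\<close>

lemma tl_by_rank:
  assumes "\<alpha> \<in> mers E k" "reaches E \<alpha> u"
  shows "rank \<alpha> u \<le> low_count k u \<longleftrightarrow> tl \<alpha> = lowest (k - 1) u"
    and "mid_count k u < rank \<alpha> u \<longleftrightarrow> tl \<alpha> = highest (k - 1) u"
proof -
  let ?A = "{\<beta> \<in> mers E k. reaches E \<beta> u \<and> colex_le \<beta> \<alpha>}"
  let ?L = "{\<beta> \<in> mers E k. reaches E \<beta> u \<and> tl \<beta> = lowest (k - 1) u}"
  let ?M = "{\<beta> \<in> mers E k. reaches E \<beta> u \<and> tl \<beta> \<noteq> highest (k - 1) u}"
  have len: "length \<beta> = length \<alpha>" if "\<beta> \<in> mers E k" for \<beta> using that assms by (auto simp: mers_def)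
  have r: "rank \<alpha> u = card ?A" using assms by (simp add: rank_def mers_def)
  have fin: "finite ?A" "finite ?L" "finite ?M" using finite_mers by auto
  have lo: "colex_le (lowest (k - 1) u) (tl \<beta>)" and hi: "colex_le (tl \<beta>) (highest (k - 1) u)"
    if "\<beta> \<in> mers E k" "reaches E \<beta> u" for \<beta>
    using lowest_highest[OF mers_tl[OF that(1)] reaches_tl[OF that(2)]] by auto
  have below: "colex_less \<beta> \<alpha>" if "\<beta> \<in> mers E k" "colex_less (tl \<beta>) (tl \<alpha>)" for \<beta>
    using colex_tl[OF len[OF that(1)] that(2)] .
  have tl_le: "colex_le (tl \<beta>) (tl \<alpha>)" if "\<beta> \<in> ?A" for \<beta>
    using colex_le_tl[of \<beta> \<alpha>] len that by blast
  show "rank \<alpha> u \<le> low_count k u \<longleftrightarrow> tl \<alpha> = lowest (k - 1) u"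
  proof
    assume eq: "tl \<alpha> = lowest (k - 1) u"
    have "?A \<subseteq> ?L"
    proof
      fix \<beta> assume \<beta>: "\<beta> \<in> ?A"
      then have "colex_le (tl \<beta>) (lowest (k - 1) u)" "colex_le (lowest (k - 1) u) (tl \<beta>)"
        using tl_le[OF \<beta>] eq lo by auto
      then have "tl \<beta> = lowest (k - 1) u" using colex_less_le_trans colex_irrefl unfolding colex_le_def by metis
      then show "\<beta> \<in> ?L" using \<beta> by simp
    qed
    then show "rank \<alpha> u \<le> low_count k u" unfolding r low_count_def by (intro card_mono fin)
  next
    assume le: "rank \<alpha> u \<le> low_count k u"
    show "tl \<alpha> = lowest (k - 1) u"
    proof (rule ccontr)
      assume ne: "tl \<alpha> \<noteq> lowest (k - 1) u"
      then have "colex_less (lowest (k - 1) u) (tl \<alpha>)" using lo[OF assms] by (auto simp: colex_le_def)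
      then have "?L \<subseteq> ?A" using below by (auto simp: colex_le_def)
      moreover have "\<alpha> \<in> ?A" "\<alpha> \<notin> ?L" using assms ne by auto
      ultimately have "?L \<subset> ?A" by blast
      then have "card ?L < card ?A" using fin by (intro psubset_card_mono)
      then show False using le by (simp add: r low_count_def)
    qed
  qed
  show "mid_count k u < rank \<alpha> u \<longleftrightarrow> tl \<alpha> = highest (k - 1) u"
  proof
    assume eq: "tl \<alpha> = highest (k - 1) u"
    have "?M \<subseteq> ?A"
    proof
      fix \<beta> assume \<beta>: "\<beta> \<in> ?M"
      then have "colex_less (tl \<beta>) (tl \<alpha>)" using hi[of \<beta>] eq by (auto simp: colex_le_def)
      then show "\<beta> \<in> ?A" using \<beta> below by (auto simp: colex_le_def)
    qed
    moreover have "\<alpha> \<in> ?A" "\<alpha> \<notin> ?M" using assms eq by auto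
    ultimately have "?M \<subset> ?A" by blast
    then show "mid_count k u < rank \<alpha> u" unfolding r mid_count_def using fin by (intro psubset_card_mono)
  next
    assume less: "mid_count k u < rank \<alpha> u"
    show "tl \<alpha> = highest (k - 1) u"
    proof (rule ccontr)
      assume ne: "tl \<alpha> \<noteq> highest (k - 1) u"
      then have \<alpha>: "colex_less (tl \<alpha>) (highest (k - 1) u)" using hi[OF assms] by (auto simp: colex_le_def)
      have "?A \<subseteq> ?M"
      proof
        fix \<beta> assume \<beta>: "\<beta> \<in> ?A"
        have "tl \<beta> \<noteq> highest (k - 1) u" using tl_le[OF \<beta>] \<alpha> colex_less_le_trans colex_irrefl by metis
        then show "\<beta> \<in> ?M" using \<beta> by simp
      qed
      then have "card ?A \<le> card ?M" by (intro card_mono fin)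
      then show False using less by (simp add: r mid_count_def)
    qed
  qed
qed

section \<open>Counting intervals and their outgoing labels\<close>

definition intervals :: "nat \<Rightarrow> 'v set set" where
  "intervals l = ends ` mers E l"

lemma finite_intervals: "finite (intervals l)"
  by (simp add: intervals_def finite_mers)

lemma card_intervals_le: "card (intervals l) \<le> num_mers E l"
  unfolding intervals_def num_mers_def by (rule card_image_le[OF finite_mers])

text \<open>All strings reaching \<open>z\<close>, except the lowest and the highest, share the
  interval \<open>{z}\<close>. This is the 3 in the bounds by vertices and by edges.\<close>

lemma few_intervals_at: "card {I \<in> intervals l. z \<in> I} \<le> 3"
proof -
  have "{I \<in> intervals l. z \<in> I} \<subseteq> {ends (lowest l z), ends (highest l z), {z}}"
    using ends_middle by (force simp: intervals_def ends_def)
  then have "card {I \<in> intervals l. z \<in> I} \<le> card {ends (lowest l z), ends (highest l z), {z}}"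
    by (intro card_mono) auto
  also have "\<dots> \<le> 3" by (simp add: card_insert_if)
  finally show ?thesis .
qed

text \<open>Double counting of pairs of an interval and one of its vertices: an interval occurs at
  least once, a vertex at most three times.\<close>

lemma card_intervals_le_V:
  assumes "V \<noteq> {}"
  shows "card (intervals l) \<le> 3 * card V"
proof -
  have ne: "I \<subseteq> V" "I \<noteq> {}" if "I \<in> intervals l" for I
    using that ends_sub ends_nonempty[OF _ assms] by (auto simp: intervals_def)
  have "card (intervals l) = (\<Sum>I\<in>intervals l. 1)" by simp
  also have "\<dots> \<le> (\<Sum>I\<in>intervals l. card {z \<in> V. z \<in> I})"
  proof (rule sum_mono)
    fix I assume I: "I \<in> intervals l"
    then have "{z \<in> V. z \<in> I} = I" using ne by blast
    then show "1 \<le> card {z \<in> V. z \<in> I}" using ne[OF I] finite_V finite_subset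
      by (metis One_nat_def Suc_leI card_gt_0_iff)
  qed
  also have "\<dots> = (\<Sum>z\<in>V. card {I \<in> intervals l. z \<in> I})"
    using sum.swap_restrict[OF finite_intervals finite_V, where g = "\<lambda>_ _. 1 :: nat" and R = "\<lambda>I z. z \<in> I"] by simp
  also have "\<dots> \<le> (\<Sum>z\<in>V. 3)" by (intro sum_mono few_intervals_at)
  finally show ?thesis by simp
qed

lemma finite_outs: "finite (outs I)" and card_outs_le: "card (outs I) \<le> card {e \<in> E. fst e \<in> I}"
proof -
  have o: "outs I = (\<lambda>e. snd (snd e)) ` {e \<in> E. fst e \<in> I}" by (force simp: outs_def)
  have f: "finite {e \<in> E. fst e \<in> I}" using finite_E by simp
  show "finite (outs I)" "card (outs I) \<le> card {e \<in> E. fst e \<in> I}"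
    unfolding o using f by (auto intro: card_image_le)
qed

text \<open>The same double counting, with an edge charged to the intervals that contain its
  source.\<close>

lemma sum_outs_le: "(\<Sum>I\<in>intervals l. card (outs I)) \<le> 3 * card E"
proof -
  have "(\<Sum>I\<in>intervals l. card (outs I)) \<le> (\<Sum>I\<in>intervals l. card {e \<in> E. fst e \<in> I})"
    by (intro sum_mono card_outs_le)
  also have "\<dots> = (\<Sum>e\<in>E. card {I \<in> intervals l. fst e \<in> I})"
    using sum.swap_restrict[OF finite_intervals finite_E, where g = "\<lambda>_ _. 1 :: nat" and R = "\<lambda>I e. fst e \<in> I"] by simp
  also have "\<dots> \<le> (\<Sum>e\<in>E. 3)" by (intro sum_mono few_intervals_at)
  finally show ?thesis by simp
qed

text \<open>The alphabet may contain letters that label no edge. Ranks among the letters that do are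
  bounded by the number of 1-mers, so they fit the entry width \<open>bl M\<close>, and by the
  number of edges, which is the source of the \<open>log m\<close> bits per letter of the
  alphabet.\<close>

definition used :: "'a set" where
  "used = {c. \<exists>u v. (u, v, c) \<in> E}"

lemma finite_used: "finite used" and used_sub: "used \<subseteq> \<Sigma>" and card_used_E: "card used \<le> card E"
  and card_used: "card used \<le> num_mers E 1" and outs_used: "outs I \<subseteq> used"
proof -
  have o: "used = (\<lambda>e. snd (snd e)) ` E" by (force simp: used_def)
  show "finite used" "card used \<le> card E" unfolding o using finite_E by (auto intro: card_image_le)
  show "used \<subseteq> \<Sigma>" using E_dest by (auto simp: used_def)
  show "outs I \<subseteq> used" by (auto simp: outs_def used_def)
  have "(\<lambda>c. [c]) ` used \<subseteq> mers E 1" using mers_snoc[of "[]" _ E 0] by (auto simp: used_def mers_0)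
  then have "card ((\<lambda>c. [c]) ` used) \<le> num_mers E 1" unfolding num_mers_def
    by (intro card_mono) (use finite_mers in auto)
  then show "card used \<le> num_mers E 1" by (simp add: card_image inj_on_def)
qed

lemma out_labels_eq:
  assumes "\<alpha> \<in> mers E k" "k \<ge> 1"
  shows "out_labels E k \<alpha> = outs (ends (tl \<alpha>))"
proof -
  have "\<alpha> \<noteq> []" using assms by (auto simp: mers_def)
  then obtain b \<gamma> where \<alpha>: "\<alpha> = b # \<gamma>" by (cases \<alpha>) auto
  have "out_labels E k \<alpha> = {c. \<gamma> @ [c] \<in> mers E k}"
    using assms by (auto simp: out_labels_def dbg_edges_def \<alpha>)
  also have "\<dots> = outs (ends \<gamma>)"
    using snoc_in_mers[of \<gamma> _ "k - 1"] mers_tl[OF assms(1)] assms(2) by (auto simp: \<alpha>)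
  finally show ?thesis by (simp add: \<alpha>)
qed

end

section \<open>Tables\<close>

definition tab :: "('x \<Rightarrow> nat) \<Rightarrow> 'x set \<Rightarrow> nat \<Rightarrow> ('x \<Rightarrow> nat) \<Rightarrow> nat list" where
  "tab code S N f = map (\<lambda>t. if t \<in> code ` S then f (inv_into S code t) else 0) [0..<N]"

lemma length_tab [simp]: "length (tab code S N f) = N"
  by (simp add: tab_def)

lemma nth_tab: "inj_on code S \<Longrightarrow> x \<in> S \<Longrightarrow> code x < N \<Longrightarrow> tab code S N f ! code x = f x"
  by (simp add: tab_def)

lemma set_tab:
  assumes "\<And>x. x \<in> S \<Longrightarrow> f x < b" "0 < b" "y \<in> set (tab code S N f)"
  shows "y < b"
  using assms by (auto simp: tab_def inv_into_into)

lemma nth_concat_map: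
  assumes "i < n" "t < length (g i)"
  shows "(\<Sum>j<i. length (g j)) + t < length (concat (map g [0..<n]))"
    and "concat (map g [0..<n]) ! ((\<Sum>j<i. length (g j)) + t) = g i ! t"
proof -
  have len: "length (concat (map g [0..<j])) = (\<Sum>j<j. length (g j))" for j
    by (induction j) auto
  have "[0..<n] = [0..<i] @ i # [Suc i..<n]" using assms(1)
    by (metis le_add1 less_imp_add_positive upt_add_eq_append upt_conv_Cons le0 add_0 less_imp_le_nat le_add_diff_inverse)
  then have split: "concat (map g [0..<n]) = concat (map g [0..<i]) @ g i @ concat (map g [Suc i..<n])" by simp
  show "(\<Sum>j<i. length (g j)) + t < length (concat (map g [0..<n]))"
    unfolding split using assms(2) len[of i] by simp
  show "concat (map g [0..<n]) ! ((\<Sum>j<i. length (g j)) + t) = g i ! t"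
    unfolding split using assms(2) len[of i] by (simp add: nth_append)
qed

lemma inj_on_card_less:
  fixes S :: "'a::linorder set"
  assumes "finite S"
  shows "inj_on (\<lambda>c. card {b \<in> S. b < c}) S"
proof (rule linorder_inj_onI)
  fix x y assume "x < y" "x \<in> S" "y \<in> S"
  then have "{b \<in> S. b < x} \<subset> {b \<in> S. b < y}" by force
  then show "card {b \<in> S. b < x} \<noteq> card {b \<in> S. b < y}"
    using psubset_card_mono[of "{b \<in> S. b < y}" "{b \<in> S. b < x}"] assms by simp
qed auto

section \<open>The arrays of the data structure\<close>

text \<open>The existence of a \<open>k\<close>-mer gives \<open>n \<ge> 1\<close>, so additive
  constants are absorbed by the space bound. The remaining case is settled by an empty data
  structure in the final theorem.\<close>

locale dbg = wheeler V \<Sigma> E le for V :: "'v set" and \<Sigma> :: "'a::linorder set" and E le +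
  fixes k :: nat
  assumes k: "k \<ge> 1" and ex_mer: "mers E k \<noteq> {}"
begin

abbreviation "n \<equiv> num_mers E k"
abbreviation "M \<equiv> max_mers E k"

lemma num_mers_le: "1 \<le> l \<Longrightarrow> l \<le> k \<Longrightarrow> num_mers E l \<le> M"
  unfolding max_mers_def by (rule Max_ge) auto

lemma n_pos: "1 \<le> n" and n_le_M: "n \<le> M" and M_pos: "1 \<le> M"
proof -
  show "1 \<le> n" using ex_mer finite_mers by (simp add: num_mers_def Suc_le_eq card_gt_0_iff)
  then show "1 \<le> M" using num_mers_le[of k] k by simp
  show "n \<le> M" using num_mers_le[of k] k by simp
qed

lemma num_mers_le': "l \<le> k \<Longrightarrow> num_mers E l \<le> M"
  using num_mers_le[of l] M_pos by (cases l) (auto simp: num_mers_def mers_0)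

lemma E_nonempty: "E \<noteq> {}" and V_nonempty: "V \<noteq> {}"
proof -
  obtain \<alpha> where "\<alpha> \<in> mers E k" using ex_mer by blast
  moreover from this have "\<alpha> \<noteq> []" using k by (auto simp: mers_def)
  ultimately show "E \<noteq> {}" using mers_set[of \<alpha> k "hd \<alpha>"] by auto
  then show "V \<noteq> {}" using E_sub by auto
qed

definition urank :: "'a \<Rightarrow> nat" where
  "urank c = card {b \<in> used. b < c}"

lemma urank_less: "c \<in> used \<Longrightarrow> urank c < card used"
  unfolding urank_def by (rule psubset_card_mono[OF finite_used]) auto

lemma inj_urank: "inj_on urank used"
  unfolding urank_def using inj_on_card_less[OF finite_used] .

lemma urank_less_iff: "c \<in> used \<Longrightarrow> d \<in> used \<Longrightarrow> urank c < urank d \<longleftrightarrow> c < d"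
proof -
  have *: "urank c \<le> urank d" if "c \<le> d" for c d
    unfolding urank_def by (rule card_mono) (use that finite_used in auto)
  assume "c \<in> used" "d \<in> used"
  then show "urank c < urank d \<longleftrightarrow> c < d"
    using *[of c d] *[of d c] inj_urank by (metis inj_onD leD le_neq_implies_less linorder_less_linear order_less_imp_le)
qed

lemma letter_code_le: "letter_code \<Sigma> c \<le> card \<Sigma>"
  unfolding letter_code_def by (rule card_mono) (auto simp: finite_\<Sigma>)

lemma inj_letter_code: "inj_on (letter_code \<Sigma>) used"
proof (rule linorder_inj_onI)
  fix x y assume "x < y" "x \<in> used" "y \<in> used"
  then have "{b \<in> \<Sigma>. b \<le> x} \<subset> {b \<in> \<Sigma>. b \<le> y}" using used_sub by force
  then show "letter_code \<Sigma> x \<noteq> letter_code \<Sigma> y"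
    using psubset_card_mono[of "{b \<in> \<Sigma>. b \<le> y}" "{b \<in> \<Sigma>. b \<le> x}"] finite_\<Sigma> by (simp add: letter_code_def)
qed auto

lemma vertex_code_le: "vertex_code le u \<le> card V"
  unfolding vertex_code_def by (rule card_mono) (use finite_V le_V in auto)

lemma inj_vertex_code: "inj_on (vertex_code le) V"
proof (rule inj_onI)
  have less: "vertex_code le x < vertex_code le y" if "(x, y) \<in> le" "x \<noteq> y" for x y
  proof -
    have "{z. (z, x) \<in> le} \<subset> {z. (z, y) \<in> le}"
      using that le_trans'[OF _ that(1)] le_refl[of y] le_V[OF that(1)] le_antisym'[OF that(1)] by blast
    moreover have "finite {z. (z, y) \<in> le}" by (rule finite_subset[OF _ finite_V]) (use le_V in auto)
    ultimately show ?thesis by (simp add: vertex_code_def psubset_card_mono)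
  qed
  fix x y assume "x \<in> V" "y \<in> V" "vertex_code le x = vertex_code le y"
  then show "x = y" using less[of x y] less[of y x] le_total by (metis less_irrefl)
qed

text \<open>Any numbering of the intervals of one length serves. The value 0 on other sets keeps the
  bound \<open>iid_le_M\<close> unconditional, since a vertex table also records
  \<open>iid (k - 1) {u}\<close> where \<open>{u}\<close> need not be an interval.\<close>

definition iid :: "nat \<Rightarrow> 'v set \<Rightarrow> nat" where
  "iid l I = (if I \<in> intervals l
     then (SOME f. bij_betw f (intervals l) {0..<card (intervals l)}) I else 0)"

lemma iid_bij: "bij_betw (iid l) (intervals l) {0..<card (intervals l)}"
proof -
  have "\<exists>f. bij_betw f (intervals l) {0..<card (intervals l)}"
    using ex_bij_betw_finite_nat[OF finite_intervals] .
  from someI_ex[OF this] show ?thesis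
    by (rule bij_betw_cong[THEN iffD1, rotated]) (simp add: iid_def)
qed

definition ival :: "nat \<Rightarrow> nat \<Rightarrow> 'v set" where
  "ival l i = inv_into (intervals l) (iid l) i"

lemma iid_less: "I \<in> intervals l \<Longrightarrow> iid l I < card (intervals l)"
  using bij_betw_imp_surj_on[OF iid_bij[of l]] imageI[of I "intervals l" "iid l"] by simp

lemma ival_iid: "I \<in> intervals l \<Longrightarrow> ival l (iid l I) = I"
  using iid_bij by (simp add: ival_def bij_betw_def)

text \<open>Fixed strides: the records for length \<open>l\<close> start at \<open>l * dmax\<close>
  and its padded entries at \<open>l * emax\<close>, so no pointers per length are stored.\<close>

definition dmax :: nat where "dmax = min M (3 * card V)"
definition emax :: nat where "emax = 3 * card E"

lemma card_intervals_dmax: "l \<le> k \<Longrightarrow> card (intervals l) \<le> dmax"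
  using card_intervals_le[of l] num_mers_le'[of l] card_intervals_le_V[OF V_nonempty, of l] by (simp add: dmax_def)

lemma iid_less': "I \<in> intervals l \<Longrightarrow> l \<le> k \<Longrightarrow> iid l I < dmax"
  using iid_less card_intervals_dmax less_le_trans by blast

lemma iid_le_M: "l \<le> k \<Longrightarrow> iid l I \<le> M"
  using iid_less'[of I l] by (cases "I \<in> intervals l") (auto simp: iid_def dmax_def)

text \<open>The search for a string begins with the constant 0 as identifier of the interval of the
  empty string.\<close>

lemma iid_0: "iid 0 (ends []) = 0"
proof -
  have "ends [] \<in> intervals 0" "card (intervals 0) = 1" by (auto simp: intervals_def mers_0)
  then show ?thesis using iid_less[of "ends []" 0] by simp
qed

definition rcode :: "nat \<times> 'v set \<Rightarrow> nat" where
  "rcode p = fst p * dmax + iid (fst p) (snd p)"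

abbreviation levels :: "(nat \<times> 'v set) set" where
  "levels \<equiv> {(l, I). l < k \<and> I \<in> intervals l}"

lemma rcode_less: "(l, I) \<in> levels \<Longrightarrow> rcode (l, I) < k * dmax"
proof -
  assume "(l, I) \<in> levels"
  then have "iid l I < dmax" "Suc l \<le> k" using iid_less'[of I l] by auto
  then have "rcode (l, I) < Suc l * dmax" by (simp add: rcode_def)
  also have "\<dots> \<le> k * dmax" using \<open>Suc l \<le> k\<close> by (intro mult_right_mono) auto
  finally show ?thesis .
qed

lemma inj_rcode: "inj_on rcode levels"
proof (rule inj_onI)
  fix p q assume pq: "p \<in> levels" "q \<in> levels" "rcode p = rcode q"
  obtain l I l' I' where [simp]: "p = (l, I)" "q = (l', I')" by (cases p; cases q)
  have i: "iid l I < dmax" "iid l' I' < dmax" using pq iid_less' by auto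
  then have "rcode p div dmax = l" "rcode q div dmax = l'" by (simp_all add: rcode_def)
  then have "l = l'" using pq by simp
  moreover have "iid l I = iid l' I'" using pq \<open>l = l'\<close> by (simp add: rcode_def)
  ultimately show "p = q" using pq iid_bij[of l] by (auto simp: bij_betw_def inj_on_def)
qed

text \<open>The sorted order allows binary search for a letter, from which the logarithm of the
  alphabet size in the query times arises.\<close>

definition labels :: "'v set \<Rightarrow> 'a list" where
  "labels I = sorted_list_of_set (outs I)"

lemma labels: "distinct (labels I)" "set (labels I) = outs I" "length (labels I) = card (outs I)" "sorted (labels I)"
  by (simp_all add: labels_def finite_outs)

definition estart :: "nat \<Rightarrow> 'v set \<Rightarrow> nat" where
  "estart l I = (\<Sum>i<iid l I. length (labels (ival l i)))"

lemma sum_labels: "(\<Sum>i<card (intervals l). length (labels (ival l i))) \<le> emax"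
proof -
  have "(\<Sum>I\<in>intervals l. card (outs I)) = (\<Sum>i\<in>{0..<card (intervals l)}. length (labels (ival l i)))"
    using sum.reindex_bij_betw[OF iid_bij[of l], of "\<lambda>i. length (labels (ival l i))"]
    by (simp add: ival_iid labels(3) cong: sum.cong)
  then show ?thesis using sum_outs_le[of l] by (simp add: emax_def lessThan_atLeast0)
qed

lemma estart_le:
  assumes "I \<in> intervals l"
  shows "estart l I + length (labels I) \<le> emax"
proof -
  have "estart l I + length (labels I) = (\<Sum>i<Suc (iid l I). length (labels (ival l i)))"
    by (simp add: estart_def ival_iid[OF assms])
  also have "\<dots> \<le> (\<Sum>i<card (intervals l). length (labels (ival l i)))"
    using iid_less[OF assms] by (intro sum_mono2) auto
  finally show ?thesis using sum_labels le_trans by blast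
qed

definition level_entries :: "(nat \<Rightarrow> 'v set \<Rightarrow> 'a \<Rightarrow> nat) \<Rightarrow> nat \<Rightarrow> nat list" where
  "level_entries f l = concat (map (\<lambda>i. map (f l (ival l i)) (labels (ival l i))) [0..<card (intervals l)])"

definition entries :: "(nat \<Rightarrow> 'v set \<Rightarrow> 'a \<Rightarrow> nat) \<Rightarrow> nat list" where
  "entries f = concat (map (\<lambda>l. level_entries f l @ replicate (emax - length (level_entries f l)) 0) [0..<k])"

lemma length_level_entries: "length (level_entries f l) \<le> emax"
proof -
  have "length (level_entries f l) = (\<Sum>i<card (intervals l). length (labels (ival l i)))"
    unfolding level_entries_def length_concat by (simp add: sum_list_sum_nth atLeast0LessThan)
  then show ?thesis using sum_labels by simp
qed

lemma length_entries: "length (entries f) = k * emax"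
proof -
  have "length (entries f) = (\<Sum>l<k. emax)"
    unfolding entries_def length_concat by (simp add: sum_list_sum_nth atLeast0LessThan length_level_entries)
  then show ?thesis by simp
qed

lemma nth_entries:
  assumes "l < k" "I \<in> intervals l" "t < length (labels I)"
  shows "l * emax + estart l I + t < k * emax"
    and "entries f ! (l * emax + estart l I + t) = f l I (labels I ! t)"
proof -
  let ?g = "\<lambda>i. map (f l (ival l i)) (labels (ival l i))"
  let ?h = "\<lambda>l. level_entries f l @ replicate (emax - length (level_entries f l)) 0"
  note c = nth_concat_map[of "iid l I" "card (intervals l)" t ?g, folded level_entries_def]
  have i: "iid l I < card (intervals l)" "t < length (?g (iid l I))"
    using assms iid_less ival_iid by simp_all
  have s: "(\<Sum>j<iid l I. length (?g j)) = estart l I" by (simp add: estart_def)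
  have 1: "estart l I + t < length (level_entries f l)" "level_entries f l ! (estart l I + t) = f l I (labels I ! t)"
    using c[OF i] unfolding s by (simp_all add: ival_iid assms)
  have len: "length (?h j) = emax" for j using length_level_entries[of f j] by simp
  have t: "estart l I + t < length (?h l)" using 1 by simp
  note d = nth_concat_map[OF assms(1), of "estart l I + t" ?h, OF t, folded entries_def]
  have s2: "(\<Sum>j<l. length (?h j)) = l * emax" by (simp only: len) simp
  show "l * emax + estart l I + t < k * emax"
    using d(1) unfolding s2 length_entries by (simp add: add.assoc)
  show "entries f ! (l * emax + estart l I + t) = f l I (labels I ! t)"
    using d(2) 1 unfolding s2 by (simp add: add.assoc nth_append)
qed

lemma set_entries:
  assumes "\<And>l I c. l < k \<Longrightarrow> I \<in> intervals l \<Longrightarrow> c \<in> outs I \<Longrightarrow> f l I c < 2 ^ b"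
  shows "\<forall>y\<in>set (entries f). y < 2 ^ b"
proof -
  have "ival l i \<in> intervals l" if "i < card (intervals l)" for l i
    using iid_bij[of l] that unfolding ival_def by (intro inv_into_into) (auto simp: bij_betw_def)
  then show ?thesis using assms by (force simp: entries_def level_entries_def labels(2))
qed

text \<open>Minimality gives \<open>2 ^ (2 ^ (s - 1)) \<le> n\<close> unless \<open>s = 1\<close>,
  and this pays for the table of all windows.\<close>

definition sparam :: nat where "sparam = (LEAST s. s \<ge> 1 \<and> n < 2 ^ (2 ^ s))"

lemma sparam: "sparam \<ge> 1" "n < 2 ^ (2 ^ sparam)" "sparam = 1 \<or> 2 ^ (2 ^ (sparam - 1)) \<le> n"
proof -
  have "n < 2 ^ n" by (rule less_exp)
  also have "\<dots> \<le> 2 ^ (2 ^ n)" by (intro power_increasing less_imp_le[OF less_exp]) auto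
  finally have ex: "\<exists>s. s \<ge> 1 \<and> n < 2 ^ (2 ^ s)" using n_pos by blast
  show 1: "sparam \<ge> 1" "n < 2 ^ (2 ^ sparam)" using LeastI_ex[OF ex] by (auto simp: sparam_def)
  show "sparam = 1 \<or> 2 ^ (2 ^ (sparam - 1)) \<le> n"
  proof (rule ccontr)
    assume "\<not> ?thesis"
    then have "sparam - 1 \<ge> 1 \<and> n < 2 ^ (2 ^ (sparam - 1))" using 1 by auto
    then have "sparam \<le> sparam - 1" unfolding sparam_def by (rule Least_le)
    then show False using 1 by simp
  qed
qed

sublocale mono_map "ext_rank k" n sparam
  by unfold_locales (use ext_rank_mono ext_rank_le sparam in auto)

definition params :: "nat list" where
  "params = [k, dmax, emax, K, L, sparam, 3 * sparam, R]"

abbreviation vtab :: "('v \<Rightarrow> nat) \<Rightarrow> nat list" where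
  "vtab f \<equiv> tab (vertex_code le) V (Suc (card V)) f"

text \<open>Wide enough for positions of entries, vertex codes and counts of strings alike. Tables
  of this width have at most \<open>dmax\<close> records for each length.\<close>

abbreviation rwidth :: nat where
  "rwidth \<equiv> bl (3 * card E + card V + M)"

text \<open>Positions in this list are the array numbers occurring in the programs. Vertex and
  letter codes count from 1, hence the lengths \<open>Suc (card V)\<close> and
  \<open>Suc (card \<Sigma>)\<close> of tables indexed by them.\<close>

definition arrays :: "(nat \<times> nat list) list" where
  "arrays =
    [(bl (sum_list params), params),
     (bl (card E), tab (letter_code \<Sigma>) used (Suc (card \<Sigma>)) urank),
     (bl (card \<Sigma>), tab urank used (card used) (letter_code \<Sigma>)),
     (bl M, vtab (\<lambda>u. card (below k u))),
     (bl M, vtab (low_count k)),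
     (bl M, vtab (mid_count k)),
     (bl M, vtab (\<lambda>u. iid (k - 1) (ends (lowest (k - 1) u)))),
     (bl M, vtab (\<lambda>u. iid (k - 1) (ends (highest (k - 1) u)))),
     (bl M, vtab (\<lambda>u. iid (k - 1) {u})),
     (rwidth, tab rcode levels (k * dmax) (\<lambda>(l, I). estart l I)),
     (rwidth, tab rcode levels (k * dmax) (\<lambda>(l, I). length (labels I))),
     (rwidth, tab (iid (k - 1)) (intervals (k - 1)) dmax (ext_below k)),
     (rwidth, tab (iid k) (intervals k) dmax (\<lambda>I. vertex_code le (lft I))),
     (rwidth, tab (iid k) (intervals k) dmax (\<lambda>I. vertex_code le (rgt I))),
     (bl M, entries (\<lambda>l I c. urank c)),
     (bl M, entries (\<lambda>l I c. iid (Suc l) (succs I c))),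
     (bl M, entries (\<lambda>l I c. of_bool (from_left I c))),
     (bl M, entries shift),
     (L, vals_A), (1, vals_sp1), (1, map of_bool pool1), (3 * sparam, vals_Rel),
     (1, vals_sp2), (1, map of_bool pool2), (1, map of_bool unary), (3 * sparam, vals_Tab)]"

lemma length_arrays: "length arrays = num_arrays"
  by (simp add: arrays_def num_arrays_def)

lemma less_bl_I: "x \<le> y \<Longrightarrow> x < 2 ^ bl y"
  using less_bl[of y] by linarith

lemma of_bool_bl: "(of_bool b :: nat) < 2 ^ bl M"
  by (rule less_bl_I) (use M_pos in \<open>cases b; simp\<close>)

lemma set_tab_bl:
  assumes "\<And>x. x \<in> S \<Longrightarrow> f x \<le> y"
  shows "\<forall>z\<in>set (tab code S N f). z < 2 ^ bl y"
proof
  fix z assume z: "z \<in> set (tab code S N f)"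
  show "z < 2 ^ bl y" by (rule set_tab[OF _ _ z]) (auto intro: less_bl_I assms)
qed

lemma card_mers_sub: "S \<subseteq> mers E l \<Longrightarrow> l \<le> k \<Longrightarrow> card S \<le> M"
  using card_mono[OF finite_mers, of S l] num_mers_le'[of l] by (simp add: num_mers_def)

lemma arrays_small: "\<forall>a\<in>set arrays. \<forall>x\<in>set (snd a). x < 2 ^ fst a"
proof -
  have s: "\<forall>x\<in>set params. x < 2 ^ bl (sum_list params)"
    using member_le_sum_list less_bl_I by blast
  have "urank c \<le> card E" if "c \<in> used" for c using urank_less[OF that] card_used_E by linarith
  then have 1: "\<forall>x\<in>set (tab (letter_code \<Sigma>) used (Suc (card \<Sigma>)) urank). x < 2 ^ bl (card E)"
    by (rule set_tab_bl)
  have 2: "\<forall>x\<in>set (tab urank used (card used) (letter_code \<Sigma>)). x < 2 ^ bl (card \<Sigma>)"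
    by (rule set_tab_bl[OF letter_code_le])
  have v: "\<forall>x\<in>set (vtab (\<lambda>u. card (below k u))). x < 2 ^ bl M"
    "\<forall>x\<in>set (vtab (low_count k)). x < 2 ^ bl M"
    "\<forall>x\<in>set (vtab (mid_count k)). x < 2 ^ bl M"
    "\<forall>x\<in>set (vtab (\<lambda>u. iid (k - 1) (ends (lowest (k - 1) u)))). x < 2 ^ bl M"
    "\<forall>x\<in>set (vtab (\<lambda>u. iid (k - 1) (ends (highest (k - 1) u)))). x < 2 ^ bl M"
    "\<forall>x\<in>set (vtab (\<lambda>u. iid (k - 1) {u})). x < 2 ^ bl M"
  proof -
    have "card (below k u) \<le> M" "low_count k u \<le> M" "mid_count k u \<le> M" for u
      unfolding low_count_def mid_count_def by (rule card_mers_sub[of _ k]; auto simp: below_def)+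
    moreover have "iid (k - 1) I \<le> M" for I by (rule iid_le_M) simp
    ultimately have "card (below k u) \<le> M \<and> low_count k u \<le> M \<and> mid_count k u \<le> M \<and> iid (k - 1) I \<le> M" for u I
      by blast
    note * = this
    show "\<forall>x\<in>set (vtab (\<lambda>u. card (below k u))). x < 2 ^ bl M"
      "\<forall>x\<in>set (vtab (low_count k)). x < 2 ^ bl M"
      "\<forall>x\<in>set (vtab (mid_count k)). x < 2 ^ bl M"
      "\<forall>x\<in>set (vtab (\<lambda>u. iid (k - 1) (ends (lowest (k - 1) u)))). x < 2 ^ bl M"
      "\<forall>x\<in>set (vtab (\<lambda>u. iid (k - 1) (ends (highest (k - 1) u)))). x < 2 ^ bl M"
      "\<forall>x\<in>set (vtab (\<lambda>u. iid (k - 1) {u})). x < 2 ^ bl M"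
      by (rule set_tab_bl, use * in blast)+
  qed
  have est: "estart l I \<le> 3 * card E + card V + M" "length (labels I) \<le> 3 * card E + card V + M"
    if "(l, I) \<in> levels" for l I
    using estart_le[of I l] that by (auto simp: emax_def)
  have r1: "\<forall>x\<in>set (tab rcode levels (k * dmax) (\<lambda>(l, I). estart l I)). x < 2 ^ rwidth"
    and r2: "\<forall>x\<in>set (tab rcode levels (k * dmax) (\<lambda>(l, I). length (labels I))). x < 2 ^ rwidth"
    by (rule set_tab_bl; use est in auto)+
  have r3: "\<forall>x\<in>set (tab (iid l) (intervals l) dmax (ext_below k)). x < 2 ^ rwidth" for l
    by (rule set_tab_bl) (rule le_trans[OF ext_below_le], use n_le_M in linarith)
  have r4: "\<forall>x\<in>set (tab (iid l) (intervals l) dmax (\<lambda>I. vertex_code le (g I))). x < 2 ^ rwidth" for l g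
    by (rule set_tab_bl) (rule le_trans[OF vertex_code_le], linarith)
  have e1: "\<forall>x\<in>set (entries (\<lambda>l I c. urank c)). x < 2 ^ bl M"
  proof -
    have "urank c < 2 ^ bl M" if "c \<in> outs I" for c I
      using urank_less[of c] outs_used that card_used num_mers_le[of 1] k by (intro less_bl_I) fastforce
    then show ?thesis by (intro set_entries) blast
  qed
  have e2: "\<forall>x\<in>set (entries (\<lambda>l I c. iid (Suc l) (succs I c))). x < 2 ^ bl M"
  proof -
    have "iid (Suc l) (succs I c) < 2 ^ bl M" if "l < k" for l c I
      using iid_le_M[of "Suc l"] that by (intro less_bl_I) simp
    then show ?thesis by (intro set_entries) blast
  qed
  have e3: "\<forall>x\<in>set (entries (\<lambda>l I c. of_bool (from_left I c))). x < 2 ^ bl M"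
    by (intro set_entries of_bool_bl)
  have e4: "\<forall>x\<in>set (entries shift). x < 2 ^ bl M"
  proof -
    have "shift l I c < 2 ^ bl M" if "l < k" "I \<in> intervals l" "c \<in> outs I" for l c I
    proof -
      from that(2) obtain \<gamma> where "\<gamma> \<in> mers E l" "I = ends \<gamma>" by (auto simp: intervals_def)
      then have "shift l I c \<le> num_mers E (Suc l)" using lrank_snoc(2) that by blast
      then show ?thesis using num_mers_le'[of "Suc l"] that by (intro less_bl_I) linarith
    qed
    then show ?thesis by (intro set_entries) blast
  qed
  have b: "\<forall>x\<in>set (map of_bool bs). x < (2::nat) ^ 1" for bs by (auto simp: of_bool_def)
  have m: "\<forall>x\<in>set vals_A. x < 2 ^ L" "\<forall>x\<in>set vals_sp1. x < 2 ^ 1" "\<forall>x\<in>set vals_Rel. x < 2 ^ (3 * sparam)"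
    "\<forall>x\<in>set vals_sp2. x < 2 ^ 1" "\<forall>x\<in>set vals_Tab. x < 2 ^ (3 * sparam)"
    using ranges by blast+
  define ok where "ok a \<longleftrightarrow> (\<forall>x\<in>set (snd a). x < 2 ^ fst a)" for a :: "nat \<times> nat list"
  have ok: "ok (c, xs)" if "\<forall>x\<in>set xs. x < 2 ^ c" for c xs using that by (simp add: ok_def)
  have "list_all ok arrays"
    unfolding arrays_def list.pred_inject
    by (intro conjI list.pred_inject(1) s[THEN ok] 1[THEN ok] 2[THEN ok] v[THEN ok] r1[THEN ok] r2[THEN ok] r3[THEN ok]
        r4[THEN ok] e1[THEN ok] e2[THEN ok] e3[THEN ok] e4[THEN ok] b[THEN ok] m[THEN ok])
  then show ?thesis by (simp add: list_all_iff ok_def)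
qed

end

section \<open>The query programs\<close>

text \<open>Meant for loop-free programs, whose time it bounds. Loops are accounted for separately,
  with their numbers of iterations, in \<open>step_time\<close>, \<open>find_time\<close> and
  \<open>enum_time\<close>.\<close>

fun tm :: "com \<Rightarrow> nat" where
  "tm (Seq c d) = tm c + tm d"
| "tm (If r c d) = max (tm c) (tm d) + 1"
| "tm _ = 1"

lemma tm_compile: "tm (compile t e) = cost e"
  by (induction e arbitrary: t) auto

lemma tm_asg: "tm (asg v e) = cost e + 1" and tm_emit: "tm (emit e) = cost e + 1"
  by (simp_all add: asg_def emit_def tm_compile)

abbreviation run :: "nat \<Rightarrow> (nat \<Rightarrow> nat) \<Rightarrow> com \<Rightarrow> (nat \<Rightarrow> nat) \<times> nat list \<Rightarrow>
    ((nat \<Rightarrow> nat) \<times> nat list \<Rightarrow> bool) \<Rightarrow> bool" where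
  "run w \<mu> c st Q \<equiv> tot w \<mu> c (tm c) st Q"

lemma run_asg:
  assumes "ev w \<mu> \<rho> e = x" "v < nvars" "\<forall>r\<in>vars e. r < nvars" "Q (\<rho>(v := x), out)"
  shows "run w \<mu> (asg v e) (\<rho>, out) Q"
  using tot_asg[of v e w \<mu> \<rho> x Q out] assms by (simp add: tm_asg)

lemma run_Seq_asg:
  assumes "ev w \<mu> \<rho> e = x" "v < nvars" "\<forall>r\<in>vars e. r < nvars" "run w \<mu> d (\<rho>(v := x), out) Q"
  shows "run w \<mu> (Seq (asg v e) d) (\<rho>, out) Q"
  using tot_Seq_asg[of v e w \<mu> \<rho> x d "tm d" out Q] assms by (simp add: tm_asg)

lemma run_emit:
  assumes "ev w \<mu> \<rho> e = x" "\<forall>r\<in>vars e. r < nvars" "Q (\<rho>, out @ [x])"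
  shows "run w \<mu> (emit e) (\<rho>, out) Q"
  using tot_emit[of e w \<mu> \<rho> x Q out] assms by (simp add: tm_emit)

lemma run_Seq_emit:
  assumes "ev w \<mu> \<rho> e = x" "\<forall>r\<in>vars e. r < nvars" "run w \<mu> d (\<rho>, out @ [x]) Q"
  shows "run w \<mu> (Seq (emit e) d) (\<rho>, out) Q"
  using tot_Seq[OF tot_emit[of e w \<mu> \<rho> x "\<lambda>st. st = (\<rho>, out @ [x])" out], of d "tm d" Q] assms
  by (simp add: tm_emit)

lemma run_If:
  assumes "v < nvars" "\<rho> v \<noteq> 0 \<Longrightarrow> run w \<mu> c (\<rho>, out) Q" "\<rho> v = 0 \<Longrightarrow> run w \<mu> d (\<rho>, out) Q"
  shows "run w \<mu> (If v c d) (\<rho>, out) Q"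
  using tot_If[of v \<rho> w \<mu> c "max (tm c) (tm d)" out Q d] assms tot_weaken[of w \<mu> _ _ _ Q _ Q]
  by (metis max.cobounded1 max.cobounded2 tm.simps(2))

lemma run_Seq:
  assumes "run w \<mu> c st P" "\<And>st'. P st' \<Longrightarrow> run w \<mu> d st' Q"
  shows "run w \<mu> (Seq c d) st Q"
  using tot_Seq[OF assms] by simp

definition par :: "nat \<Rightarrow> ex" where
  "par i = arr 0 (Num i)"

abbreviation block_entry :: ex where
  "block_entry \<equiv> arrbits 20 (Bin Add (Bin Add (Bin Mul (Var 12) (par 3)) (Var 13)) (Bin Mul (Bin Mod (Var 10) (par 3)) (par 4))) (par 4)"

abbreviation subblock_entry :: ex where
  "subblock_entry \<equiv> arrbits 23 (Bin Add (Bin Add (Bin Mul (Var 15) (par 5)) (Var 13)) (Bin Mul (Bin Mod (Var 10) (par 5)) (par 6))) (par 6)"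

abbreviation table_entry :: ex where
  "table_entry \<equiv> arr 25 (Bin Add (Bin Mul (arrbits 24 (Bin Add (Bin Mul (Var 15) (par 5)) (Var 13)) (par 7)) (par 5)) (Bin Mod (Var 10) (par 5)))"

text \<open>Register 10 holds the argument and register 11 receives the value. The two tests choose
  among the list of the block, the list of the subblock and the table of windows.\<close>

definition lookup_prog :: com where
  "lookup_prog =
     Seq (asg 12 (Bin Div (Var 10) (par 3)))
     (Seq (asg 13 (arr 18 (Var 12)))
     (Seq (asg 14 (arr 19 (Var 12)))
     (If 14
       (asg 11 block_entry)
       (Seq (asg 15 (Bin Div (Var 10) (par 5)))
       (Seq (asg 13 (Bin Add (Var 13) (arr 21 (Var 15))))
       (Seq (asg 14 (arr 22 (Var 15)))
       (If 14
         (asg 11 (Bin Add (Var 13) subblock_entry))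
         (asg 11 (Bin Add (Var 13) table_entry)))))))))"

text \<open>
  Registers 20, 21 and 22 hold the length, the interval and the rank at the left end of the current
  string, register 23 the next letter, registers 24 and 25 a range of entries. Register 0 remains the
  address of the query, and registers 1 and 2 the word size and the width of the header fields.
\<close>

definition search_init :: com where
  "search_init =
     Seq (asg 27 (Bin Add (Bin Mul (Var 20) (par 1)) (Var 21)))
     (Seq (asg 24 (Bin Add (Bin Mul (Var 20) (par 2)) (arr 9 (Var 27))))
          (asg 25 (Bin Add (Var 24) (arr 10 (Var 27)))))"

definition search_test :: com where
  "search_test = asg 26 (Bin Lt (Bin Add (Var 24) (Num 1)) (Var 25))"

definition search_body :: com where
  "search_body =
     Seq (asg 27 (Bin Add (Var 24) (Bin Div (Bin Sub (Var 25) (Var 24)) (Num 2))))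
     (Seq (asg 28 (Bin Lt (Var 23) (arr 14 (Var 27))))
     (Seq (If 28 (asg 25 (Var 27)) (asg 24 (Var 27))) search_test))"

definition step_final :: com where
  "step_final =
     Seq (asg 22 (Bin Add (Bin Mul (arr 16 (Var 24)) (Var 22)) (arr 17 (Var 24))))
         (asg 21 (arr 15 (Var 24)))"

definition step_prog :: com where
  "step_prog = Seq search_init (Seq search_test (Seq (While 26 search_body) step_final))"

definition step_time :: "nat \<Rightarrow> nat" where
  "step_time b = tm search_init + (tm search_test + (b * (tm search_body + 1) + 1 + tm step_final))"

text \<open>The left end and the rank are read from the query at offsets 0 and 2. Register 22 is
  guaranteed to receive the rank of the suffix only under the hypotheses of \<open>lrank_tl\<close>;
  otherwise the bit read in \<open>step_final\<close> cancels it.\<close>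

definition shorten_prog :: com where
  "shorten_prog =
     Seq (asg 18 (Cell (Var 0)))
     (Seq (asg 19 (Cell (Bin Add (Var 0) (Num 2))))
     (Seq (asg 10 (Bin Add (arr 3 (Var 18)) (Var 19)))
     (Seq lookup_prog
     (Seq (asg 16 (Bin Lt (arr 4 (Var 18)) (Var 19)))
     (Seq (If 16
        (Seq (asg 16 (Bin Lt (arr 5 (Var 18)) (Var 19)))
          (If 16 (asg 21 (arr 7 (Var 18))) (asg 21 (arr 8 (Var 18)))))
        (asg 21 (arr 6 (Var 18))))
     (Seq (asg 22 (Bin Sub (Var 11) (arr 11 (Var 21))))
        (asg 20 (Bin Sub (par 0) (Num 1)))))))))"

definition output_prog :: com where
  "output_prog = Seq (emit (arr 12 (Var 21))) (Seq (emit (arr 13 (Var 21))) (emit (Var 22)))"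

definition find_init :: com where
  "find_init = Seq (asg 20 (Num 0)) (Seq (asg 21 (Num 0)) (Seq (asg 22 (Num 1))
     (asg 30 (Bin Lt (Var 20) (par 0)))))"

definition find_load :: com where
  "find_load = asg 23 (arr 1 (Cell (Bin Add (Var 0) (Var 20))))"

definition find_next :: com where
  "find_next = Seq (asg 20 (Bin Add (Var 20) (Num 1))) (asg 30 (Bin Lt (Var 20) (par 0)))"

definition find_prog :: com where
  "find_prog = Seq load_hw (Seq find_init
     (Seq (While 30 (Seq find_load (Seq step_prog find_next))) output_prog))"

definition enum_body :: com where
  "enum_body = Seq (emit (arr 2 (arr 14 (Var 24))))
     (Seq (asg 24 (Bin Add (Var 24) (Num 1))) (asg 26 (Bin Lt (Var 24) (Var 25))))"

definition enum_prog :: com where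
  "enum_prog = Seq load_hw (Seq shorten_prog (Seq search_init
     (Seq (asg 26 (Bin Lt (Var 24) (Var 25))) (While 26 enum_body))))"

definition forward_load :: com where
  "forward_load = asg 23 (arr 1 (Cell (Bin Add (Var 0) (Num 3))))"

definition forward_prog :: com where
  "forward_prog = Seq load_hw (Seq shorten_prog (Seq forward_load (Seq step_prog output_prog)))"

definition find_time :: "nat \<Rightarrow> nat \<Rightarrow> nat" where
  "find_time l b = 50 + (tm find_init + ((l * (tm find_load + (step_time b + tm find_next) + 1) + 1) + tm output_prog))"

definition enum_time :: "nat \<Rightarrow> nat" where
  "enum_time l = 50 + (tm shorten_prog + (tm search_init +
     (tm (asg 26 (Bin Lt (Var 24) (Var 25))) + (l * (tm enum_body + 1) + 1))))"

definition forward_time :: "nat \<Rightarrow> nat" where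
  "forward_time b = 50 + (tm shorten_prog + (tm forward_load + (step_time b + tm output_prog)))"

lemma vars_par: "vars (par i) = {1, 2}"
  by (simp add: par_def vars_arr)

section \<open>Correctness of the programs on a memory that stores the arrays\<close>

locale machine = dbg V \<Sigma> E le k for V :: "'v set" and \<Sigma> :: "'a::linorder set" and E le k +
  fixes w :: nat and \<mu> :: "nat \<Rightarrow> nat"
  assumes store: "store w \<mu> arrays"
begin

sublocale store w \<mu> arrays
  by (rule store)

lemma width_less: "a < num_arrays \<Longrightarrow> arrays ! a = (b, xs) \<Longrightarrow> b < w"
  using wide(3) nth_mem[of a arrays] by (fastforce simp: len)

lemma arrays_nth:
  "arrays ! 0 = (bl (sum_list params), params)"
  "arrays ! 1 = (bl (card E), tab (letter_code \<Sigma>) used (Suc (card \<Sigma>)) urank)"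
  "arrays ! 2 = (bl (card \<Sigma>), tab urank used (card used) (letter_code \<Sigma>))"
  "arrays ! 3 = (bl M, vtab (\<lambda>u. card (below k u)))"
  "arrays ! 4 = (bl M, vtab (low_count k))"
  "arrays ! 5 = (bl M, vtab (mid_count k))"
  "arrays ! 6 = (bl M, vtab (\<lambda>u. iid (k - 1) (ends (lowest (k - 1) u))))"
  "arrays ! 7 = (bl M, vtab (\<lambda>u. iid (k - 1) (ends (highest (k - 1) u))))"
  "arrays ! 8 = (bl M, vtab (\<lambda>u. iid (k - 1) {u}))"
  "arrays ! 9 = (rwidth, tab rcode levels (k * dmax) (\<lambda>(l, I). estart l I))"
  "arrays ! 10 = (rwidth, tab rcode levels (k * dmax) (\<lambda>(l, I). length (labels I)))"
  "arrays ! 11 = (rwidth, tab (iid (k - 1)) (intervals (k - 1)) dmax (ext_below k))"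
  "arrays ! 12 = (rwidth, tab (iid k) (intervals k) dmax (\<lambda>I. vertex_code le (lft I)))"
  "arrays ! 13 = (rwidth, tab (iid k) (intervals k) dmax (\<lambda>I. vertex_code le (rgt I)))"
  "arrays ! 14 = (bl M, entries (\<lambda>l I c. urank c))"
  "arrays ! 15 = (bl M, entries (\<lambda>l I c. iid (Suc l) (succs I c)))"
  "arrays ! 16 = (bl M, entries (\<lambda>l I c. of_bool (from_left I c)))"
  "arrays ! 17 = (bl M, entries shift)"
  "arrays ! 18 = (L, vals_A)" "arrays ! 19 = (1, vals_sp1)" "arrays ! 20 = (1, map of_bool pool1)"
  "arrays ! 21 = (3 * sparam, vals_Rel)" "arrays ! 22 = (1, vals_sp2)" "arrays ! 23 = (1, map of_bool pool2)"
  "arrays ! 24 = (1, map of_bool unary)" "arrays ! 25 = (3 * sparam, vals_Tab)"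
  by (simp_all add: arrays_def)

text \<open>Every array with positive width lies in a bit string shorter than \<open>2 ^ w\<close>.
  This single fact rules out overflow in computations of indices, with no separate estimates for
  each table.\<close>

lemma length_less: 
  assumes "a < num_arrays" "arrays ! a = (b, xs)" "b \<ge> 1"
  shows "length xs + 1 < 2 ^ w"
proof -
  have "length xs \<le> b * length xs" using assms(3) by simp
  also have "\<dots> \<le> length (body arrays)" using offset_bound[of a arrays] assms len by simp
  finally show ?thesis using wide(1) by (simp add: length_encode')
qed

lemma bl_pos: "x \<ge> 1 \<Longrightarrow> bl x \<ge> 1"
  using less_bl[of x] by (cases "bl x") auto

lemma num_arrays_less: "a < 26 \<Longrightarrow> a < num_arrays"
  by (simp add: num_arrays_def)

lemma M_less: "M + 1 \<le> 2 ^ bl M" "2 ^ bl M < (2::nat) ^ w"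
proof -
  show "M + 1 \<le> 2 ^ bl M" using less_bl[of M] by simp
  have "bl M < w" by (rule width_less[OF num_arrays_less arrays_nth(4)]) simp
  then show "2 ^ bl M < (2::nat) ^ w" by (intro power_strict_increasing) auto
qed

lemma le_M_less: "x \<le> M \<Longrightarrow> x < 2 ^ w" "x \<le> M \<Longrightarrow> x + 1 < 2 ^ w"
  using M_less by linarith+

lemma n_less: "n < 2 ^ w"
  using le_M_less n_le_M by blast

lemma ev_par:
  assumes "ready \<rho>" "i < 8"
  shows "ev w \<mu> \<rho> (par i) = params ! i"
  unfolding par_def
proof (rule ev_arr[OF assms(1) num_arrays_less _ arrays_nth(1)])
  show "ev w \<mu> \<rho> (Num i) = i" by (rule Num_eq) (use assms in \<open>simp add: num_arrays_def\<close>)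
qed (use assms in \<open>auto simp: params_def\<close>)

lemma params_less: "i < 8 \<Longrightarrow> params ! i < 2 ^ w"
proof -
  assume "i < 8"
  then have "params ! i \<in> set params" by (intro nth_mem) (simp add: params_def)
  then have "params ! i \<le> sum_list params" by (auto intro: member_le_sum_list)
  also have "\<dots> < 2 ^ bl (sum_list params)" by (rule less_bl)
  also have "\<dots> < 2 ^ w"
    using width_less[OF num_arrays_less arrays_nth(1)] by (intro power_strict_increasing) auto
  finally show ?thesis .
qed

lemma params_nth:
  "params ! 0 = k" "params ! 1 = dmax" "params ! 2 = emax" "params ! 3 = K" "params ! 4 = L" "params ! 5 = sparam"
  "params ! 6 = 3 * sparam" "params ! 7 = R"
  by (simp_all add: params_def)

lemma ev_pars:
  assumes "ready \<rho>"
  shows "ev w \<mu> \<rho> (par 0) = k" "ev w \<mu> \<rho> (par 1) = dmax" "ev w \<mu> \<rho> (par 2) = emax"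
    "ev w \<mu> \<rho> (par 3) = K" "ev w \<mu> \<rho> (par 4) = L" "ev w \<mu> \<rho> (par 5) = sparam"
    "ev w \<mu> \<rho> (par 6) = 3 * sparam" "ev w \<mu> \<rho> (par 7) = R"
  by (subst ev_par[OF assms], simp, rule params_nth)+

lemma ev_tab:
  assumes "ready \<rho>" "arrays ! a = (b, tab code S N f)" "a < 26" "ev w \<mu> \<rho> e = code x"
    "inj_on code S" "x \<in> S" "code x < N"
  shows "ev w \<mu> \<rho> (arr a e) = f x"
  using ev_arr[OF assms(1) num_arrays_less[OF assms(3)] assms(4,2)] nth_tab[OF assms(5-7)] assms(7) by simp

lemma ev_entry:
  assumes "ready \<rho>" "arrays ! a = (b, entries f)" "a < 26" "ev w \<mu> \<rho> e = l * emax + estart l I + t"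
    "l < k" "I \<in> intervals l" "t < length (labels I)"
  shows "ev w \<mu> \<rho> (arr a e) = f l I (labels I ! t)"
  using ev_arr[OF assms(1) num_arrays_less[OF assms(3)] assms(4,2)] nth_entries(1)[OF assms(5-7)] nth_entries(2)[OF assms(5-7), of f]
  by (simp add: length_entries)

lemma R_less_w: "R < w" "L < w" "3 * sparam < w" "sparam < w"
proof -
  show 1: "L < w" by (rule width_less[OF num_arrays_less arrays_nth(19)]) simp
  show 2: "3 * sparam < w" by (rule width_less[OF num_arrays_less arrays_nth(22)]) simp
  then show "sparam < w" by simp
  \<comment> \<open>The window width is bounded through the table that windows index: its
    \<open>2 ^ R * sparam\<close> entries fit below \<open>2 ^ w\<close>.\<close>
  have "2 ^ R * 1 \<le> 2 ^ R * sparam" using L_pos by (intro mult_left_mono) auto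
  also have "2 ^ R * sparam < 2 ^ w"
    using length_less[OF num_arrays_less arrays_nth(26)] L_pos by (simp add: lengths)
  finally have "(2::nat) ^ R < 2 ^ w" by simp
  then show "R < w" by simp
qed

definition agree :: "nat set \<Rightarrow> (nat \<Rightarrow> nat) \<Rightarrow> (nat \<Rightarrow> nat) \<Rightarrow> bool" where
  "agree S \<rho> \<rho>' \<longleftrightarrow> (\<forall>r. r \<notin> S \<longrightarrow> \<rho>' r = \<rho> r)"

lemma run_lookup:
  assumes r: "ready \<rho>" and g: "\<rho> 10 = g" "g \<le> n"
    and Q: "\<And>\<rho>'. ready \<rho>' \<Longrightarrow> agree {11, 12, 13, 14, 15} \<rho> \<rho>' \<Longrightarrow> \<rho>' 11 = ext_rank k g \<Longrightarrow> Q (\<rho>', out)"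
  shows "run w \<mu> lookup_prog (\<rho>, out) Q"
proof -
  let ?F = "ext_rank k"
  define b where "b = g div K"
  define c where "c = g div sparam"
  note lk = lookup[OF g(2), folded b_def c_def]
  have gw: "g < 2 ^ w" using g n_less by simp
  have Fn: "?F h < 2 ^ w" for h using bounded[of h] n_less by simp
  have upd: "ready (\<rho>'(v := x))" if "ready \<rho>'" "v > 2" for \<rho>' v x using that by (auto simp: ready_def)
  note vs = vars_arr vars_par nvars_def
  let ?r1 = "\<rho>(12 := b)" let ?r2 = "?r1(13 := ?F (b * K))" let ?r3 = "?r2(14 := of_bool (sparse1 b))"
  have r1: "ready ?r1" and r2: "ready ?r2" and r3: "ready ?r3" by (auto intro!: upd r)
  have e1: "ev w \<mu> \<rho> (Bin Div (Var 10) (par 3)) = b"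
    unfolding b_def by (rule ev_Div) (use g gw ev_pars[OF r] in auto)
  have e2: "ev w \<mu> ?r1 (arr 18 (Var 12)) = ?F (b * K)"
    using ev_arr[OF r1 num_arrays_less _ arrays_nth(19), of "Var 12" b] lk by simp
  have e3: "ev w \<mu> ?r2 (arr 19 (Var 12)) = of_bool (sparse1 b)"
    using ev_arr[OF r2 num_arrays_less _ arrays_nth(20), of "Var 12" b] lk by simp
  show ?thesis
    unfolding lookup_prog_def
  proof (rule run_Seq_asg[OF e1], simp add: vs, simp add: vs, rule run_Seq_asg[OF e2], simp add: vs, simp add: vs,
      rule run_Seq_asg[OF e3], simp add: vs, simp add: vs, rule run_If, simp add: vs)
    assume "?r3 14 \<noteq> 0"
    then have sp: "sparse1 b" by simp
    have bn: "b \<le> n div K" using g by (simp add: b_def div_le_mono)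
    have i: "g mod K < K" using L_pos by simp
    have bg: "b * K + g mod K = g" by (simp add: b_def)
    note p = pool1(2)[OF bn sp i, unfolded bg]
    have len: "length pool1 + 1 < 2 ^ w"
      using length_less[OF num_arrays_less arrays_nth(21)] by simp
    have x: "ev w \<mu> ?r3 (Bin Add (Bin Add (Bin Mul (Var 12) (par 3)) (Var 13)) (Bin Mul (Bin Mod (Var 10) (par 3)) (par 4)))
        = P (b * K) + g mod K * L"
      unfolding P_def
      by (intro ev_Add ev_Mul ev_Mod ev_pars r3) (use p len gw g in \<open>auto simp: P_def\<close>)
    have "ev w \<mu> ?r3 block_entry = ?F g"
      using ev_arrbits[OF r3 num_arrays_less x ev_pars(5)[OF r3] arrays_nth(21)] p R_less_w by simp
    then show "run w \<mu> (asg 11 block_entry) (?r3, out) Q"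
      by (rule run_asg, simp add: vs, simp add: vs) (rule Q, auto intro!: upd r simp: agree_def)
  next
    assume "?r3 14 = 0"
    then have sp: "\<not> sparse1 b" by simp
    let ?r4 = "?r3(15 := c)" let ?r5 = "?r4(13 := ?F (c * sparam))" let ?r6 = "?r5(14 := of_bool (sparse2 c))"
    have r4: "ready ?r4" and r5: "ready ?r5" and r6: "ready ?r6" by (auto intro!: upd r)
    have f0: "vals_A ! b + vals_Rel ! c = ?F (c * sparam)" using lk sp by simp
    have e4: "ev w \<mu> ?r3 (Bin Div (Var 10) (par 5)) = c"
      unfolding c_def by (rule ev_Div) (use g gw ev_pars[OF r3] in auto)
    have e5': "ev w \<mu> ?r4 (arr 21 (Var 15)) = vals_Rel ! c"
      using ev_arr[OF r4 num_arrays_less _ arrays_nth(22), of "Var 15" c] lk by simp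
    have e5: "ev w \<mu> ?r4 (Bin Add (Var 13) (arr 21 (Var 15))) = ?F (c * sparam)"
      using ev_Add[OF _ e5', of "Var 13" "?F (b * K)"] f0 Fn[of "c * sparam"] lk by simp
    have e6: "ev w \<mu> ?r5 (arr 22 (Var 15)) = of_bool (sparse2 c)"
      using ev_arr[OF r5 num_arrays_less _ arrays_nth(23), of "Var 15" c] lk by simp
    have cg: "c * sparam + g mod sparam = g" unfolding c_def by (rule div_mult_mod_eq)
    have Fc: "?F (c * sparam) \<le> ?F g" by (rule mono) (use cg in linarith)
    show "run w \<mu> (Seq (asg 15 (Bin Div (Var 10) (par 5)))
       (Seq (asg 13 (Bin Add (Var 13) (arr 21 (Var 15))))
       (Seq (asg 14 (arr 22 (Var 15)))
       (If 14
         (asg 11 (Bin Add (Var 13) subblock_entry))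
         (asg 11 (Bin Add (Var 13) table_entry))))))
       (?r3, out) Q"
    proof (rule run_Seq_asg[OF e4], simp add: vs, simp add: vs, rule run_Seq_asg[OF e5], simp add: vs, simp add: vs,
      rule run_Seq_asg[OF e6], simp add: vs, simp add: vs, rule run_If, simp add: vs)
      assume "?r6 14 \<noteq> 0"
      then have sp2: "sparse2 c" by simp
      have cn: "c \<le> n div sparam" using g by (simp add: c_def div_le_mono)
      have i: "g mod sparam < sparam" using L_pos by simp
      note p = pool2(2)[OF cn sp2 i, unfolded cg]
      have len: "length pool2 + 1 < 2 ^ w"
        using length_less[OF num_arrays_less arrays_nth(24)] by simp
      have x: "ev w \<mu> ?r6 (Bin Add (Bin Add (Bin Mul (Var 15) (par 5)) (Var 13)) (Bin Mul (Bin Mod (Var 10) (par 5)) (par 6)))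
          = P (c * sparam) + g mod sparam * (3 * sparam)"
        unfolding P_def
        by (intro ev_Add ev_Mul ev_Mod ev_pars r6) (use p len gw g in \<open>auto simp: P_def\<close>)
      have y: "ev w \<mu> ?r6 subblock_entry = ?F g - ?F (c * sparam)"
        using ev_arrbits[OF r6 num_arrays_less x ev_pars(7)[OF r6] arrays_nth(24)] p R_less_w by simp
      have "ev w \<mu> ?r6 (Bin Add (Var 13) subblock_entry) = ?F g"
        using ev_Add[OF _ y, of "Var 13" "?F (c * sparam)"] Fc Fn[of g] by simp
      then show "run w \<mu> (asg 11 (Bin Add (Var 13) subblock_entry)) (?r6, out) Q"
        by (rule run_asg, simp add: vs, simp add: vs) (rule Q, auto intro!: upd r simp: agree_def)
    next
      assume "?r6 14 = 0"
      then have sp2: "\<not> sparse2 c" by simp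
      let ?x = "field unary (P (c * sparam)) R"
      have p: "P (c * sparam) + R \<le> length unary" "?x * sparam + g mod sparam < length vals_Tab"
        "?F (c * sparam) + vals_Tab ! (?x * sparam + g mod sparam) = ?F g"
        using lk(9)[OF sp sp2] by auto
      have len: "length unary + 1 < 2 ^ w" "length vals_Tab + 1 < 2 ^ w"
        using length_less[OF num_arrays_less arrays_nth(25)] length_less[OF num_arrays_less arrays_nth(26)] L_pos by auto
      have x: "ev w \<mu> ?r6 (Bin Add (Bin Mul (Var 15) (par 5)) (Var 13)) = P (c * sparam)"
        unfolding P_def by (intro ev_Add ev_Mul ev_pars r6) (use p(1) len in \<open>auto simp: P_def\<close>)
      have y: "ev w \<mu> ?r6 (arrbits 24 (Bin Add (Bin Mul (Var 15) (par 5)) (Var 13)) (par 7)) = ?x"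
        using ev_arrbits[OF r6 num_arrays_less x ev_pars(8)[OF r6] arrays_nth(25)] p R_less_w by simp
      have z: "ev w \<mu> ?r6 (Bin Add (Bin Mul (arrbits 24 (Bin Add (Bin Mul (Var 15) (par 5)) (Var 13)) (par 7)) (par 5))
          (Bin Mod (Var 10) (par 5))) = ?x * sparam + g mod sparam"
        by (intro ev_Add ev_Mul ev_Mod ev_pars r6 y) (use p(2) len gw g in auto)
      have u: "ev w \<mu> ?r6 table_entry = vals_Tab ! (?x * sparam + g mod sparam)"
        using ev_arr[OF r6 num_arrays_less z arrays_nth(26) p(2)] by simp
      have "ev w \<mu> ?r6 (Bin Add (Var 13) table_entry) = ?F g"
        using ev_Add[OF _ u, of "Var 13" "?F (c * sparam)"] p(3) Fn[of g] by simp
      then show "run w \<mu> (asg 11 (Bin Add (Var 13) table_entry)) (?r6, out) Q"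
        by (rule run_asg, simp add: vs, simp add: vs) (rule Q, auto intro!: upd r simp: agree_def)
    qed
  qed
qed

lemma agreeD: "agree S \<rho> \<rho>' \<Longrightarrow> r \<notin> S \<Longrightarrow> \<rho>' r = \<rho> r"
  by (simp add: agree_def)

lemma ready_upd: "ready \<rho> \<Longrightarrow> v > 2 \<Longrightarrow> ready (\<rho>(v := x))"
  by (auto simp: ready_def)

lemma agree_upd: "agree S \<rho> \<rho>' \<Longrightarrow> v \<in> S \<Longrightarrow> agree S \<rho> (\<rho>'(v := x))" "agree S \<rho> \<rho>"
  by (auto simp: agree_def)

abbreviation shorten_regs :: "nat set" where
  "shorten_regs \<equiv> {10, 11, 12, 13, 14, 15, 16, 18, 19, 20, 21, 22}"

lemmas vs = vars_arr vars_par nvars_def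

lemma Num_small: "ev w \<mu> \<rho> (Num 0) = 0" "ev w \<mu> \<rho> (Num 1) = 1" "ev w \<mu> \<rho> (Num 2) = 2" "ev w \<mu> \<rho> (Num 3) = 3"
  by (rule Num_eq, simp add: num_arrays_def)+

lemma entry_bound:
  assumes "l < k" "I \<in> intervals l"
  shows "l * emax + estart l I + length (labels I) \<le> k * emax" "k * emax + 1 < 2 ^ w"
proof -
  have "l * emax + estart l I + length (labels I) \<le> Suc l * emax" using estart_le[OF assms(2)] by simp
  also have "\<dots> \<le> k * emax" using assms(1) by (intro mult_right_mono) auto
  finally show "l * emax + estart l I + length (labels I) \<le> k * emax" .
  show "k * emax + 1 < 2 ^ w"
    using length_less[OF num_arrays_less arrays_nth(15)] bl_pos[OF M_pos] by (simp add: length_entries)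
qed

lemma record_bound:
  assumes "l < k" "I \<in> intervals l"
  shows "l * dmax + iid l I < k * dmax" "k * dmax + 1 < 2 ^ w"
proof -
  show "l * dmax + iid l I < k * dmax" using rcode_less[of l I] assms by (simp add: rcode_def)
  have "rwidth \<ge> 1" by (rule bl_pos) (use M_pos in simp)
  then show "k * dmax + 1 < 2 ^ w"
    using length_less[OF num_arrays_less arrays_nth(10)] by simp
qed

lemma run_search_init:
  assumes r: "ready \<rho>" and l: "\<rho> 20 = l" "l < k" and I: "\<rho> 21 = iid l I" "I \<in> intervals l"
  shows "run w \<mu> search_init (\<rho>, out) (\<lambda>st. \<exists>\<rho>'. st = (\<rho>', out) \<and> ready \<rho>' \<and> agree {24, 25, 27} \<rho> \<rho>' \<and>
    \<rho>' 24 = l * emax + estart l I \<and> \<rho>' 25 = l * emax + estart l I + length (labels I))"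
proof -
  note eb = entry_bound[OF l(2) I(2)] and rb = record_bound[OF l(2) I(2)]
  let ?r1 = "\<rho>(27 := l * dmax + iid l I)" let ?r2 = "?r1(24 := l * emax + estart l I)"
  have r1: "ready ?r1" and r2: "ready ?r2" by (auto intro!: ready_upd r)
  have lv: "(l, I) \<in> levels" using l I by simp
  have c: "rcode (l, I) = l * dmax + iid l I" by (simp add: rcode_def)
  have e1: "ev w \<mu> \<rho> (Bin Add (Bin Mul (Var 20) (par 1)) (Var 21)) = l * dmax + iid l I"
    by (intro ev_Add ev_Mul ev_pars r) (use l I rb in auto)
  have "ev w \<mu> ?r1 (arr 9 (Var 27)) = estart l I"
    using ev_tab[OF r1 arrays_nth(10) _ _ inj_rcode lv rcode_less[OF lv], of "Var 27"] c by simp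
  then have e2: "ev w \<mu> ?r1 (Bin Add (Bin Mul (Var 20) (par 2)) (arr 9 (Var 27))) = l * emax + estart l I"
    by (intro ev_Add ev_Mul ev_pars r1) (use l eb in auto)
  have "ev w \<mu> ?r2 (arr 10 (Var 27)) = length (labels I)"
    using ev_tab[OF r2 arrays_nth(11) _ _ inj_rcode lv rcode_less[OF lv], of "Var 27"] c by simp
  then have e3: "ev w \<mu> ?r2 (Bin Add (Var 24) (arr 10 (Var 27))) = l * emax + estart l I + length (labels I)"
    by (intro ev_Add) (use eb in auto)
  show ?thesis
    unfolding search_init_def
    by (rule run_Seq_asg[OF e1], simp add: vs, simp add: vs, rule run_Seq_asg[OF e2], simp add: vs, simp add: vs,
        rule run_asg[OF e3], simp add: vs, simp add: vs)
      (auto simp: agree_def intro!: ready_upd r)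
qed

lemma labels_less_iff:
  assumes "i < length (labels I)" "j < length (labels I)"
  shows "urank (labels I ! i) < urank (labels I ! j) \<longleftrightarrow> i < j"
proof -
  have *: "labels I ! i < labels I ! j" if "i < j" "j < length (labels I)" for i j
  proof -
    have "labels I ! i \<le> labels I ! j" using sorted_nth_mono[OF labels(4)] that by simp
    moreover have "labels I ! i \<noteq> labels I ! j" using nth_eq_iff_index_eq[OF labels(1)] that by simp
    ultimately show ?thesis by simp
  qed
  have "labels I ! i \<in> used" "labels I ! j \<in> used" using assms nth_mem labels(2) outs_used by blast+
  then have "urank (labels I ! i) < urank (labels I ! j) \<longleftrightarrow> labels I ! i < labels I ! j" by (rule urank_less_iff)
  also have "\<dots> \<longleftrightarrow> i < j" using *[of i j] *[of j i] assms by (metis linorder_neqE_nat order_less_asym order_less_irrefl)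
  finally show ?thesis .
qed

text \<open>With at most \<open>2 ^ b\<close> labels, \<open>b\<close> halvings isolate the letter.
  Ranks among the used letters are compared, because these are what the entries store.\<close>

lemma tot_search:
  assumes r: "ready \<rho>" and l: "l < k" and I: "I \<in> intervals l"
    and t: "t < length (labels I)" "\<rho> 23 = urank (labels I ! t)" "length (labels I) \<le> 2 ^ b"
    and base: "\<rho> 24 = l * emax + estart l I" "\<rho> 25 = l * emax + estart l I + length (labels I)"
  shows "tot w \<mu> (Seq search_test (While 26 search_body)) (tm search_test + (b * (tm search_body + 1) + 1)) (\<rho>, out)
    (\<lambda>st. \<exists>\<rho>'. st = (\<rho>', out) \<and> ready \<rho>' \<and> agree {24, 25, 26, 27, 28} \<rho> \<rho>' \<and> \<rho>' 24 = l * emax + estart l I + t)"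
proof -
  let ?p = "l * emax + estart l I"
  note eb = entry_bound[OF l I]
  have w0: "w > 0" using wide(4) by simp
  \<comment> \<open>The index \<open>t\<close> stays in the half-open range from \<open>lo\<close>
    to \<open>hi\<close>, of length at most \<open>2 ^ i\<close>. When the test fails, the range
    contains \<open>t\<close> alone and \<open>lo\<close> is \<open>t\<close>.\<close>
  define Inv where "Inv i st \<longleftrightarrow> (\<exists>\<rho>' lo hi. st = (\<rho>', out) \<and> ready \<rho>' \<and> agree {24, 25, 26, 27, 28} \<rho> \<rho>' \<and>
    \<rho>' 24 = ?p + lo \<and> \<rho>' 25 = ?p + hi \<and> lo \<le> t \<and> t < hi \<and> hi \<le> length (labels I) \<and> hi \<le> lo + 2 ^ i \<and>
    \<rho>' 26 = of_bool (lo + 1 < hi))" for i :: nat and st :: "(nat \<Rightarrow> nat) \<times> nat list"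
  have test: "ev w \<mu> \<rho>' (Bin Lt (Bin Add (Var 24) (Num 1)) (Var 25)) = of_bool (lo + 1 < hi)"
    if "\<rho>' 24 = ?p + lo" "\<rho>' 25 = ?p + hi" "lo < hi" "hi \<le> length (labels I)" for \<rho>' lo hi
  proof -
    have "ev w \<mu> \<rho>' (Bin Add (Var 24) (Num 1)) = ?p + lo + 1"
      by (rule ev_Add) (use that eb Num_small in \<open>auto simp del: ev.simps(1)\<close>)
    then show ?thesis using ev_Lt[OF _ _ w0, of \<mu> \<rho>' "Bin Add (Var 24) (Num 1)" "?p + lo + 1" "Var 25" "?p + hi"] that
      by simp
  qed
  show ?thesis
  proof (rule tot_Seq[where R = "Inv b"])
    show "run w \<mu> search_test (\<rho>, out) (Inv b)"
      unfolding search_test_def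
    proof (rule run_asg[OF test[of \<rho> 0 "length (labels I)"]])
      show "Inv b (\<rho>(26 := of_bool (0 + 1 < length (labels I))), out)"
        unfolding Inv_def
        by (intro exI[of _ "\<rho>(26 := of_bool (0 + 1 < length (labels I)))"] exI[of _ 0] exI[of _ "length (labels I)"])
          (use base t r in \<open>auto intro!: ready_upd simp: agree_def\<close>)
    qed (use base t in \<open>auto simp: vs\<close>)
  next
    fix st assume "Inv b st"
    show "tot w \<mu> (While 26 search_body) (b * (tm search_body + 1) + 1) st
        (\<lambda>st. \<exists>\<rho>'. st = (\<rho>', out) \<and> ready \<rho>' \<and> agree {24, 25, 26, 27, 28} \<rho> \<rho>' \<and> \<rho>' 24 = ?p + t)"
    proof (rule tot_While[where I = Inv, OF _ \<open>Inv b st\<close>])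
      show "(26::nat) < nvars" by (simp add: nvars_def)
    next
      fix i st assume "Inv i st" "fst st 26 = 0"
      then show "\<exists>\<rho>'. st = (\<rho>', out) \<and> ready \<rho>' \<and> agree {24, 25, 26, 27, 28} \<rho> \<rho>' \<and> \<rho>' 24 = ?p + t"
        unfolding Inv_def by (auto split: if_splits)
    next
      fix i st assume i: "Inv i st" "fst st 26 \<noteq> 0"
      then obtain \<rho>' lo hi where st: "st = (\<rho>', out)" and r': "ready \<rho>'" and ag: "agree {24, 25, 26, 27, 28} \<rho> \<rho>'"
        and lh: "\<rho>' 24 = ?p + lo" "\<rho>' 25 = ?p + hi" "lo \<le> t" "t < hi" "hi \<le> length (labels I)" "hi \<le> lo + 2 ^ i" "lo + 1 < hi"
        unfolding Inv_def by auto
      have i0: "i > 0" using lh by (cases i) auto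
      have "hi \<le> lo + 2 ^ i" by (rule lh)
      also have "(2::nat) ^ i = 2 * 2 ^ (i - 1)" using i0 by (simp flip: power_Suc)
      finally have half: "hi \<le> lo + 2 * 2 ^ (i - 1)" .
      let ?m = "lo + (hi - lo) div 2"
      have m: "lo < ?m" "?m < hi" using lh by auto
      let ?r1 = "\<rho>'(27 := ?p + ?m)" let ?r2 = "?r1(28 := of_bool (t < ?m))"
      have r1: "ready ?r1" and r2: "ready ?r2" by (auto intro!: ready_upd r')
      have "ev w \<mu> \<rho>' (Bin Add (Var 24) (Bin Div (Bin Sub (Var 25) (Var 24)) (Num 2))) = (?p + lo) + ((?p + hi) - (?p + lo)) div 2"
        by (intro ev_Add ev_Div ev_Sub Num_small) (use lh eb m in auto)
      then have e1: "ev w \<mu> \<rho>' (Bin Add (Var 24) (Bin Div (Bin Sub (Var 25) (Var 24)) (Num 2))) = ?p + ?m" by simp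
      have ml: "?m < length (labels I)" using m lh by linarith
      have "ev w \<mu> ?r1 (arr 14 (Var 27)) = urank (labels I ! ?m)"
        using ev_entry[OF r1 arrays_nth(15) _ _ l I ml, of "Var 27"] by simp
      moreover have "?r1 23 = urank (labels I ! t)" using agreeD[OF ag, of 23] t(2) by simp
      ultimately have e2: "ev w \<mu> ?r1 (Bin Lt (Var 23) (arr 14 (Var 27))) = of_bool (t < ?m)"
        using ev_Lt[OF _ _ w0, of \<mu> ?r1 "Var 23" "urank (labels I ! t)" "arr 14 (Var 27)"] labels_less_iff[OF t(1) ml] by simp
      have fin: "Inv (i - 1) (\<rho>3(26 := of_bool (lo' + 1 < hi')), out)"
        if "ready \<rho>3" "agree {24, 25, 26, 27, 28} \<rho> \<rho>3" "\<rho>3 24 = ?p + lo'" "\<rho>3 25 = ?p + hi'" "lo' \<le> t" "t < hi'" "hi' \<le> hi"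
          "hi' \<le> lo' + 2 ^ (i - 1)" for \<rho>3 lo' hi'
        unfolding Inv_def
        by (intro exI[of _ "\<rho>3(26 := of_bool (lo' + 1 < hi'))"] exI[of _ lo'] exI[of _ hi'])
          (use that lh in \<open>auto intro!: ready_upd agree_upd\<close>)
      have "run w \<mu> search_body (\<rho>', out) (Inv (i - 1))"
        unfolding search_body_def
      proof (rule run_Seq_asg[OF e1], simp add: vs, simp add: vs, rule run_Seq_asg[OF e2], simp add: vs, simp add: vs)
        let ?st = "\<lambda>st. \<exists>\<rho>3 lo' hi'. st = (\<rho>3, out) \<and> ready \<rho>3 \<and> agree {24, 25, 26, 27, 28} \<rho> \<rho>3 \<and>
          \<rho>3 24 = ?p + lo' \<and> \<rho>3 25 = ?p + hi' \<and> lo' \<le> t \<and> t < hi' \<and> hi' \<le> hi \<and> hi' \<le> lo' + 2 ^ (i - 1)"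
        have hl: "?m \<le> lo + 2 ^ (i - 1)" "hi \<le> ?m + 2 ^ (i - 1)" using half by linarith+
        have v27: "ev w \<mu> ?r2 (Var 27) = ?p + ?m" by simp
        have ag2: "agree {24, 25, 26, 27, 28} \<rho> ?r2" by (intro agree_upd ag) auto
        show "run w \<mu> (Seq (If 28 (asg 25 (Var 27)) (asg 24 (Var 27))) search_test) (?r2, out) (Inv (i - 1))"
        proof (rule run_Seq[where P = ?st], rule run_If, simp add: vs)
          assume "?r2 28 \<noteq> 0"
          then have tm: "t < ?m" by simp
          let ?r3 = "?r2(25 := ?p + ?m)"
          have "ready ?r3" "agree {24, 25, 26, 27, 28} \<rho> ?r3" by (rule ready_upd[OF r2], simp, rule agree_upd(1)[OF ag2], simp)
          moreover have "?r3 24 = ?p + lo" "?r3 25 = ?p + ?m" using lh(1) by simp_all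
          ultimately have "?st (?r3, out)" using lh(3) tm hl(1) less_imp_le[OF m(2)] by blast
          then show "run w \<mu> (asg 25 (Var 27)) (?r2, out) ?st"
            by (rule run_asg[OF v27, rotated 2]) (simp_all only: vars.simps nvars_def, simp_all)
        next
          assume "?r2 28 = 0"
          then have tm: "?m \<le> t" by simp
          let ?r3 = "?r2(24 := ?p + ?m)"
          have "ready ?r3" "agree {24, 25, 26, 27, 28} \<rho> ?r3" by (rule ready_upd[OF r2], simp, rule agree_upd(1)[OF ag2], simp)
          moreover have "?r3 24 = ?p + ?m" "?r3 25 = ?p + hi" using lh(2) by simp_all
          ultimately have "?st (?r3, out)" using lh(4) tm hl(2) order_refl[of hi] by blast
          then show "run w \<mu> (asg 24 (Var 27)) (?r2, out) ?st"
            by (rule run_asg[OF v27, rotated 2]) (simp_all only: vars.simps nvars_def, simp_all)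
        next
          fix st3 assume "?st st3"
          then obtain \<rho>3 lo' hi' where s3: "st3 = (\<rho>3, out)" "ready \<rho>3" "agree {24, 25, 26, 27, 28} \<rho> \<rho>3"
            "\<rho>3 24 = ?p + lo'" "\<rho>3 25 = ?p + hi'" "lo' \<le> t" "t < hi'" "hi' \<le> hi" "hi' \<le> lo' + 2 ^ (i - 1)" by blast
          show "run w \<mu> search_test st3 (Inv (i - 1))"
            unfolding search_test_def s3(1)
            by (rule run_asg[OF test[of \<rho>3 lo' hi']], use s3 lh in simp, use s3 lh in simp, use s3 lh in simp,
                use s3 lh in simp, simp add: vs, simp add: vs, rule fin) (use s3 in auto)
        qed
      qed
      then show "i > 0 \<and> run w \<mu> search_body st (Inv (i - 1))" using i0 st by simp
    qed
  qed
qed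

end

context machine
begin

lemma agree_trans: "agree S \<rho> \<rho>' \<Longrightarrow> agree T \<rho>' \<rho>'' \<Longrightarrow> agree (S \<union> T) \<rho> \<rho>''"
  by (auto simp: agree_def)

lemma agree_mono: "agree S \<rho> \<rho>' \<Longrightarrow> S \<subseteq> T \<Longrightarrow> agree T \<rho> \<rho>'"
  by (auto simp: agree_def)

lemma lrank_le_M: "\<gamma> \<in> mers E l \<Longrightarrow> l \<le> k \<Longrightarrow> lrank \<gamma> \<le> M"
  unfolding lrank_def rank_def by (rule card_mers_sub[of _ l]) (auto simp: mers_def)

text \<open>The rank register has to be correct only if \<open>c\<close> leaves the left end of the
  interval. Forward traversal can satisfy just this weak requirement, since shortening does not
  always produce the rank of the suffix.\<close>

lemma tot_step:
  assumes r: "ready \<rho>" and l: "\<rho> 20 = l" "l < k" and \<gamma>: "\<gamma> \<in> mers E l" "c \<in> outs (ends \<gamma>)"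
    and I: "\<rho> 21 = iid l (ends \<gamma>)" and c: "\<rho> 23 = urank c"
    and j: "from_left (ends \<gamma>) c \<Longrightarrow> \<rho> 22 = lrank \<gamma>"
    and b: "length (labels (ends \<gamma>)) \<le> 2 ^ b"
  shows "tot w \<mu> step_prog (step_time b) (\<rho>, out) (\<lambda>st. \<exists>\<rho>'. st = (\<rho>', out) \<and> ready \<rho>' \<and>
    agree {21, 22, 24, 25, 26, 27, 28} \<rho> \<rho>' \<and>
    \<rho>' 21 = iid (Suc l) (ends (\<gamma> @ [c])) \<and> \<rho>' 22 = lrank (\<gamma> @ [c]))"
proof -
  let ?I = "ends \<gamma>"
  let ?p = "l * emax + estart l ?I"
  have Ii: "?I \<in> intervals l" using \<gamma> by (auto simp: intervals_def)
  obtain t where t: "t < length (labels ?I)" "labels ?I ! t = c"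
    using \<gamma>(2) labels(2)[of ?I] by (metis in_set_conv_nth)
  have \<gamma>c: "\<gamma> @ [c] \<in> mers E (Suc l)" using snoc_in_mers \<gamma> by blast
  have jM: "lrank (\<gamma> @ [c]) < 2 ^ w" using lrank_le_M[OF \<gamma>c] l(2) le_M_less by simp
  have final: "run w \<mu> step_final (\<rho>3, out) (\<lambda>st. \<exists>\<rho>'. st = (\<rho>', out) \<and> ready \<rho>' \<and>
      agree {21, 22, 24, 25, 26, 27, 28} \<rho> \<rho>' \<and>
      \<rho>' 21 = iid (Suc l) (ends (\<gamma> @ [c])) \<and> \<rho>' 22 = lrank (\<gamma> @ [c]))"
    if r3: "ready \<rho>3" and ag: "agree {24, 25, 26, 27, 28} \<rho> \<rho>3" and p: "\<rho>3 24 = ?p + t" for \<rho>3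
  proof -
    have f: "ev w \<mu> \<rho>3 (arr 16 (Var 24)) = of_bool (from_left ?I c)"
      using ev_entry[OF r3 arrays_nth(17) _ _ l(2) Ii t(1), of "Var 24"] p t(2) by simp
    have s: "ev w \<mu> \<rho>3 (arr 17 (Var 24)) = shift l ?I c"
      using ev_entry[OF r3 arrays_nth(18) _ _ l(2) Ii t(1), of "Var 24"] p t(2) by simp
    note lr = lrank_snoc(1)[OF \<gamma>]
    have r22: "\<rho>3 22 = \<rho> 22" using agreeD[OF ag] by simp
    have m: "ev w \<mu> \<rho>3 (Bin Mul (arr 16 (Var 24)) (Var 22)) = of_bool (from_left ?I c) * lrank \<gamma>"
    proof (cases "from_left ?I c")
      case True
      then show ?thesis using ev_Mul[OF f, of "Var 22" "lrank \<gamma>"] j r22 lr jM by simp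
    next
      \<comment> \<open>Whatever register 22 contains is multiplied by the stored bit 0.\<close>
      case False
      then show ?thesis using ev_Mul[OF f, of "Var 22" "\<rho> 22"] r22 by simp
    qed
    have e1: "ev w \<mu> \<rho>3 (Bin Add (Bin Mul (arr 16 (Var 24)) (Var 22)) (arr 17 (Var 24))) = lrank (\<gamma> @ [c])"
      unfolding lr by (rule ev_Add[OF m s]) (use lr jM in simp)
    let ?r4 = "\<rho>3(22 := lrank (\<gamma> @ [c]))"
    have r4: "ready ?r4" by (rule ready_upd[OF r3]) simp
    have e2: "ev w \<mu> ?r4 (arr 15 (Var 24)) = iid (Suc l) (ends (\<gamma> @ [c]))"
      using ev_entry[OF r4 arrays_nth(16) _ _ l(2) Ii t(1), of "Var 24"] p t(2) by (simp add: ends_snoc)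
    show ?thesis
      unfolding step_final_def
      by (rule run_Seq_asg[OF e1], simp add: vs, simp add: vs, rule run_asg[OF e2], simp add: vs, simp add: vs)
        (use ag in \<open>auto intro!: ready_upd r3 simp: agree_def\<close>)
  qed
  have "tot w \<mu> (Seq search_init (Seq search_test (Seq (While 26 search_body) step_final))) (step_time b) (\<rho>, out)
    (\<lambda>st. \<exists>\<rho>'. st = (\<rho>', out) \<and> ready \<rho>' \<and> agree {21, 22, 24, 25, 26, 27, 28} \<rho> \<rho>' \<and>
    \<rho>' 21 = iid (Suc l) (ends (\<gamma> @ [c])) \<and> \<rho>' 22 = lrank (\<gamma> @ [c]))"
    unfolding step_time_def
  proof (rule tot_Seq[OF run_search_init[OF r l I Ii]])
    fix st assume "\<exists>\<rho>'. st = (\<rho>', out) \<and> ready \<rho>' \<and> agree {24, 25, 27} \<rho> \<rho>' \<and>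
      \<rho>' 24 = ?p \<and> \<rho>' 25 = ?p + length (labels ?I)"
    then obtain \<rho>1 where 1: "st = (\<rho>1, out)" "ready \<rho>1" "agree {24, 25, 27} \<rho> \<rho>1"
      "\<rho>1 24 = ?p" "\<rho>1 25 = ?p + length (labels ?I)" by blast
    have c1: "\<rho>1 23 = urank (labels ?I ! t)" using agreeD[OF 1(3), of 23] c t(2) by simp
    note se = tot_search[OF 1(2) l(2) Ii t(1) c1 b 1(4,5), of out]
    have "tot w \<mu> (Seq (Seq search_test (While 26 search_body)) step_final)
        (tm search_test + (b * (tm search_body + 1) + 1) + tm step_final) (\<rho>1, out)
      (\<lambda>st. \<exists>\<rho>'. st = (\<rho>', out) \<and> ready \<rho>' \<and> agree {21, 22, 24, 25, 26, 27, 28} \<rho> \<rho>' \<and>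
        \<rho>' 21 = iid (Suc l) (ends (\<gamma> @ [c])) \<and> \<rho>' 22 = lrank (\<gamma> @ [c]))"
    proof (rule tot_Seq[OF se])
      fix st assume "\<exists>\<rho>'. st = (\<rho>', out) \<and> ready \<rho>' \<and> agree {24, 25, 26, 27, 28} \<rho>1 \<rho>' \<and> \<rho>' 24 = ?p + t"
      then obtain \<rho>3 where 3: "st = (\<rho>3, out)" "ready \<rho>3" "agree {24, 25, 26, 27, 28} \<rho>1 \<rho>3" "\<rho>3 24 = ?p + t" by blast
      have "agree {24, 25, 26, 27, 28} \<rho> \<rho>3" by (rule agree_mono[OF agree_trans[OF 1(3) 3(3)]]) auto
      then show "run w \<mu> step_final st (\<lambda>st. \<exists>\<rho>'. st = (\<rho>', out) \<and> ready \<rho>' \<and>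
        agree {21, 22, 24, 25, 26, 27, 28} \<rho> \<rho>' \<and>
        \<rho>' 21 = iid (Suc l) (ends (\<gamma> @ [c])) \<and> \<rho>' 22 = lrank (\<gamma> @ [c]))"
        using final 3 by simp
    qed
    from tot_assoc[OF this]
    show "tot w \<mu> (Seq search_test (Seq (While 26 search_body) step_final))
        (tm search_test + (b * (tm search_body + 1) + 1 + tm step_final)) st
      (\<lambda>st. \<exists>\<rho>'. st = (\<rho>', out) \<and> ready \<rho>' \<and> agree {21, 22, 24, 25, 26, 27, 28} \<rho> \<rho>' \<and>
        \<rho>' 21 = iid (Suc l) (ends (\<gamma> @ [c])) \<and> \<rho>' 22 = lrank (\<gamma> @ [c]))"
      unfolding 1(1) by (rule tot_weaken) simp_all
  qed
  then show ?thesis by (simp add: step_prog_def)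
qed

lemma run_shorten:
  assumes r: "ready \<rho>" and \<alpha>: "\<alpha> \<in> mers E k" and N: "\<rho> 0 + 2 < 2 ^ w"
    and q: "\<mu> (\<rho> 0) = vertex_code le (lft (ends \<alpha>))" "\<mu> (\<rho> 0 + 2) = lrank \<alpha>"
  shows "run w \<mu> shorten_prog (\<rho>, out) (\<lambda>st. \<exists>\<rho>'. st = (\<rho>', out) \<and> ready \<rho>' \<and>
    agree shorten_regs \<rho> \<rho>' \<and>
    \<rho>' 20 = k - 1 \<and> \<rho>' 21 = iid (k - 1) (ends (tl \<alpha>)) \<and>
    \<rho>' 22 = ext_rank k (grank \<alpha>) - ext_below k (ends (tl \<alpha>)))"
proof -
  let ?u = "lft (ends \<alpha>)" and ?j = "lrank \<alpha>" and ?g = "grank \<alpha>"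
  let ?F = "ext_rank k (grank \<alpha>)" and ?I = "ends (tl \<alpha>)"
  have u: "?u \<in> ends \<alpha>" by (rule lft_in[OF ends_sub ends_nonempty[OF \<alpha> V_nonempty]])
  then have uV: "?u \<in> V" and ru: "reaches E \<alpha> ?u" by (auto simp: ends_def)
  have g: "card (below k ?u) + ?j = ?g" using grank_eq[OF \<alpha> ru] by (simp add: lrank_def)
  have gn: "?g \<le> n" unfolding grank_def num_mers_def using \<alpha> finite_mers by (intro card_mono) (auto simp: mers_def)
  have w0: "w > 0" using wide(4) by simp
  have vc: "vertex_code le ?u < Suc (card V)" using vertex_code_le[of ?u] by simp
  have vt: "ev w \<mu> \<rho>' (arr a (Var 18)) = f ?u"
    if "ready \<rho>'" "arrays ! a = (bl M, vtab f)" "a < 26" "\<rho>' 18 = vertex_code le ?u" for \<rho>' a f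
    by (rule ev_tab[OF that(1,2,3) _ inj_vertex_code uV vc]) (use that in simp)
  let ?r1 = "\<rho>(18 := vertex_code le ?u)" let ?r2 = "?r1(19 := ?j)" let ?r3 = "?r2(10 := ?g)"
  have r1: "ready ?r1" and r2: "ready ?r2" and r3: "ready ?r3" by (auto intro!: ready_upd r)
  have e1: "ev w \<mu> \<rho> (Cell (Var 0)) = vertex_code le ?u" using q by simp
  have "ev w \<mu> ?r1 (Bin Add (Var 0) (Num 2)) = \<rho> 0 + 2" by (rule ev_Add[OF _ Num_small(3)]) (use N in auto)
  then have e2: "ev w \<mu> ?r1 (Cell (Bin Add (Var 0) (Num 2))) = ?j" using q by (simp only: ev.simps(4))
  have e3: "ev w \<mu> ?r2 (Bin Add (arr 3 (Var 18)) (Var 19)) = ?g"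
    using ev_Add[OF vt[OF r2 arrays_nth(4)], of "Var 19" ?j] g gn n_less by simp
  have rest: "run w \<mu> (Seq (asg 16 (Bin Lt (arr 4 (Var 18)) (Var 19)))
     (Seq (If 16
        (Seq (asg 16 (Bin Lt (arr 5 (Var 18)) (Var 19)))
          (If 16 (asg 21 (arr 7 (Var 18))) (asg 21 (arr 8 (Var 18)))))
        (asg 21 (arr 6 (Var 18))))
     (Seq (asg 22 (Bin Sub (Var 11) (arr 11 (Var 21))))
        (asg 20 (Bin Sub (par 0) (Num 1)))))) (\<rho>4, out) (\<lambda>st. \<exists>\<rho>'. st = (\<rho>', out) \<and> ready \<rho>' \<and>
    agree shorten_regs \<rho> \<rho>' \<and>
    \<rho>' 20 = k - 1 \<and> \<rho>' 21 = iid (k - 1) ?I \<and> \<rho>' 22 = ?F - ext_below k ?I)"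
    if r4: "ready \<rho>4" and ag: "agree {11, 12, 13, 14, 15} ?r3 \<rho>4" and F: "\<rho>4 11 = ?F" for \<rho>4
  proof -
    have v: "\<rho>4 18 = vertex_code le ?u" "\<rho>4 19 = ?j" using agreeD[OF ag] by simp_all
    have ag4: "agree shorten_regs \<rho> \<rho>4" using ag by (auto simp: agree_def)
    have f1: "ev w \<mu> \<rho>4 (Bin Lt (arr 4 (Var 18)) (Var 19)) = of_bool (low_count k ?u < ?j)"
      by (rule ev_Lt[OF vt[OF r4 arrays_nth(5)] _ w0]) (use v in auto)
    let ?r5 = "\<rho>4(16 := of_bool (low_count k ?u < ?j))"
    let ?r6 = "?r5(16 := of_bool (mid_count k ?u < ?j))"
    have r5: "ready ?r5" and r6: "ready ?r6" by (auto intro!: ready_upd r4)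
    have ag6: "agree shorten_regs \<rho> ?r5"
      "agree shorten_regs \<rho> ?r6" using ag4 by (auto intro!: agree_upd)
    have f2: "ev w \<mu> ?r5 (Bin Lt (arr 5 (Var 18)) (Var 19)) = of_bool (mid_count k ?u < ?j)"
      by (rule ev_Lt[OF vt[OF r5 arrays_nth(6)] _ w0]) (use v in auto)
    note tr = tl_by_rank[OF \<alpha> ru, folded lrank_def]
    have t: "tl \<alpha> \<in> mers E (k - 1)" "reaches E (tl \<alpha>) ?u" using mers_tl[OF \<alpha>] reaches_tl[OF ru] by auto
    have Ii: "?I \<in> intervals (k - 1)" using t by (auto simp: intervals_def)
    let ?st = "\<lambda>st. \<exists>\<rho>'. st = (\<rho>', out) \<and> ready \<rho>' \<and>
        agree shorten_regs \<rho> \<rho>' \<and> \<rho>' 21 = iid (k - 1) ?I \<and> \<rho>' 11 = ?F"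
    have choose: "run w \<mu> (asg 21 (arr a (Var 18))) (\<rho>', out) ?st"
      if "ready \<rho>'" "agree shorten_regs \<rho> \<rho>'" "\<rho>' 18 = vertex_code le ?u"
        "\<rho>' 11 = ?F" "arrays ! a = (bl M, vtab f)" "a < 26" "f ?u = iid (k - 1) ?I" for \<rho>' a f
      by (rule run_asg[OF vt[OF that(1,5,6,3)]], simp add: vs, simp add: vs)
        (use that in \<open>auto intro!: ready_upd agree_upd\<close>)
    have cond: "run w \<mu> (If 16
        (Seq (asg 16 (Bin Lt (arr 5 (Var 18)) (Var 19)))
          (If 16 (asg 21 (arr 7 (Var 18))) (asg 21 (arr 8 (Var 18)))))
        (asg 21 (arr 6 (Var 18)))) (?r5, out) ?st"
    proof (rule run_If, simp add: vs)
      assume "?r5 16 \<noteq> 0"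
      then have lo: "tl \<alpha> \<noteq> lowest (k - 1) ?u" using tr(1) by simp
      show "run w \<mu> (Seq (asg 16 (Bin Lt (arr 5 (Var 18)) (Var 19)))
          (If 16 (asg 21 (arr 7 (Var 18))) (asg 21 (arr 8 (Var 18))))) (?r5, out) ?st"
      proof (rule run_Seq_asg[OF f2], simp add: vs, simp add: vs, rule run_If, simp add: vs)
        assume "?r6 16 \<noteq> 0"
        then have hi: "tl \<alpha> = highest (k - 1) ?u" using tr(2) by simp
        show "run w \<mu> (asg 21 (arr 7 (Var 18))) (?r6, out) ?st"
          by (rule choose[OF r6 ag6(2) _ _ arrays_nth(8)]) (use v F hi in auto)
      next
        assume "?r6 16 = 0"
        then have "ends (tl \<alpha>) = {?u}" using tr(2) by (intro ends_middle[OF t uV lo]) simp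
        then show "run w \<mu> (asg 21 (arr 8 (Var 18))) (?r6, out) ?st"
          by (intro choose[OF r6 ag6(2) _ _ arrays_nth(9)]) (use v F in auto)
      qed
    next
      assume "?r5 16 = 0"
      then have "tl \<alpha> = lowest (k - 1) ?u" using tr(1) by simp
      then show "run w \<mu> (asg 21 (arr 6 (Var 18))) (?r5, out) ?st"
        by (intro choose[OF r5 ag6(1) _ _ arrays_nth(7)]) (use v F in auto)
    qed
    have last: "run w \<mu> (Seq (asg 22 (Bin Sub (Var 11) (arr 11 (Var 21)))) (asg 20 (Bin Sub (par 0) (Num 1)))) (\<rho>7, out)
      (\<lambda>st. \<exists>\<rho>'. st = (\<rho>', out) \<and> ready \<rho>' \<and>
        agree shorten_regs \<rho> \<rho>' \<and>
        \<rho>' 20 = k - 1 \<and> \<rho>' 21 = iid (k - 1) ?I \<and> \<rho>' 22 = ?F - ext_below k ?I)"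
      if "ready \<rho>7" "agree shorten_regs \<rho> \<rho>7" "\<rho>7 21 = iid (k - 1) ?I" "\<rho>7 11 = ?F" for \<rho>7
    proof -
      have "iid (k - 1) ?I < dmax" by (rule iid_less'[OF Ii]) simp
      then have x: "ev w \<mu> \<rho>7 (arr 11 (Var 21)) = ext_below k ?I"
        using ev_tab[OF that(1) arrays_nth(12) _ _ _ Ii, of "Var 21"] that(3) iid_bij[of "k - 1"] by (simp add: bij_betw_def)
      have y: "ev w \<mu> \<rho>7 (Bin Sub (Var 11) (arr 11 (Var 21))) = ?F - ext_below k ?I"
        by (rule ev_Sub[OF _ x ext_below_le_rank[OF \<alpha> V_nonempty]])
          (use that le_M_less(1)[OF le_trans[OF ext_rank_le n_le_M]] in auto)
      let ?r8 = "\<rho>7(22 := ?F - ext_below k ?I)"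
      have r8: "ready ?r8" by (rule ready_upd[OF that(1)]) simp
      have z: "ev w \<mu> ?r8 (Bin Sub (par 0) (Num 1)) = k - 1"
        by (rule ev_Sub[OF ev_pars(1)[OF r8] Num_small(2)]) (use k params_less[of 0] in \<open>auto simp: params_nth\<close>)
      show ?thesis
        by (rule run_Seq_asg[OF y], simp add: vs, simp add: vs, rule run_asg[OF z], simp add: vs, simp add: vs)
          (use that in \<open>auto intro!: ready_upd agree_upd\<close>)
    qed
    show ?thesis
      by (rule run_Seq_asg[OF f1], simp add: vs, simp add: vs, rule run_Seq[OF cond]) (use last in blast)
  qed
  show ?thesis
    unfolding shorten_prog_def
    by (rule run_Seq_asg[OF e1], simp add: vs, simp add: vs, rule run_Seq_asg[OF e2], simp add: vs, simp add: vs,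
        rule run_Seq_asg[OF e3], simp add: vs, simp add: vs,
        rule run_Seq[OF run_lookup[OF r3 _ gn, where Q = "\<lambda>st. \<exists>\<rho>4. st = (\<rho>4, out) \<and> ready \<rho>4 \<and>
          agree {11, 12, 13, 14, 15} ?r3 \<rho>4 \<and> \<rho>4 11 = ?F"]], simp, blast)
      (use rest in blast)
qed

lemma run_output:
  assumes r: "ready \<rho>" and \<beta>: "\<beta> \<in> mers E k" "\<rho> 21 = iid k (ends \<beta>)" "\<rho> 22 = lrank \<beta>"
  shows "run w \<mu> output_prog (\<rho>, []) (\<lambda>st. snd st = handle_code le (handle E le \<beta>))"
proof -
  have Ii: "ends \<beta> \<in> intervals k" using \<beta> by (auto simp: intervals_def)
  have i: "inj_on (iid k) (intervals k)" "iid k (ends \<beta>) < dmax" using iid_bij[of k] iid_less'[OF Ii]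
    by (auto simp: bij_betw_def)
  have lo: "ev w \<mu> \<rho> (arr 12 (Var 21)) = vertex_code le (lft (ends \<beta>))"
    and hi: "ev w \<mu> \<rho> (arr 13 (Var 21)) = vertex_code le (rgt (ends \<beta>))"
    using ev_tab[OF r arrays_nth(13) _ _ i(1) Ii i(2), of "Var 21"] ev_tab[OF r arrays_nth(14) _ _ i(1) Ii i(2), of "Var 21"] \<beta>
    by simp_all
  have v: "ev w \<mu> \<rho> (Var 22) = lrank \<beta>" using \<beta> by simp
  show ?thesis
    unfolding output_prog_def
    by (rule run_Seq_emit[OF lo], simp add: vs, rule run_Seq_emit[OF hi], simp add: vs, rule run_emit[OF v], simp add: vs)
      (simp add: handle_eq[OF \<beta>(1) k] handle_code_def)
qed

lemma ev_letter:
  assumes "ready \<rho>" "c \<in> used" "\<mu> a = letter_code \<Sigma> c" "ev w \<mu> \<rho> e = a"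
  shows "ev w \<mu> \<rho> (arr 1 (Cell e)) = urank c"
  by (rule ev_tab[OF assms(1) arrays_nth(2) _ _ inj_letter_code assms(2)])
    (use assms letter_code_le[of c] in auto)

lemma tot_load:
  assumes "\<rho> 1 = w" "\<And>\<rho>'. ready \<rho>' \<Longrightarrow> \<rho>' 0 = \<rho> 0 \<Longrightarrow> tot w \<mu> c t (\<rho>', []) Q"
  shows "tot w \<mu> (Seq load_hw c) (50 + t) (\<rho>, []) Q"
  by (rule tot_Seq[OF tot_load_hw[where \<rho> = \<rho>, OF assms(1), where Q = "\<lambda>st. \<exists>\<rho>'. st = (\<rho>', []) \<and> ready \<rho>' \<and> \<rho>' 0 = \<rho> 0"]])
    (use assms(2) in auto)

lemma length_labels: "length (labels I) \<le> card \<Sigma>"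
  unfolding labels(3) using outs_used[of I] used_sub finite_\<Sigma> by (intro card_mono) auto

lemma lrank_Nil: "lrank [] = 1"
  by (simp add: lrank_def rank_def mers_0 conj_commute cong: conj_cong)

lemma mers_snocD: "\<alpha> @ [c] \<in> mers E (Suc l) \<Longrightarrow> c \<in> used"
  using mers_set[of "\<alpha> @ [c]"] by (auto simp: used_def)

lemma tot_find:
  assumes r: "\<rho> 1 = w" and \<alpha>: "\<alpha> \<in> mers E k" and N: "\<rho> 0 + k < 2 ^ w"
    and q: "\<And>i. i < k \<Longrightarrow> \<mu> (\<rho> 0 + i) = letter_code \<Sigma> (\<alpha> ! i)" and b: "card \<Sigma> \<le> 2 ^ b"
  shows "tot w \<mu> find_prog (find_time k b) (\<rho>, []) (\<lambda>st. snd st = handle_code le (handle E le \<alpha>))"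
  unfolding find_prog_def find_time_def
proof (rule tot_load[where \<rho> = \<rho>, OF r])
  fix \<rho>0 assume r0: "ready \<rho>0" and N0: "\<rho>0 0 = \<rho> 0"
  have w0: "w > 0" using wide(4) by simp
  \<comment> \<open>After \<open>i\<close> letters the registers describe the prefix of length
    \<open>i\<close>; the index of the invariant is the number of letters left.\<close>
  define Inv where "Inv m st \<longleftrightarrow> (\<exists>\<rho>' i. st = (\<rho>', []) \<and> ready \<rho>' \<and> \<rho>' 0 = \<rho> 0 \<and> i \<le> k \<and> m = k - i \<and> \<rho>' 20 = i \<and>
    \<rho>' 21 = iid i (ends (take i \<alpha>)) \<and> \<rho>' 22 = lrank (take i \<alpha>) \<and> \<rho>' 30 = of_bool (i < k))"
    for m :: nat and st :: "(nat \<Rightarrow> nat) \<times> nat list"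
  have lt: "ev w \<mu> \<rho>' (Bin Lt (Var 20) (par 0)) = of_bool (\<rho>' 20 < k)" if "ready \<rho>'" for \<rho>'
    by (rule ev_Lt[OF _ ev_pars(1)[OF that] w0]) simp
  have init: "run w \<mu> find_init (\<rho>0, []) (Inv k)"
  proof -
    let ?r1 = "\<rho>0(20 := 0)" let ?r2 = "?r1(21 := 0)" let ?r3 = "?r2(22 := 1)" let ?r4 = "?r3(30 := 1)"
    have r3: "ready ?r3" and r4: "ready ?r4" by (auto intro!: ready_upd r0)
    have "0 < k" using k by simp
    then have "Inv k (?r4, [])" unfolding Inv_def
      by (intro exI[of _ ?r4] exI[of _ 0]) (use r4 N0 \<open>0 < k\<close> in \<open>simp add: iid_0 lrank_Nil\<close>)
    moreover have "ev w \<mu> ?r3 (Bin Lt (Var 20) (par 0)) = 1" using lt[OF r3] \<open>0 < k\<close> by simp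
    ultimately show ?thesis unfolding find_init_def
      by (intro run_Seq_asg[OF Num_small(1)] run_Seq_asg[OF Num_small(2)] run_asg) (auto simp: vs)
  qed
  have body: "tot w \<mu> (Seq find_load (Seq step_prog find_next)) (tm find_load + (step_time b + tm find_next)) st (Inv (m - 1))"
    and pos: "m > 0" if m: "Inv m st" "fst st 30 \<noteq> 0" for m st
  proof -
    from m obtain \<rho>1 i where 1: "st = (\<rho>1, [])" "ready \<rho>1" "\<rho>1 0 = \<rho> 0" "i < k" "m = k - i" "\<rho>1 20 = i"
      "\<rho>1 21 = iid i (ends (take i \<alpha>))" "\<rho>1 22 = lrank (take i \<alpha>)" unfolding Inv_def by auto
    show "m > 0" using 1 by simp
    let ?\<gamma> = "take i \<alpha>" and ?c = "\<alpha> ! i"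
    have len: "length \<alpha> = k" using \<alpha> by (simp add: mers_def)
    have tk: "take (Suc i) \<alpha> = ?\<gamma> @ [?c]" using 1(4) len by (simp add: take_Suc_conv_app_nth)
    have \<gamma>c: "?\<gamma> @ [?c] \<in> mers E (Suc i)" using mers_take[OF \<alpha>, of "Suc i"] 1(4) tk by simp
    then have \<gamma>: "?\<gamma> \<in> mers E i" "?c \<in> outs (ends ?\<gamma>)" using snoc_in_mers by blast+
    have cu: "?c \<in> used" using mers_snocD[OF \<gamma>c] .
    have a: "ev w \<mu> \<rho>1 (Bin Add (Var 0) (Var 20)) = \<rho> 0 + i" by (rule ev_Add) (use 1 N in auto)
    have e1: "ev w \<mu> \<rho>1 (arr 1 (Cell (Bin Add (Var 0) (Var 20)))) = urank ?c"
      by (rule ev_letter[OF 1(2) cu q[OF 1(4)] a])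
    let ?r2 = "\<rho>1(23 := urank ?c)"
    have r2: "ready ?r2" by (rule ready_upd[OF 1(2)]) simp
    have load: "run w \<mu> find_load st (\<lambda>st. st = (?r2, []))"
      unfolding find_load_def 1(1) by (rule run_asg[OF e1]) (auto simp: vs)
    have stp: "tot w \<mu> step_prog (step_time b) (?r2, []) (\<lambda>st. \<exists>\<rho>'. st = (\<rho>', []) \<and> ready \<rho>' \<and>
        agree {21, 22, 24, 25, 26, 27, 28} ?r2 \<rho>' \<and>
        \<rho>' 21 = iid (Suc i) (ends (?\<gamma> @ [?c])) \<and> \<rho>' 22 = lrank (?\<gamma> @ [?c]))"
      by (rule tot_step[OF r2 _ 1(4) \<gamma>]) (use 1 le_trans[OF length_labels b] in auto)
    have next': "run w \<mu> find_next st' (Inv (m - 1))" if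
      "\<exists>\<rho>'. st' = (\<rho>', []) \<and> ready \<rho>' \<and> agree {21, 22, 24, 25, 26, 27, 28} ?r2 \<rho>' \<and>
        \<rho>' 21 = iid (Suc i) (ends (?\<gamma> @ [?c])) \<and> \<rho>' 22 = lrank (?\<gamma> @ [?c])" for st'
    proof -
      from that obtain \<rho>3 where 3: "st' = (\<rho>3, [])" "ready \<rho>3" "agree {21, 22, 24, 25, 26, 27, 28} ?r2 \<rho>3"
        "\<rho>3 21 = iid (Suc i) (ends (?\<gamma> @ [?c]))" "\<rho>3 22 = lrank (?\<gamma> @ [?c])" by blast
      have v: "\<rho>3 20 = i" "\<rho>3 0 = \<rho> 0" using agreeD[OF 3(3)] 1 by simp_all
      have e1: "ev w \<mu> \<rho>3 (Bin Add (Var 20) (Num 1)) = Suc i"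
        using ev_Add[OF _ Num_small(2), of \<rho>3 "Var 20" i] v N 1(4) by simp
      let ?r4 = "\<rho>3(20 := Suc i)" let ?r5 = "?r4(30 := of_bool (Suc i < k))"
      have r4: "ready ?r4" and r5: "ready ?r5" by (auto intro!: ready_upd 3)
      have e2: "ev w \<mu> ?r4 (Bin Lt (Var 20) (par 0)) = of_bool (Suc i < k)" using lt[OF r4] by simp
      have "Inv (m - 1) (?r5, [])" unfolding Inv_def
        by (intro exI[of _ ?r5] exI[of _ "Suc i"]) (use r5 v 3 1 tk in simp)
      then show ?thesis unfolding find_next_def 3(1)
        by (intro run_Seq_asg[OF e1] run_asg[OF e2]) (auto simp: vs)
    qed
    show "tot w \<mu> (Seq find_load (Seq step_prog find_next)) (tm find_load + (step_time b + tm find_next)) st (Inv (m - 1))"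
      by (rule tot_Seq[OF load]) (use tot_Seq[OF stp next'] in simp)
  qed
  have loop: "tot w \<mu> (While 30 (Seq find_load (Seq step_prog find_next)))
      (k * (tm find_load + (step_time b + tm find_next) + 1) + 1) st
      (\<lambda>st. \<exists>\<rho>'. st = (\<rho>', []) \<and> ready \<rho>' \<and> \<rho>' 21 = iid k (ends \<alpha>) \<and> \<rho>' 22 = lrank \<alpha>)" if "Inv k st" for st
  proof (rule tot_While[where I = Inv, OF _ that])
    show "(30::nat) < nvars" by (simp add: nvars_def)
    fix m st assume "Inv m st" "fst st 30 = 0"
    then show "\<exists>\<rho>'. st = (\<rho>', []) \<and> ready \<rho>' \<and> \<rho>' 21 = iid k (ends \<alpha>) \<and> \<rho>' 22 = lrank \<alpha>"
      using \<alpha> unfolding Inv_def by (auto simp: mers_def)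
  qed (use body pos in auto)
  show "tot w \<mu> (Seq find_init (Seq (While 30 (Seq find_load (Seq step_prog find_next))) output_prog))
      (tm find_init + (k * (tm find_load + (step_time b + tm find_next) + 1) + 1 + tm output_prog)) (\<rho>0, [])
      (\<lambda>st. snd st = handle_code le (handle E le \<alpha>))"
    by (rule tot_Seq[OF init], rule tot_Seq[OF loop]) (use run_output \<alpha> in auto)
qed

lemma tot_enum:
  assumes r: "\<rho> 1 = w" and \<alpha>: "\<alpha> \<in> mers E k" and N: "\<rho> 0 + 2 < 2 ^ w"
    and q: "\<mu> (\<rho> 0) = vertex_code le (lft (ends \<alpha>))" "\<mu> (\<rho> 0 + 2) = lrank \<alpha>"
  defines "cs \<equiv> labels (ends (tl \<alpha>))"
  shows "tot w \<mu> enum_prog (enum_time (length cs)) (\<rho>, []) (\<lambda>st. snd st = map (letter_code \<Sigma>) cs)"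
  unfolding enum_prog_def enum_time_def
proof (rule tot_load[where \<rho> = \<rho>, OF r], rule tot_Seq, rule run_shorten[OF _ \<alpha>])
  fix \<rho>0 assume r0: "ready \<rho>0" and N0: "\<rho>0 0 = \<rho> 0"
  then show "ready \<rho>0" "\<rho>0 0 + 2 < 2 ^ w" "\<mu> (\<rho>0 0) = vertex_code le (lft (ends \<alpha>))" "\<mu> (\<rho>0 0 + 2) = lrank \<alpha>"
    using N q by auto
  fix st :: "(nat \<Rightarrow> nat) \<times> nat list"
  assume "\<exists>\<rho>'. st = (\<rho>', []) \<and> ready \<rho>' \<and> agree shorten_regs \<rho>0 \<rho>' \<and>
    \<rho>' 20 = k - 1 \<and> \<rho>' 21 = iid (k - 1) (ends (tl \<alpha>)) \<and> \<rho>' 22 = ext_rank k (grank \<alpha>) - ext_below k (ends (tl \<alpha>))"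
  then obtain \<rho>1 where 1: "st = (\<rho>1, [])" "ready \<rho>1" "\<rho>1 20 = k - 1" "\<rho>1 21 = iid (k - 1) (ends (tl \<alpha>))" by blast
  let ?I = "ends (tl \<alpha>)" let ?p = "(k - 1) * emax + estart (k - 1) ?I"
  have Ii: "?I \<in> intervals (k - 1)" using mers_tl[OF \<alpha>] by (auto simp: intervals_def)
  have l: "k - 1 < k" using k by simp
  have w0: "w > 0" using wide(4) by simp
  note eb = entry_bound[OF l Ii]
  define Inv where "Inv m st \<longleftrightarrow> (\<exists>\<rho>' t. st = (\<rho>', map (letter_code \<Sigma>) (take t cs)) \<and> ready \<rho>' \<and> t \<le> length cs \<and>
    m = length cs - t \<and> \<rho>' 24 = ?p + t \<and> \<rho>' 25 = ?p + length cs \<and> \<rho>' 26 = of_bool (t < length cs))"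
    for m :: nat and st :: "(nat \<Rightarrow> nat) \<times> nat list"
  have lt: "ev w \<mu> \<rho>' (Bin Lt (Var 24) (Var 25)) = of_bool (t < length cs)"
    if "\<rho>' 24 = ?p + t" "\<rho>' 25 = ?p + length cs" for \<rho>' t
    using ev_Lt[OF _ _ w0, of \<mu> \<rho>' "Var 24" "?p + t" "Var 25" "?p + length cs"] that by simp
  have body: "m > 0 \<and> run w \<mu> enum_body st (Inv (m - 1))" if m: "Inv m st" "fst st 26 \<noteq> 0" for m st
  proof -
    from m obtain \<rho>2 t where 2: "st = (\<rho>2, map (letter_code \<Sigma>) (take t cs))" "ready \<rho>2" "t < length cs"
      "m = length cs - t" "\<rho>2 24 = ?p + t" "\<rho>2 25 = ?p + length cs" unfolding Inv_def by auto
    have t: "t < length (labels ?I)" using 2(3) by (simp add: cs_def)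
    have cu: "cs ! t \<in> used" using nth_mem[OF 2(3)] labels(2)[of ?I] outs_used[of ?I] by (auto simp: cs_def)
    have x: "ev w \<mu> \<rho>2 (arr 14 (Var 24)) = urank (cs ! t)"
      using ev_entry[OF 2(2) arrays_nth(15) _ _ l Ii t, of "Var 24"] 2(5) by (simp add: cs_def)
    have y: "ev w \<mu> \<rho>2 (arr 2 (arr 14 (Var 24))) = letter_code \<Sigma> (cs ! t)"
      by (rule ev_tab[OF 2(2) arrays_nth(3) _ x inj_urank cu urank_less[OF cu]]) simp
    have z: "ev w \<mu> \<rho>2 (Bin Add (Var 24) (Num 1)) = ?p + Suc t"
      using ev_Add[OF _ Num_small(2), of \<rho>2 "Var 24" "?p + t"] 2(5) eb t by simp
    let ?r3 = "\<rho>2(24 := ?p + Suc t)" let ?r4 = "?r3(26 := of_bool (Suc t < length cs))"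
    have r4: "ready ?r4" by (auto intro!: ready_upd 2)
    have u: "ev w \<mu> ?r3 (Bin Lt (Var 24) (Var 25)) = of_bool (Suc t < length cs)" by (rule lt) (use 2 in auto)
    have "Inv (m - 1) (?r4, map (letter_code \<Sigma>) (take (Suc t) cs))" unfolding Inv_def
      by (intro exI[of _ ?r4] exI[of _ "Suc t"]) (use r4 2 in simp)
    then have "Inv (m - 1) (?r4, map (letter_code \<Sigma>) (take t cs) @ [letter_code \<Sigma> (cs ! t)])"
      using 2(3) by (simp add: take_Suc_conv_app_nth)
    then have "run w \<mu> enum_body st (Inv (m - 1))" unfolding enum_body_def 2(1)
      by (intro run_Seq_emit[OF y] run_Seq_asg[OF z] run_asg[OF u]) (auto simp: vs)
    then show ?thesis using 2 by simp
  qed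
  have loop: "tot w \<mu> (While 26 enum_body) (length cs * (tm enum_body + 1) + 1) st
      (\<lambda>st. snd st = map (letter_code \<Sigma>) cs)" if "Inv (length cs) st" for st
  proof (rule tot_While[where I = Inv, OF _ that])
    show "(26::nat) < nvars" by (simp add: nvars_def)
    fix m st assume "Inv m st" "fst st 26 = 0"
    then show "snd st = map (letter_code \<Sigma>) cs" unfolding Inv_def by auto
  qed (use body in auto)
  have test: "run w \<mu> (asg 26 (Bin Lt (Var 24) (Var 25))) st' (Inv (length cs))"
    if "\<exists>\<rho>'. st' = (\<rho>', []) \<and> ready \<rho>' \<and> agree {24, 25, 27} \<rho>1 \<rho>' \<and> \<rho>' 24 = ?p \<and> \<rho>' 25 = ?p + length (labels ?I)" for st'
  proof -
    from that obtain \<rho>2 where 2: "st' = (\<rho>2, [])" "ready \<rho>2" "\<rho>2 24 = ?p" "\<rho>2 25 = ?p + length cs"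
      unfolding cs_def by blast
    let ?r3 = "\<rho>2(26 := of_bool (0 < length cs))"
    have "ready ?r3" by (auto intro!: ready_upd 2)
    then have "Inv (length cs) (?r3, [])" unfolding Inv_def
      by (intro exI[of _ ?r3] exI[of _ 0]) (use 2 in simp)
    then show ?thesis unfolding 2(1) using lt[of \<rho>2 0] 2 by (intro run_asg) (auto simp: vs)
  qed
  show "tot w \<mu> (Seq search_init (Seq (asg 26 (Bin Lt (Var 24) (Var 25))) (While 26 enum_body)))
      (tm search_init + (tm (asg 26 (Bin Lt (Var 24) (Var 25))) + (length cs * (tm enum_body + 1) + 1))) st
      (\<lambda>st. snd st = map (letter_code \<Sigma>) cs)"
    unfolding 1(1)
    by (rule tot_Seq[OF run_search_init[OF 1(2,3) l 1(4) Ii]], rule tot_Seq[OF test], assumption, rule loop)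
qed

lemma tot_forward:
  assumes r: "\<rho> 1 = w" and \<alpha>: "\<alpha> \<in> mers E k" and N: "\<rho> 0 + 3 < 2 ^ w"
    and q: "\<mu> (\<rho> 0) = vertex_code le (lft (ends \<alpha>))" "\<mu> (\<rho> 0 + 2) = lrank \<alpha>" "\<mu> (\<rho> 0 + 3) = letter_code \<Sigma> c"
    and \<beta>: "tl \<alpha> @ [c] \<in> mers E k" and b: "card \<Sigma> \<le> 2 ^ b"
  shows "tot w \<mu> forward_prog (forward_time b) (\<rho>, []) (\<lambda>st. snd st = handle_code le (handle E le (tl \<alpha> @ [c])))"
  unfolding forward_prog_def forward_time_def
proof (rule tot_load[where \<rho> = \<rho>, OF r], rule tot_Seq, rule run_shorten[OF _ \<alpha>])
  fix \<rho>0 assume r0: "ready \<rho>0" and N0: "\<rho>0 0 = \<rho> 0"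
  then show "ready \<rho>0" "\<rho>0 0 + 2 < 2 ^ w" "\<mu> (\<rho>0 0) = vertex_code le (lft (ends \<alpha>))" "\<mu> (\<rho>0 0 + 2) = lrank \<alpha>"
    using N q by auto
  let ?\<gamma> = "tl \<alpha>" let ?I = "ends ?\<gamma>"
  fix st :: "(nat \<Rightarrow> nat) \<times> nat list"
  assume "\<exists>\<rho>'. st = (\<rho>', []) \<and> ready \<rho>' \<and> agree shorten_regs \<rho>0 \<rho>' \<and>
    \<rho>' 20 = k - 1 \<and> \<rho>' 21 = iid (k - 1) ?I \<and> \<rho>' 22 = ext_rank k (grank \<alpha>) - ext_below k ?I"
  then obtain \<rho>1 where 1: "st = (\<rho>1, [])" "ready \<rho>1" "agree shorten_regs \<rho>0 \<rho>1"
    "\<rho>1 20 = k - 1" "\<rho>1 21 = iid (k - 1) ?I" "\<rho>1 22 = ext_rank k (grank \<alpha>) - ext_below k ?I" by blast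
  have Sk: "Suc (k - 1) = k" and l: "k - 1 < k" using k by auto
  have \<gamma>: "?\<gamma> \<in> mers E (k - 1)" "c \<in> outs ?I" using \<beta> snoc_in_mers[of ?\<gamma> c "k - 1"] unfolding Sk by auto
  have cu: "c \<in> used" using \<gamma>(2) outs_used by blast
  have v0: "\<rho>1 0 = \<rho> 0" using agreeD[OF 1(3), of 0] N0 by simp
  have a: "ev w \<mu> \<rho>1 (Bin Add (Var 0) (Num 3)) = \<rho> 0 + 3"
    by (rule ev_Add[OF _ Num_small(4)]) (use v0 N in auto)
  have e1: "ev w \<mu> \<rho>1 (arr 1 (Cell (Bin Add (Var 0) (Num 3)))) = urank c" by (rule ev_letter[OF 1(2) cu q(3) a])
  let ?r2 = "\<rho>1(23 := urank c)"
  have r2: "ready ?r2" by (rule ready_upd[OF 1(2)]) simp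
  have load: "run w \<mu> forward_load st (\<lambda>st. st = (?r2, []))"
    unfolding forward_load_def 1(1) by (rule run_asg[OF e1]) (auto simp: vs)
  have j: "from_left ?I c \<Longrightarrow> ?r2 22 = lrank ?\<gamma>" using lrank_tl[OF \<alpha> k \<gamma>(2)] 1(6) by simp
  have stp: "tot w \<mu> step_prog (step_time b) (?r2, []) (\<lambda>st. \<exists>\<rho>'. st = (\<rho>', []) \<and> ready \<rho>' \<and>
      agree {21, 22, 24, 25, 26, 27, 28} ?r2 \<rho>' \<and>
      \<rho>' 21 = iid (Suc (k - 1)) (ends (?\<gamma> @ [c])) \<and> \<rho>' 22 = lrank (?\<gamma> @ [c]))"
    by (rule tot_step[OF r2 _ l \<gamma> _ _ j]) (use 1 le_trans[OF length_labels b] in auto)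
  show "tot w \<mu> (Seq forward_load (Seq step_prog output_prog))
      (tm forward_load + (step_time b + tm output_prog)) st
      (\<lambda>st. snd st = handle_code le (handle E le (?\<gamma> @ [c])))"
  proof (rule tot_Seq[OF load])
    fix st' :: "(nat \<Rightarrow> nat) \<times> nat list" assume "st' = (?r2, [])"
    then show "tot w \<mu> (Seq step_prog output_prog) (step_time b + tm output_prog) st'
      (\<lambda>st. snd st = handle_code le (handle E le (?\<gamma> @ [c])))"
      using tot_Seq[OF stp, of output_prog "tm output_prog"] run_output[OF _ \<beta>] unfolding Sk by blast
  qed
qed

end

section \<open>Bounds\<close>

lemma lg_ge_1: "lg x \<ge> 1"
  by (auto simp: lg_def le_log_iff)

text \<open>The factor 2 absorbs the rounding: a number above 2 has at most one digit more than its
  logarithm, which itself is at least 1.\<close>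

lemma bl_le_lg: "real (bl x) \<le> 2 * lg x"
proof (cases "x \<le> 2")
  case True
  then have "x < 2 ^ 2" by simp
  then have "bl x \<le> 2" by (rule bl_le)
  then show ?thesis using lg_ge_1[of x] by simp
next
  case False
  define b where "b = nat \<lfloor>log 2 (real x)\<rfloor> + 1"
  have l1: "log 2 (real x) \<ge> 1" using False by (simp add: le_log_iff)
  have "log 2 (real x) < real b" using l1 unfolding b_def by linarith
  then have "real x < 2 powr real b" using False by (simp add: log_less_iff)
  then have "real x < 2 ^ b" by (simp add: powr_realpow)
  then have "x < 2 ^ b" by (metis of_nat_less_iff of_nat_numeral of_nat_power)
  then have "bl x \<le> b" by (rule bl_le)
  moreover have "real b \<le> log 2 (real x) + 1" using l1 unfolding b_def by linarith
  ultimately have "real (bl x) \<le> log 2 (real x) + 1" by linarith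
  also have "\<dots> \<le> 2 * log 2 (real x)" using l1 by linarith
  finally show ?thesis using False by (simp add: lg_def)
qed

lemma lg_le_self: "x \<ge> 1 \<Longrightarrow> lg x \<le> real x"
proof (cases "x \<le> 2")
  case False
  have "real x < 2 ^ x" by (metis less_exp of_nat_less_iff of_nat_numeral of_nat_power)
  then have "real x < 2 powr real x" by (simp add: powr_realpow)
  then have "log 2 (real x) < real x" using False by (simp add: log_less_iff)
  then show ?thesis using False by (simp add: lg_def)
qed (auto simp: lg_def)

text \<open>
  A table with at most \<^term>\<open>y\<close> entries below \<^term>\<open>N\<close> is affordable even though \<^term>\<open>log 2 (real N)\<close> may exceed
  \<^term>\<open>log 2 (real y)\<close> by far: either \<open>N \<le> y\<^sup>2\<close>, or the table has fewer than \<open>\<surd>N\<close> entries.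
\<close>

lemma dictionary_bound:
  assumes "x \<le> N" "x \<le> y" "y \<ge> 1" "N \<ge> 1"
  shows "real x * real (bl N) \<le> 8 * real N * lg y"
proof (cases "N \<le> y\<^sup>2")
  case True
  have "lg N \<le> 2 * lg y"
  proof (cases "N \<le> 2")
    case False
    then have "y \<ge> 2" using True assms(3) by (cases "y = 1") auto
    have "log 2 (real N) \<le> log 2 (real (y\<^sup>2))"
      using True assms False by (intro log_mono) (auto simp flip: of_nat_power)
    also have "\<dots> = 2 * log 2 (real y)" using assms by (simp add: log_nat_power)
    also have "\<dots> \<le> 2 * lg y" using \<open>y \<ge> 2\<close> by (auto simp: lg_def)
    finally show ?thesis using False by (simp add: lg_def)
  qed (use lg_ge_1[of y] in \<open>simp add: lg_def\<close>)
  then have "real (bl N) \<le> 4 * lg y" using bl_le_lg[of N] by linarith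
  then have "real x * real (bl N) \<le> real N * (4 * lg y)" using assms by (intro mult_mono) auto
  also have "\<dots> \<le> 8 * real N * lg y" using lg_ge_1[of y] by simp
  finally show ?thesis .
next
  case False
  then have "real y ^ 2 \<le> real N" by (simp flip: of_nat_power)
  then have y: "real y \<le> sqrt (real N)" by (rule real_le_rsqrt)
  have s1: "sqrt (real N) \<ge> 1" using assms(4) by simp
  have "lg N \<le> 4 * sqrt (real N)"
  proof (cases "N \<le> 2")
    case c: False
    have N: "real N = sqrt (real N) ^ 2" by simp
    have "log 2 (real N) = 2 * log 2 (sqrt (real N))" by (subst N, subst log_nat_power) (use c in auto)
    also have "log 2 (sqrt (real N)) \<le> 2 * sqrt (real N)"
    proof -
      define q where "q = nat \<lceil>sqrt (real N)\<rceil>"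
      have "sqrt (real N) \<le> real q" unfolding q_def by linarith
      also have "real q < 2 ^ q" by (metis less_exp of_nat_less_iff of_nat_numeral of_nat_power)
      finally have "sqrt (real N) < 2 powr real q" by (simp add: powr_realpow)
      then have "log 2 (sqrt (real N)) < real q" using s1 by (simp add: log_less_iff)
      also have "real q \<le> sqrt (real N) + 1" using s1 unfolding q_def by linarith
      finally show ?thesis using s1 by linarith
    qed
    finally show ?thesis using c by (simp add: lg_def)
  next
    case True
    then have "lg N = 1" by (simp add: lg_def)
    then show ?thesis using s1 by linarith
  qed
  then have "real (bl N) \<le> 8 * sqrt (real N)" using bl_le_lg[of N] by linarith
  moreover have "real x \<le> sqrt (real N)" using y assms(2) by linarith
  ultimately have "real x * real (bl N) \<le> sqrt (real N) * (8 * sqrt (real N))" by (intro mult_mono) auto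
  also have "\<dots> = 8 * real N" by simp
  also have "\<dots> \<le> 8 * real N * lg y" using lg_ge_1[of y] by (simp add: mult_le_cancel_left1)
  finally show ?thesis .
qed

text \<open>Allows the record width to be split into a part for positions and vertex codes and a
  part for \<open>M\<close>, each charged to the space bound in its own way.\<close>

lemma bl_add_le: "a \<ge> 1 \<Longrightarrow> b \<ge> 1 \<Longrightarrow> bl (a + b) \<le> bl a + bl b"
proof (rule bl_le)
  assume "a \<ge> 1" "b \<ge> 1"
  have "a + 1 \<le> 2 ^ bl a" "b + 1 \<le> 2 ^ bl b" using less_bl[of a] less_bl[of b] by linarith+
  then have "(a + 1) * (b + 1) \<le> 2 ^ bl a * 2 ^ bl b" by (intro mult_mono) auto
  moreover have "a + b < (a + 1) * (b + 1)" by simp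
  ultimately show "a + b < 2 ^ (bl a + bl b)" unfolding power_add by linarith
qed

text \<open>The excess of the quadratic expression over \<open>2 ^ (s - 1)\<close> is greatest at
  \<open>s = 7\<close>, where it is 104; 110 is rounded up from this. From 9 on the doubling of the
  power outweighs the quadratic growth.\<close>

lemma small_exponent: "3 * s\<^sup>2 + 3 * s \<le> 110 + (2::nat) ^ (s - 1)"
proof (cases "s < 9")
  case True
  then have "s \<in> {0, 1, 2, 3, 4, 5, 6, 7, 8}" by auto
  then show ?thesis by (auto simp: power2_eq_square)
next
  case False
  then have "s \<ge> 9" by simp
  then show ?thesis
  proof (induction s rule: nat_induct_at_least)
    case (Suc s)
    then obtain r where "s = Suc r" by (cases s) auto
    then have p: "(2::nat) ^ (Suc s - 1) = 2 * 2 ^ (s - 1)" by simp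
    have "9 * 9 \<le> s * s" "9 * s \<le> s * s" using Suc(1) by (intro mult_mono; simp)+
    moreover have "3 * (Suc s)\<^sup>2 + 3 * Suc s = 3 * (s * s) + 9 * s + 6" by (simp add: power2_eq_square)
    ultimately show ?case using Suc(2) unfolding p power2_eq_square[of s] by linarith
  qed simp
qed

lemma time_bounds:
  obtains c where "\<And>l b. l \<ge> 1 \<Longrightarrow> find_time l b \<le> c * (l * (b + 1))"
    "\<And>l. enum_time l \<le> c * (l + 1)" "\<And>b. forward_time b \<le> c * (b + 1)"
proof -
  have st: "step_time b \<le> step_time 1 * (b + 1)" for b by (simp add: step_time_def algebra_simps)
  let ?c1 = "50 + tm find_init + (tm find_load + step_time 1 + tm find_next + 2) + tm output_prog"
  have 1: "find_time l b \<le> ?c1 * (l * (b + 1))" if "l \<ge> 1" for l b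
  proof -
    have lb: "1 \<le> l * (b + 1)" using that by simp
    let ?x = "50 + tm find_init + 1 + tm output_prog" and ?y = "tm find_load + tm find_next + 1"
    have "find_time l b = ?x + l * (?y + step_time b)" by (simp add: find_time_def algebra_simps)
    also have "\<dots> \<le> ?x * (l * (b + 1)) + l * ((?y + step_time 1) * (b + 1))"
    proof (rule add_mono)
      show "?x \<le> ?x * (l * (b + 1))" using lb by (metis mult.right_neutral mult_le_mono2)
      have "?y + step_time b \<le> ?y * (b + 1) + step_time 1 * (b + 1)" using st[of b] by (intro add_mono) auto
      then show "l * (?y + step_time b) \<le> l * ((?y + step_time 1) * (b + 1))"
        by (intro mult_left_mono) (simp_all add: algebra_simps)
    qed
    also have "\<dots> = ?c1 * (l * (b + 1))" by (simp add: algebra_simps)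
    finally show ?thesis .
  qed
  have 2: "enum_time l \<le> enum_time 1 * (l + 1)" for l by (simp add: enum_time_def algebra_simps)
  let ?c3 = "50 + tm shorten_prog + tm forward_load + tm output_prog + step_time 1"
  have 3: "forward_time b \<le> ?c3 * (b + 1)" for b
    using st[of b] by (simp add: forward_time_def algebra_simps)
  let ?c = "?c1 + enum_time 1 + ?c3"
  have m: "x * y \<le> ?c * y" if "x \<le> ?c" for x y :: nat using that by (rule mult_le_mono1)
  show ?thesis
  proof (rule that[of ?c])
    show "find_time l b \<le> ?c * (l * (b + 1))" if "l \<ge> 1" for l b
      using 1[OF that, of b] m[of ?c1 "l * (b + 1)"] by linarith
    show "enum_time l \<le> ?c * (l + 1)" for l using 2[of l] m[of "enum_time 1" "l + 1"] by linarith
    show "forward_time b \<le> ?c * (b + 1)" for b using 3[of b] m[of ?c3 "b + 1"] by linarith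
  qed
qed

section \<open>Space of the data structure and a sufficient word size\<close>

context dbg
begin

definition budget :: real where
  "budget = real n + real (card V + card E) * real k * lg M + real (card \<Sigma>) * lg (card E)"

text \<open>The word size is assumed to exceed a multiple of its logarithm. Its fourth power bounds
  the space, so addresses fit into a word.\<close>

definition total :: nat where
  "total = M + card V + card E + card \<Sigma> + k"

lemma card_pos: "card V \<ge> 1" "card E \<ge> 1" "card \<Sigma> \<ge> 1" "card used \<ge> 1"
proof -
  show "card V \<ge> 1" "card E \<ge> 1" using V_nonempty E_nonempty finite_V finite_E by (simp_all add: Suc_le_eq card_gt_0_iff)
  have "used \<noteq> {}" using E_nonempty by (auto simp: used_def)
  then show "card used \<ge> 1" "card \<Sigma> \<ge> 1" using used_sub finite_used finite_\<Sigma> by (auto simp: Suc_le_eq card_gt_0_iff)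
qed

lemma R_eq: "R = 3 * sparam\<^sup>2"
  by (simp add: R_def power2_eq_square)

text \<open>Up to the factor \<open>2 ^ 110\<close> from \<open>small_exponent\<close>, the number
  of table bits is at most \<open>2 ^ (2 ^ (sparam - 1))\<close>, and this is at most
  \<open>n\<close> by minimality of \<open>sparam\<close>. For \<open>sparam = 1\<close> the table
  has constant size.\<close>

lemma table_size: "2 ^ R * R \<le> 2 ^ 110 * n"
proof -
  have "R \<le> 2 ^ (3 * sparam)" using three_square_le[of sparam] by (simp add: R_eq)
  then have "2 ^ R * R \<le> 2 ^ R * 2 ^ (3 * sparam)" by simp
  also have "\<dots> = 2 ^ (3 * sparam\<^sup>2 + 3 * sparam)" by (simp add: R_eq power_add)
  finally have X: "2 ^ R * R \<le> 2 ^ (3 * sparam\<^sup>2 + 3 * sparam)" .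
  show ?thesis
  proof (cases "sparam = 1")
    case True
    have "2 ^ R * R \<le> 2 ^ 6" using X True by simp
    also have "\<dots> \<le> (2 ^ 110 * n :: nat)" using n_pos by simp
    finally show ?thesis .
  next
    case False
    have "(2::nat) ^ (3 * sparam\<^sup>2 + 3 * sparam) \<le> 2 ^ (110 + 2 ^ (sparam - 1))"
      by (rule power_increasing[OF small_exponent]) simp
    also have "\<dots> = 2 ^ 110 * 2 ^ (2 ^ (sparam - 1))" by (rule power_add)
    also have "\<dots> \<le> 2 ^ 110 * n" using sparam(3) False by (intro mult_left_mono) auto
    finally show ?thesis using X by linarith
  qed
qed

lemma sizes_le: "L \<le> 2 ^ R * R" "K \<le> 2 ^ R * R" "sparam \<le> 2 ^ R * R" "R \<le> 2 ^ R * R"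
proof -
  have sR: "sparam \<le> R" using sparam(1) by (simp add: R_def)
  have "L \<le> 2 ^ R" unfolding L_def using sR by (intro power_increasing) auto
  then have "sparam * L \<le> R * 2 ^ R" using sR by (intro mult_mono) auto
  then show K: "K \<le> 2 ^ R * R" by (simp add: K_def mult.commute)
  have "L \<le> K" using L_pos by (simp add: K_def)
  then show "L \<le> 2 ^ R * R" using K by simp
  have "1 * R \<le> 2 ^ R * R" by (rule mult_right_mono) auto
  then show "R \<le> 2 ^ R * R" "sparam \<le> 2 ^ R * R" using sR by linarith+
qed

lemma sum_params: "sum_list params \<le> k + 3 * card V + 3 * card E + 7 * (2 ^ R * R)"
proof -
  have "dmax \<le> 3 * card V" by (simp add: dmax_def)
  moreover have "sum_list params = k + dmax + emax + K + L + sparam + 3 * sparam + R" by (simp add: params_def)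
  ultimately show ?thesis using sizes_le unfolding emax_def by linarith
qed

text \<open>Each explicit list occupies the growth of \<open>P\<close> that justified it. So a pool
  is as long as the last value of \<open>P\<close>, at most \<open>2 * n\<close> plus the size of
  one block or subblock.\<close>

lemma mono_map_size:
  "L * length vals_A + length vals_sp1 + length pool1 + 3 * sparam * length vals_Rel + length vals_sp2 +
   length pool2 + length unary + 3 * sparam * length vals_Tab \<le> 14 * n + 10 * (2 ^ R * R)"
proof -
  have "L * (n div K) \<le> K * (n div K)" using L_pos by (intro mult_right_mono) (auto simp: K_def)
  also have "\<dots> \<le> n" by simp
  finally have A: "L * length vals_A \<le> n + L" by (simp add: lengths)
  have d: "n div K \<le> n" "n div sparam \<le> n" by simp_all
  have p1: "length pool1 \<le> 2 * n + K"
    using bounded[of "Suc (n div K) * K"] by (simp add: pool1(1) P_def) (use div_times_less_eq_dividend[of n K] in linarith)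
  have p2: "length pool2 \<le> 2 * n + sparam"
    using bounded[of "Suc (n div sparam) * sparam"]
    by (simp add: pool2(1) P_def) (use div_times_less_eq_dividend[of n sparam] in linarith)
  have R: "3 * sparam * length vals_Rel \<le> 3 * n + 3 * sparam"
    using div_times_less_eq_dividend[of n sparam] by (simp add: lengths algebra_simps)
  have T: "3 * sparam * length vals_Tab = 2 ^ R * R" by (simp add: lengths R_def)
  show ?thesis
    unfolding T using A p1 p2 R d sizes_le n_pos lengths(2,4,5) by linarith
qed

lemma length_body_arrays: "length (body arrays) =
    bl (sum_list params) * 8 + bl (card E) * Suc (card \<Sigma>) + bl (card \<Sigma>) * card used + 6 * (bl M * Suc (card V)) +
    2 * (rwidth * (k * dmax)) + 3 * (rwidth * dmax) + 4 * (bl M * (k * emax)) +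
    (L * length vals_A + length vals_sp1 + length pool1 + 3 * sparam * length vals_Rel + length vals_sp2 +
     length pool2 + length unary + 3 * sparam * length vals_Tab)"
  by (simp add: length_body arrays_def length_entries) (simp add: params_def)

lemma budget_ge: "real n \<le> budget" "real (card V + card E) * real k * lg M \<le> budget"
  "real (card \<Sigma>) * lg (card E) \<le> budget" "real (k + 3 * card V + 3 * card E) \<le> 4 * budget" "1 \<le> budget"
proof -
  have l: "lg M \<ge> 1" "lg (card E) \<ge> 1" by (rule lg_ge_1)+
  have a: "0 \<le> real (card V + card E) * real k * lg M" "0 \<le> real (card \<Sigma>) * lg (card E)" using l by auto
  show 1: "real n \<le> budget" and 2: "real (card V + card E) * real k * lg M \<le> budget"
    and "real (card \<Sigma>) * lg (card E) \<le> budget"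
    using a by (auto simp: budget_def)
  show "1 \<le> budget" using 1 n_pos by linarith
  have "real (card V + card E) * real k * 1 \<le> real (card V + card E) * real k * lg M"
    using l by (intro mult_left_mono) auto
  moreover have "real (card V + card E) * 1 \<le> real (card V + card E) * real k" using k by (intro mult_left_mono) auto
  moreover have "1 * real k \<le> real (card V + card E) * real k" using card_pos by (intro mult_right_mono) auto
  ultimately show "real (k + 3 * card V + 3 * card E) \<le> 4 * budget" using 2 by simp
qed

lemma body_le: "real (length (body arrays)) \<le> 2 ^ 120 * budget"
proof -
  let ?T = budget and ?X = "(2::real) ^ 110"
  have X: "real (2 ^ R * R) \<le> ?X * ?T"
  proof -
    have "real (2 ^ R * R) \<le> real (2 ^ 110 * n)" using table_size by (simp only: of_nat_le_iff)
    also have "\<dots> = ?X * real n" by simp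
    also have "\<dots> \<le> ?X * ?T" using budget_ge(1) by (intro mult_left_mono) auto
    finally show ?thesis .
  qed
  have lM: "lg M \<ge> 1" and lE: "lg (card E) \<ge> 1" by (rule lg_ge_1)+
  let ?Y = "real (card V + card E) * lg M"
  have Yk: "?Y * real k \<le> ?T" using budget_ge(2) by (simp add: mult_ac)
  have k1: "1 \<le> real k" using k by simp
  have Y0: "0 \<le> ?Y" using lM by simp
  have "?Y * 1 \<le> ?Y * real k" by (rule mult_left_mono[OF k1 Y0])
  then have Y: "?Y \<le> ?T" using Yk by linarith
  \<comment> \<open>There are only eight parameters, so even estimating a bit length by the number
    itself is affordable.\<close>
  have p: "real (bl (sum_list params) * 8) \<le> (4 + 7 * ?X) * ?T * 8"
  proof -
    define z where "z = 2 ^ R * R"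
    have "bl (sum_list params) \<le> (k + 3 * card V + 3 * card E) + 7 * z"
      using bl_le_self[of "sum_list params"] sum_params unfolding z_def by linarith
    then have "real (bl (sum_list params)) \<le> real ((k + 3 * card V + 3 * card E) + 7 * z)" by (simp only: of_nat_le_iff)
    also have "\<dots> = real (k + 3 * card V + 3 * card E) + 7 * real (2 ^ R * R)"
      unfolding z_def[symmetric] by simp
    also have "\<dots> \<le> 4 * ?T + 7 * (?X * ?T)" using budget_ge(4) X by linarith
    also have "\<dots> = (4 + 7 * ?X) * ?T" by (simp add: algebra_simps)
    finally show ?thesis by simp
  qed
  have a1: "real (bl (card E) * Suc (card \<Sigma>)) \<le> 4 * ?T"
  proof -
    have "real (bl (card E)) * real (Suc (card \<Sigma>)) \<le> (2 * lg (card E)) * (2 * real (card \<Sigma>))"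
      using bl_le_lg[of "card E"] card_pos lE by (intro mult_mono) auto
    also have "\<dots> = 4 * (real (card \<Sigma>) * lg (card E))" by simp
    finally show ?thesis using budget_ge(3) unfolding of_nat_mult by linarith
  qed
  \<comment> \<open>At most \<open>card E\<close> letters are used while their codes range up to
    \<open>card \<Sigma>\<close>; \<open>dictionary_bound\<close> covers such a table.\<close>
  have a2: "real (bl (card \<Sigma>) * card used) \<le> 8 * ?T"
  proof -
    have "card used \<le> card \<Sigma>" using used_sub finite_\<Sigma> by (rule card_mono[rotated])
    from dictionary_bound[OF this card_used_E] card_pos
    have "real (card used) * real (bl (card \<Sigma>)) \<le> 8 * real (card \<Sigma>) * lg (card E)" by simp
    then show ?thesis using budget_ge(3) by (simp add: mult_ac)
  qed
  have a3: "real (6 * (bl M * Suc (card V))) \<le> 24 * ?T"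
  proof -
    have "real (bl M) * real (Suc (card V)) \<le> (2 * lg M) * (2 * real (card V + card E))"
      using bl_le_lg[of M] card_pos lM by (intro mult_mono) auto
    also have "\<dots> = 4 * ?Y" by simp
    finally show ?thesis using Y unfolding of_nat_mult of_nat_numeral by linarith
  qed
  \<comment> \<open>For positions and vertex codes \<open>dictionary_bound\<close> is applied with
    \<open>dmax \<le> M\<close>; for the part of width \<open>bl M\<close> the inequality
    \<open>dmax \<le> 3 * card V\<close> is the right one.\<close>
  have rd: "real (rwidth * dmax) \<le> 30 * ?Y"
  proof -
    let ?N = "3 * card E + 3 * card V"
    have dm: "dmax \<le> ?N" "dmax \<le> M" "dmax \<le> 3 * card V" by (auto simp: dmax_def)
    have "rwidth \<le> bl (?N + M)" by (rule bl_mono) simp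
    also have "\<dots> \<le> bl ?N + bl M" by (rule bl_add_le) (use card_pos M_pos in auto)
    finally have "rwidth * dmax \<le> dmax * bl ?N + dmax * bl M"
      by (metis add_mult_distrib mult.commute mult_le_mono1)
    then have "real (rwidth * dmax) \<le> real dmax * real (bl ?N) + real dmax * real (bl M)"
      by (metis of_nat_add of_nat_le_iff of_nat_mult)
    also have "real dmax * real (bl ?N) \<le> 8 * real ?N * lg M"
      by (rule dictionary_bound[OF dm(1,2) M_pos]) (use card_pos in simp)
    also have "real dmax * real (bl M) \<le> (3 * real (card V + card E)) * (2 * lg M)"
      using dm(3) bl_le_lg[of M] by (intro mult_mono) auto
    finally show ?thesis by (simp add: algebra_simps)
  qed
  have rdk: "real (rwidth * (k * dmax)) \<le> 30 * ?T"
  proof -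
    have "real (rwidth * (k * dmax)) = real (rwidth * dmax) * real k" by simp
    also have "\<dots> \<le> 30 * ?Y * real k" using rd by (intro mult_right_mono) auto
    finally show ?thesis using Yk by simp
  qed
  have a4: "real (2 * (rwidth * (k * dmax)) + 3 * (rwidth * dmax)) \<le> 150 * ?T"
    using rdk rd Y by simp
  have a5: "real (4 * (bl M * (k * emax))) \<le> 24 * ?T"
  proof -
    have "real (bl M) * (3 * real (card E) * real k) \<le> (2 * lg M) * (3 * real (card V + card E) * real k)"
      using bl_le_lg[of M] lM by (intro mult_mono mult_right_mono) auto
    also have "\<dots> = 6 * (?Y * real k)" by simp
    finally have "real (bl M) * (3 * real (card E) * real k) \<le> 6 * ?T" using Yk by linarith
    moreover have "real (4 * (bl M * (k * emax))) = 4 * (real (bl M) * (3 * real (card E) * real k))"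
      by (simp add: emax_def)
    ultimately show ?thesis by linarith
  qed
  have a6: "real (L * length vals_A + length vals_sp1 + length pool1 + 3 * sparam * length vals_Rel + length vals_sp2 +
     length pool2 + length unary + 3 * sparam * length vals_Tab) \<le> 14 * ?T + 10 * (?X * ?T)" (is "real ?m \<le> _")
  proof -
    define z where "z = 2 ^ R * R"
    have "real ?m \<le> real (14 * n + 10 * z)" using mono_map_size unfolding z_def by (simp only: of_nat_le_iff)
    also have "\<dots> = 14 * real n + 10 * real (2 ^ R * R)" unfolding z_def[symmetric] by simp
    finally show ?thesis using X budget_ge(1) by linarith
  qed
  have "real (length (body arrays)) \<le>
      (4 + 7 * ?X) * ?T * 8 + 4 * ?T + 8 * ?T + 24 * ?T + 150 * ?T + 24 * ?T + (14 * ?T + 10 * (?X * ?T))"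
    unfolding length_body_arrays of_nat_add using p a1 a2 a3 a4 a5 a6 unfolding of_nat_add by linarith
  also have "\<dots> = (256 + 66 * ?X) * ?T" by (simp add: algebra_simps)
  also have "\<dots> \<le> 2 ^ 120 * ?T" using budget_ge(5) by (intro mult_right_mono) auto
  finally show ?thesis .
qed

text \<open>An array with at least one entry is no shorter, in bits, than its width. This bounds the
  widths recorded in the header by the length of the body.\<close>

lemma arrays_nonempty: "\<forall>a\<in>set arrays. length (snd a) \<ge> 1"
proof -
  have "dmax \<ge> 1" "emax \<ge> 1" using card_pos M_pos by (auto simp: dmax_def emax_def)
  then have d: "dmax \<ge> 1" "k * dmax \<ge> 1" "k * emax \<ge> 1" using k by auto
  have P: "P g \<ge> g" for g by (simp add: P_def)
  have p: "length pool1 \<ge> 1" "length pool2 \<ge> 1"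
    using P[of "Suc (n div K) * K"] P[of "Suc (n div sparam) * sparam"] L_pos by (simp_all add: pool1(1) pool2(1))
  have t: "length vals_Tab \<ge> 1" "length unary \<ge> 1" using L_pos n_pos by (simp_all add: lengths Suc_le_eq)
  have pa: "length params \<ge> 1" by (simp add: params_def)
  have "list_all (\<lambda>a. length (snd a) \<ge> 1) arrays"
    unfolding arrays_def list.pred_inject snd_conv length_tab length_map length_entries lengths(1-4)
    using d p t pa card_pos by simp
  then show ?thesis by (simp add: list_all_iff)
qed

lemma sum_widths: "sum_list (map fst arrays) \<le> length (body arrays)"
  unfolding length_body
proof (rule sum_list_mono)
  fix a assume "a \<in> set arrays"
  then have "length (snd a) \<ge> 1" using arrays_nonempty by blast
  then show "fst a \<le> (case a of (b, xs) \<Rightarrow> b * length xs)" by (cases a) simp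
qed

lemma encode_le: "real (length (encode arrays)) \<le> 2 ^ 127 * budget"
proof -
  \<comment> \<open>There are 54 fields of the header width, namely two of the prefix and two for
    each of the 26 arrays. The width is at most twice the body length, and the body itself gives the
    remaining 1 of the 109.\<close>
  have "length (encode arrays) \<le> 1 + 109 * length (body arrays)"
    using sum_widths bl_le_self[of "length (body arrays) + sum_list (map fst arrays)"]
    unfolding length_encode length_arrays hwidth_def num_arrays_def by simp
  then have "real (length (encode arrays)) \<le> 1 + 109 * real (length (body arrays))" by linarith
  also have "\<dots> \<le> 1 * budget + 109 * (2 ^ 120 * budget)" using body_le budget_ge(5) by linarith
  also have "\<dots> = (1 + 109 * 2 ^ 120) * budget" by (simp add: algebra_simps)
  also have "\<dots> \<le> 2 ^ 127 * budget" using budget_ge(5) by (intro mult_right_mono) auto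
  finally show ?thesis .
qed

lemma total_ge: "5 \<le> total" "M \<le> total" "card V \<le> total" "card E \<le> total" "card \<Sigma> \<le> total" "k \<le> total"
  "card V + card E \<le> total" "n \<le> total"
  using card_pos M_pos k n_le_M unfolding total_def by linarith+

lemma total_le_power: "total \<le> total ^ 4"
  using total_ge(1) self_le_power[of total 4] by simp

lemma budget_le: "budget \<le> real total ^ 4"
proof -
  let ?S = "real total"
  have S: "5 \<le> ?S" using total_ge(1) by simp
  have lM: "lg M \<le> ?S" using lg_le_self[OF M_pos] total_ge(2) by linarith
  have lE: "lg (card E) \<le> ?S" using lg_le_self[OF card_pos(2)] total_ge(4) by linarith
  have "real (card V + card E) * real k * lg M \<le> ?S * ?S * ?S"
    using total_ge(6,7) lM lg_ge_1[of M] by (intro mult_mono) auto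
  moreover have "real (card \<Sigma>) * lg (card E) \<le> ?S * ?S"
    using total_ge(5) lE lg_ge_1[of "card E"] by (intro mult_mono) auto
  moreover have "real n \<le> ?S" using total_ge(8) by simp
  ultimately have b: "budget \<le> ?S + ?S * ?S * ?S + ?S * ?S" unfolding budget_def by linarith
  have "?S * 1 \<le> ?S * ?S" using S by (intro mult_left_mono) auto
  moreover have "?S * ?S * 1 \<le> ?S * ?S * ?S" using S by (intro mult_left_mono) auto
  moreover have "?S * ?S * ?S * 3 \<le> ?S * ?S * ?S * ?S" using S by (intro mult_left_mono) auto
  ultimately show ?thesis using b by (simp add: eval_nat_numeral)
qed

text \<open>A quarter of the word accommodates the space bound. The factor 4 leaves room for two
  fields of the header width in the first word and for \<open>2 * L\<close>, which is shown to be
  below the word size as well.\<close>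

lemma word_size:
  assumes "real w \<ge> 2 ^ 140 * lg total"
  obtains q where "4 * q \<le> w" "2 ^ 130 * total ^ 4 \<le> 2 ^ q"
proof -
  have S: "total > 2" using total_ge(1) by simp
  then have lg: "lg total = log 2 (real total)" by (simp add: lg_def)
  have l1: "1 \<le> log 2 (real total)" using lg_ge_1[of total] lg by simp
  define q where "q = w div 4"
  have "real w \<le> 4 * real q + 3" unfolding q_def by linarith
  moreover have "2 ^ 140 * log 2 (real total) \<le> real w" using assms lg by simp
  \<comment> \<open>540 is four times 135, and 135 logarithms cover
    \<open>130 + 4 * log 2 (real total)\<close> because the logarithm is at least 1. The 3
    compensates for rounding in \<open>w div 4\<close>.\<close>
  moreover have "540 * log 2 (real total) + 3 \<le> 2 ^ 140 * log 2 (real total)" using l1 by simp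
  ultimately have "135 * log 2 (real total) \<le> real q" by linarith
  then have q: "130 + 4 * log 2 (real total) \<le> real q" using l1 by linarith
  have "real (2 ^ 130 * total ^ 4) = 2 powr (130 + 4 * log 2 (real total))"
  proof -
    have "2 powr (4 * log 2 (real total)) = (2 powr log 2 (real total)) ^ 4"
      by (subst powr_power) (simp_all add: mult.commute)
    also have "\<dots> = real total ^ 4" using S by simp
    finally show ?thesis by (simp add: powr_add powr_numeral)
  qed
  also have "\<dots> \<le> 2 powr real q" using q by (intro powr_mono) auto
  also have "\<dots> = real (2 ^ q)" by (simp add: powr_realpow)
  finally have "2 ^ 130 * total ^ 4 \<le> 2 ^ q" by (simp only: of_nat_le_iff)
  then show ?thesis using that[of q] unfolding q_def by simp
qed

end

section \<open>Answers from the initial state of the machine\<close>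

lemma initial_regs: "regs (initial w D xs) 1 = w" "num_words w D < 2 ^ w \<Longrightarrow> regs (initial w D xs) 0 = num_words w D"
  by (simp_all add: initial_def Let_def take_bit_nat_eq_self less_exp)

lemma initial_query: "i < length xs \<Longrightarrow> xs ! i < 2 ^ w \<Longrightarrow> mem (initial w D xs) (num_words w D + i) = xs ! i"
  by (simp add: initial_def Let_def take_bit_nat_eq_self)

lemma num_words_le: "w > 0 \<Longrightarrow> num_words w D \<le> length D"
proof (cases "num_words w D")
  case (Suc i)
  assume "w > 0"
  then have "i * w < length D" using less_num_words[of w i D] Suc by simp
  moreover have "i \<le> i * w" using \<open>w > 0\<close> by simp
  ultimately show ?thesis using Suc by linarith
qed simp

lemma represents_initial: "represents w (mem (initial w D xs)) (initial w D xs) (regs (initial w D xs), [])"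
proof -
  have "packed_word w D i < 2 ^ w" for i using field_less[of D "i * w" w] by (simp add: field_def packed_word_def)
  then show ?thesis by (auto simp: represents_def initial_def Let_def)
qed

lemma tot_answers:
  assumes "tot w (mem (initial w D xs)) p t (regs (initial w D xs), []) (\<lambda>st. snd st = ys)"
  shows "\<exists>t'\<le>t. answers w p D xs ys t'"
proof -
  obtain t' s' st' where "exec w p (initial w D xs) t' s'" "t' \<le> t" "represents w (mem (initial w D xs)) s' st'" "snd st' = ys"
    using assms represents_initial unfolding tot_def by blast
  then show ?thesis unfolding answers_def represents_def by auto
qed

context dbg
begin

lemma fits:
  assumes "real w \<ge> 2 ^ 140 * lg total"
  shows "length (encode arrays) + total + 3 < 2 ^ w"
    and "store w (mem (initial w (encode arrays) xs)) arrays"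
proof -
  obtain q where q: "4 * q \<le> w" "2 ^ 130 * total ^ 4 \<le> 2 ^ q" using word_size[OF assms] .
  let ?z = "total ^ 4"
  have z: "5 \<le> ?z" "total \<le> ?z" using total_ge(1) total_le_power by linarith+
  have e: "length (encode arrays) \<le> 2 ^ 127 * ?z"
  proof -
    have "real (length (encode arrays)) \<le> 2 ^ 127 * real total ^ 4"
      using encode_le budget_le by (rule order_trans[OF _ mult_left_mono]) auto
    then have "real (length (encode arrays)) \<le> real (2 ^ 127 * ?z)" by simp
    then show ?thesis by (simp only: of_nat_le_iff)
  qed
  have "0 < ?z" using z by linarith
  then have big: "2 * (2 ^ 127 * ?z) + total + total + 7 * ?z + 3 < 2 ^ q" using q(2) z by simp
  have q8: "q > 8"
  proof (rule ccontr)
    assume "\<not> q > 8"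
    then have "(2::nat) ^ q \<le> 2 ^ 8" by (intro power_increasing) auto
    then show False using big \<open>0 < ?z\<close> by simp
  qed
  have qw: "(2::nat) ^ q \<le> 2 ^ w" using q(1) by (intro power_increasing) auto
  show enc: "length (encode arrays) + total + 3 < 2 ^ w" using e big qw by linarith
  have b: "length (body arrays) \<le> length (encode arrays)" by (simp add: length_encode)
  have hw: "hwidth arrays \<le> q" unfolding hwidth_def by (rule bl_le) (use b e big sum_widths in linarith)
  \<comment> \<open>By the choice of \<open>sparam\<close>, half of \<open>L\<close> is at most the
    logarithm of \<open>n\<close> and hence below \<open>q\<close>, unless \<open>L\<close> is
    2.\<close>
  have Lw: "2 * L < w"
  proof (cases "sparam = 1")
    case True
    then have "L = 2" unfolding L_def by simp
    then show ?thesis using q8 q(1) by linarith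
  next
    case False
    then have n: "2 ^ (2 ^ (sparam - 1)) \<le> n" using sparam(3) by blast
    have "n < 2 ^ q" using total_ge(8) big by linarith
    then have "(2::nat) ^ (2 ^ (sparam - 1)) < 2 ^ q" using n by linarith
    then have h: "2 ^ (sparam - 1) < q" by simp
    have "2 * 2 ^ (sparam - 1) = L" using sparam(1) by (simp add: L_def flip: power_Suc)
    then show ?thesis using h q(1) by linarith
  qed
  have s3: "3 * sparam \<le> 2 * L"
  proof -
    have "3 * s \<le> 2 * (2::nat) ^ s" for s
    proof (induction s)
      case (Suc s)
      have "1 \<le> (2::nat) ^ s" by simp
      then show ?case using Suc by (cases "s = 0") auto
    qed simp
    then show ?thesis by (simp add: L_def)
  qed
  have w: "L < w" "3 * sparam < w" "1 < w" "8 < w" using Lw s3 q8 q(1) by linarith+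
  have bq: "bl x < w" if "x < 2 ^ q" for x
    using bl_le[OF that] q(1) q8 by linarith
  have "n \<le> ?z" "k \<le> ?z" "card V + card E \<le> ?z" using total_ge z(2) by linarith+
  moreover have "2 ^ 110 * n \<le> 2 ^ 110 * ?z" using calculation(1) by (rule mult_left_mono) simp
  moreover have "7 * (2 ^ 110 * ?z) \<le> 2 ^ 127 * ?z" by simp
  ultimately have pa: "sum_list params < 2 ^ q" using sum_params table_size big by linarith
  have "list_all (\<lambda>a. fst a < w) arrays"
    unfolding arrays_def list.pred_inject fst_conv
    by (intro conjI TrueI list.pred_inject(1) w bq pa) (use total_ge big z in \<open>auto simp: total_def\<close>)
  then have wide: "\<forall>a\<in>set arrays. fst a < w" by (simp add: list_all_iff)
  show "store w (mem (initial w (encode arrays) xs)) arrays"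
  proof
    show "length arrays = num_arrays" by (rule length_arrays)
    show "length (encode arrays) + 1 < 2 ^ w" using enc by simp
    show "2 * hwidth arrays + 1 < w" using hw q(1) q8 by linarith
    show "\<forall>a\<in>set arrays. fst a < w" by (rule wide)
    show "8 < w" by (rule w)
    show "\<forall>a\<in>set arrays. \<forall>x\<in>set (snd a). x < 2 ^ fst a" by (rule arrays_small)
    show "\<forall>i<num_words w (encode arrays). mem (initial w (encode arrays) xs) i = packed_word w (encode arrays) i"
      by (simp add: initial_def Let_def)
  qed
qed

lemma machine: "real w \<ge> 2 ^ 140 * lg total \<Longrightarrow> machine V \<Sigma> E le k w (mem (initial w (encode arrays) xs))"
  by (intro machine.intro machine_axioms.intro dbg_axioms fits(2))

lemma address:
  assumes "real w \<ge> 2 ^ 140 * lg total"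
  shows "regs (initial w (encode arrays) xs) 0 = num_words w (encode arrays)"
    "num_words w (encode arrays) + k < 2 ^ w" "num_words w (encode arrays) + 3 < 2 ^ w" "total < 2 ^ w"
proof -
  have "0 < 2 ^ 140 * lg total" using lg_ge_1[of total] by simp
  then have "w > 0" using assms by (cases w) auto
  then have "num_words w (encode arrays) + total + 3 < 2 ^ w"
    using num_words_le[of w "encode arrays"] fits(1)[OF assms] by linarith
  then show "num_words w (encode arrays) + k < 2 ^ w" "num_words w (encode arrays) + 3 < 2 ^ w" "total < 2 ^ w"
    and "regs (initial w (encode arrays) xs) 0 = num_words w (encode arrays)"
    using total_ge(6) by (auto intro: initial_regs(2))
qed

lemma codes_less:
  assumes "real w \<ge> 2 ^ 140 * lg total"
  shows "letter_code \<Sigma> c < 2 ^ w" "vertex_code le v < 2 ^ w" "\<alpha> \<in> mers E k \<Longrightarrow> lrank \<alpha> < 2 ^ w"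
proof -
  note t = address(4)[OF assms]
  show "letter_code \<Sigma> c < 2 ^ w" using letter_code_le[of c] total_ge(5) t by linarith
  show "vertex_code le v < 2 ^ w" using vertex_code_le[of v] total_ge(3) t by linarith
  assume "\<alpha> \<in> mers E k"
  then have "lrank \<alpha> \<le> M"
    unfolding lrank_def rank_def by (intro card_mers_sub[of _ k]) (auto simp: mers_def)
  then show "lrank \<alpha> < 2 ^ w" using total_ge(2) t by linarith
qed

lemma find_answers:
  assumes w: "real w \<ge> 2 ^ 140 * lg total" and \<alpha>: "\<alpha> \<in> mers E k" and b: "card \<Sigma> \<le> 2 ^ b"
  shows "\<exists>t\<le>find_time k b. answers w find_prog (encode arrays) (map (letter_code \<Sigma>) \<alpha>) (handle_code le (handle E le \<alpha>)) t"
proof -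
  let ?xs = "map (letter_code \<Sigma>) \<alpha>"
  have len: "length \<alpha> = k" using \<alpha> by (simp add: mers_def)
  have q: "mem (initial w (encode arrays) ?xs) (regs (initial w (encode arrays) ?xs) 0 + i) = letter_code \<Sigma> (\<alpha> ! i)"
    if "i < k" for i
    unfolding address(1)[OF w] using initial_query[of i ?xs w "encode arrays"] that len codes_less(1)[OF w] by simp
  have N: "regs (initial w (encode arrays) ?xs) 0 + k < 2 ^ w" unfolding address(1)[OF w] by (rule address(2)[OF w])
  show ?thesis by (rule tot_answers) (rule machine.tot_find[OF machine[OF w] initial_regs(1) \<alpha> N q b])
qed

lemma enum_answers:
  assumes w: "real w \<ge> 2 ^ 140 * lg total" and \<alpha>: "\<alpha> \<in> mers E k"
  defines "cs \<equiv> labels (ends (tl \<alpha>))"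
  shows "\<exists>t\<le>enum_time (length cs). answers w enum_prog (encode arrays) (handle_code le (handle E le \<alpha>)) (map (letter_code \<Sigma>) cs) t"
proof -
  let ?xs = "[vertex_code le (lft (ends \<alpha>)), vertex_code le (rgt (ends \<alpha>)), lrank \<alpha>]"
  have h: "handle_code le (handle E le \<alpha>) = ?xs" by (simp add: handle_eq[OF \<alpha> k] handle_code_def)
  note A = address(1)[OF w, of ?xs]
  have q: "mem (initial w (encode arrays) ?xs) (regs (initial w (encode arrays) ?xs) 0) = vertex_code le (lft (ends \<alpha>))"
    "mem (initial w (encode arrays) ?xs) (regs (initial w (encode arrays) ?xs) 0 + 2) = lrank \<alpha>"
    unfolding A using initial_query[of 0 ?xs w "encode arrays"] initial_query[of 2 ?xs w "encode arrays"] codes_less[OF w] \<alpha>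
    by simp_all
  have N: "regs (initial w (encode arrays) ?xs) 0 + 2 < 2 ^ w" unfolding A using address(3)[OF w] by linarith
  show ?thesis unfolding h cs_def
    by (rule tot_answers) (rule machine.tot_enum[OF machine[OF w] initial_regs(1) \<alpha> N q])
qed

lemma forward_answers:
  assumes w: "real w \<ge> 2 ^ 140 * lg total" and \<alpha>: "\<alpha> \<in> mers E k" and \<beta>: "tl \<alpha> @ [c] \<in> mers E k" and b: "card \<Sigma> \<le> 2 ^ b"
  shows "\<exists>t\<le>forward_time b. answers w forward_prog (encode arrays) (handle_code le (handle E le \<alpha>) @ [letter_code \<Sigma> c])
    (handle_code le (handle E le (tl \<alpha> @ [c]))) t"
proof -
  let ?xs = "[vertex_code le (lft (ends \<alpha>)), vertex_code le (rgt (ends \<alpha>)), lrank \<alpha>, letter_code \<Sigma> c]"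
  have h: "handle_code le (handle E le \<alpha>) @ [letter_code \<Sigma> c] = ?xs" by (simp add: handle_eq[OF \<alpha> k] handle_code_def)
  note A = address(1)[OF w, of ?xs]
  have q: "mem (initial w (encode arrays) ?xs) (regs (initial w (encode arrays) ?xs) 0) = vertex_code le (lft (ends \<alpha>))"
    "mem (initial w (encode arrays) ?xs) (regs (initial w (encode arrays) ?xs) 0 + 2) = lrank \<alpha>"
    "mem (initial w (encode arrays) ?xs) (regs (initial w (encode arrays) ?xs) 0 + 3) = letter_code \<Sigma> c"
    unfolding A using initial_query[of 0 ?xs w "encode arrays"] initial_query[of 2 ?xs w "encode arrays"]
      initial_query[of 3 ?xs w "encode arrays"] codes_less[OF w] \<alpha>
    by simp_all
  have N: "regs (initial w (encode arrays) ?xs) 0 + 3 < 2 ^ w" unfolding A by (rule address(3)[OF w])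
  show ?thesis unfolding h
    by (rule tot_answers) (rule machine.tot_forward[OF machine[OF w] initial_regs(1) \<alpha> N q \<beta> b])
qed

end

theorem theorem12:
  shows "\<exists>(find :: com) (enum :: com) (forward :: com) (C :: real). C > 0 \<and>
    (\<forall>(V :: 'v set) (\<Sigma> :: 'a::linorder set) (E :: ('v \<times> 'v \<times> 'a) set) (le :: ('v \<times> 'v) set)
        (k :: nat) (w :: nat).
      labeled_graph V \<Sigma> E \<and> deterministic E \<and> wheeler_order V E le \<and> k \<ge> 1 \<and>
      real w \<ge> C * lg (max_mers E k + card V + card E + card \<Sigma> + k) \<longrightarrow>
      (\<exists>D :: bool list.
        real (length D) \<le>
          C * (real (num_mers E k)
               + real (card V + card E) * real k * lg (max_mers E k)
               + real (card \<Sigma>) * lg (card E)) \<and>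
        (\<forall>\<alpha> \<in> mers E k. \<exists>t.
          answers w find D (map (letter_code \<Sigma>) \<alpha>) (handle_code le (handle E le \<alpha>)) t \<and>
          real t \<le> C * (real k * lg (card \<Sigma>))) \<and>
        (\<forall>\<alpha> \<in> mers E k. \<exists>cs t.
          distinct cs \<and> set cs = out_labels E k \<alpha> \<and>
          answers w enum D (handle_code le (handle E le \<alpha>)) (map (letter_code \<Sigma>) cs) t \<and>
          real t \<le> C * (real (length cs + 1) * lg (card \<Sigma>))) \<and>
        (\<forall>(\<alpha>, \<beta>, c) \<in> dbg_edges E k. \<exists>t.
          answers w forward D (handle_code le (handle E le \<alpha>) @ [letter_code \<Sigma> c])
            (handle_code le (handle E le \<beta>)) t \<and>
          real t \<le> C * lg (card \<Sigma>))))"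
proof -
  obtain c where c: "\<And>l b. l \<ge> 1 \<Longrightarrow> find_time l b \<le> c * (l * (b + 1))"
    "\<And>l. enum_time l \<le> c * (l + 1)" "\<And>b. forward_time b \<le> c * (b + 1)" by (rule time_bounds) blast
  \<comment> \<open>The power of two covers the word size and the space; the other summand covers
    the times, the 3 stemming from
    \<open>bl (card \<Sigma>) + 1 \<le> 3 * lg (card \<Sigma>)\<close>.\<close>
  define C :: real where "C = 2 ^ 140 + 3 * real c"
  have C: "2 ^ 140 \<le> C" "3 * real c \<le> C" "C > 0" by (auto simp: C_def intro: add_pos_nonneg)
  show ?thesis
  proof (rule exI[of _ find_prog], rule exI[of _ enum_prog], rule exI[of _ forward_prog], rule exI[of _ C],
      intro conjI C(3) allI impI)
    fix V :: "'v set" and \<Sigma> :: "'a set" and E :: "('v \<times> 'v \<times> 'a) set" and le :: "('v \<times> 'v) set" and k w :: nat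
    assume A: "labeled_graph V \<Sigma> E \<and> deterministic E \<and> wheeler_order V E le \<and> k \<ge> 1 \<and>
      real w \<ge> C * lg (max_mers E k + card V + card E + card \<Sigma> + k)"
    let ?T = "real (num_mers E k) + real (card V + card E) * real k * lg (max_mers E k) + real (card \<Sigma>) * lg (card E)"
    let ?l = "lg (card \<Sigma>)"
    show "\<exists>D :: bool list. real (length D) \<le> C * ?T \<and>
        (\<forall>\<alpha> \<in> mers E k. \<exists>t.
          answers w find_prog D (map (letter_code \<Sigma>) \<alpha>) (handle_code le (handle E le \<alpha>)) t \<and>
          real t \<le> C * (real k * ?l)) \<and>
        (\<forall>\<alpha> \<in> mers E k. \<exists>cs t.
          distinct cs \<and> set cs = out_labels E k \<alpha> \<and>
          answers w enum_prog D (handle_code le (handle E le \<alpha>)) (map (letter_code \<Sigma>) cs) t \<and>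
          real t \<le> C * (real (length cs + 1) * ?l)) \<and>
        (\<forall>(\<alpha>, \<beta>, c) \<in> dbg_edges E k. \<exists>t.
          answers w forward_prog D (handle_code le (handle E le \<alpha>) @ [letter_code \<Sigma> c])
            (handle_code le (handle E le \<beta>)) t \<and>
          real t \<le> C * ?l)"
    proof (cases "mers E k = {}")
      \<comment> \<open>Without \<open>k\<close>-mers there are no queries, and the empty bit string
        satisfies the space bound because that bound is nonnegative.\<close>
      case True
      have "0 \<le> lg x" for x using lg_ge_1[of x] by simp
      then have "0 \<le> C * ?T" using C(3) by simp
      then show ?thesis using True by (intro exI[of _ "[]"]) (auto simp: dbg_edges_def)
    next
      case False
      interpret dbg V \<Sigma> E le k using A False by unfold_locales auto
      have lg1: "1 \<le> ?l" by (rule lg_ge_1)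
      have "2 ^ 140 * lg total \<le> C * lg total" using C(1) lg_ge_1[of total] by (intro mult_right_mono) auto
      then have w: "2 ^ 140 * lg total \<le> real w" using A by (auto simp: total_def)
      let ?b = "bl (card \<Sigma>)"
      have b: "card \<Sigma> \<le> 2 ^ ?b" using less_bl[of "card \<Sigma>"] by simp
      have b3: "real (?b + 1) \<le> 3 * ?l" using bl_le_lg[of "card \<Sigma>"] lg1 by simp
      have cb: "real c * (x * real (?b + 1)) \<le> C * (x * ?l)" if "x \<ge> 0" for x :: real
      proof -
        have "real c * (x * real (?b + 1)) \<le> real c * (x * (3 * ?l))" using b3 that by (intro mult_left_mono) auto
        also have "\<dots> = (3 * real c) * (x * ?l)" by simp
        also have "\<dots> \<le> C * (x * ?l)" using C(2) that lg1 by (intro mult_right_mono) auto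
        finally show ?thesis .
      qed
      have space: "real (length (encode arrays)) \<le> C * ?T"
      proof -
        have "real (length (encode arrays)) \<le> 2 ^ 127 * budget" by (rule encode_le)
        also have "\<dots> \<le> C * budget" using C(1) budget_ge(5) by (intro mult_right_mono) auto
        finally show ?thesis by (simp add: budget_def)
      qed
      have find: "\<exists>t. answers w find_prog (encode arrays) (map (letter_code \<Sigma>) \<alpha>) (handle_code le (handle E le \<alpha>)) t \<and>
          real t \<le> C * (real k * ?l)" if \<alpha>: "\<alpha> \<in> mers E k" for \<alpha>
      proof -
        obtain t where t: "t \<le> find_time k ?b"
          "answers w find_prog (encode arrays) (map (letter_code \<Sigma>) \<alpha>) (handle_code le (handle E le \<alpha>)) t"
          using find_answers[OF w \<alpha> b] by blast
        have "t \<le> c * (k * (?b + 1))" using t(1) c(1)[OF k] le_trans by blast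
        then have "real t \<le> real c * (real k * real (?b + 1))" by (metis of_nat_le_iff of_nat_mult)
        then show ?thesis using t(2) cb[of "real k"] by auto
      qed
      have enum: "\<exists>cs t. distinct cs \<and> set cs = out_labels E k \<alpha> \<and>
          answers w enum_prog (encode arrays) (handle_code le (handle E le \<alpha>)) (map (letter_code \<Sigma>) cs) t \<and>
          real t \<le> C * (real (length cs + 1) * ?l)" if \<alpha>: "\<alpha> \<in> mers E k" for \<alpha>
      proof -
        let ?cs = "labels (ends (tl \<alpha>))"
        obtain t where t: "t \<le> enum_time (length ?cs)"
          "answers w enum_prog (encode arrays) (handle_code le (handle E le \<alpha>)) (map (letter_code \<Sigma>) ?cs) t"
          using enum_answers[OF w \<alpha>] by blast
        have "t \<le> c * (length ?cs + 1)" using t(1) c(2) le_trans by blast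
        then have "real t \<le> real c * real (length ?cs + 1)" by (metis of_nat_le_iff of_nat_mult)
        \<comment> \<open>Enumeration takes constant time per label; a factor that is at least 1 is
          inserted to reach the form of the claim.\<close>
        also have "\<dots> \<le> real c * (real (length ?cs + 1) * real (?b + 1))"
          by (intro mult_left_mono) (auto simp: mult_le_cancel_left1)
        also have "\<dots> \<le> C * (real (length ?cs + 1) * ?l)" by (rule cb) simp
        finally show ?thesis using t(2) labels[of "ends (tl \<alpha>)"] out_labels_eq[OF \<alpha> k]
          by (intro exI[of _ ?cs] exI[of _ t]) auto
      qed
      have forward: "\<exists>t. answers w forward_prog (encode arrays) (handle_code le (handle E le \<alpha>) @ [letter_code \<Sigma> d])
            (handle_code le (handle E le \<beta>)) t \<and> real t \<le> C * ?l" if e: "(\<alpha>, \<beta>, d) \<in> dbg_edges E k" for \<alpha> \<beta> d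
      proof -
        from e have \<alpha>: "\<alpha> \<in> mers E k" and \<beta>: "\<beta> = tl \<alpha> @ [d]" "tl \<alpha> @ [d] \<in> mers E k" by (auto simp: dbg_edges_def)
        obtain t where t: "t \<le> forward_time ?b" "answers w forward_prog (encode arrays)
            (handle_code le (handle E le \<alpha>) @ [letter_code \<Sigma> d]) (handle_code le (handle E le \<beta>)) t"
          using forward_answers[OF w \<alpha> \<beta>(2) b] \<beta>(1) by blast
        have "t \<le> c * (?b + 1)" using t(1) c(3) le_trans by blast
        then have "real t \<le> real c * (1 * real (?b + 1))" by (metis mult_1 of_nat_le_iff of_nat_mult)
        then show ?thesis using t(2) cb[of 1] by auto
      qed
      show ?thesis by (intro exI[of _ "encode arrays"] conjI ballI space find enum) (use forward in auto)
    qed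
  qed
qed

end
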